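(* Let $(\mathcal{R}_k)_{k\ge2}$ be the sequence of extremist rules, $\mathcal{R}_k$ of order $k$. The rescaling core of $(\mathcal{R}_k)_{k\ge2}$ is the set of graphons $W$ with $\|W\|_1\neq\tfrac12$. Moreover, for each graphon $W\in\mathcal{W}_0$: (i) if $\|W\|_1>\tfrac12$ then $\Psi^tW=1-e^{-t}(1-W)$ for each $t\ge0$; (ii) if $\|W\|_1<\tfrac12$ then $\Psi^tW=e^{-t}W$ for each $t\ge0$.
   Context: Let $(\Omega,\pi)$ be an atomless probability space with separable $\sigma$-algebra. A kernel is a bounded symmetric measurable $W:\Omega^2\to\mathbb{R}$ (up to a.e. equality); $\mathcal{W}$ is the Banach space of kernels with norm $\|\cdot\|_\infty$; graphons are kernels with values in $[0,1]$; $\mathcal{W}_0$ is the set of graphons; $\|W\|_1=\int|W|\,d\pi^2$; $d_\square(U,W)=\sup_{S,T\subseteq\Omega}|\int_{S\times T}(U-W)\,d\pi^2|$ and the topology induced by it is called the cut-norm topology; $(k)_2=k(k-1)$. $\mathcal{H}_k$ is the set of graphs on $[k]$. A rule of order $k$ is a matrix $\mathcal{R}\in[0,1]^{\mathcal{H}_k\times\mathcal{H}_k}$ with row sums $1$. For a kernel $W$, $F\in\mathcal{H}_k$, distinct $a,b$, $x,y$: $t^{x,y}_{\mathrm{ind}}(F^{a,b},W)=\int\prod_{ij\in E(F)}W(x_i,x_j)\prod_{ij\notin E(F)}(1-W(x_i,x_j))\prod_{i\ne a,b}d\pi(x_i)$ with $x_a=x,x_b=y$. Velocity: $\mathfrak{V}_{\mathcal{R}}W(x,y)=\sum_{F,H}\sum_{a\ne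 b}\mathcal{R}_{F,H}t^{x,y}_{\mathrm{ind}}(F^{a,b},W)(\mathbb{1}[ab\in E(H)\setminus E(F)]-\mathbb{1}[ab\in E(F)\setminus E(H)])$. For a graphon $W$, the trajectory $t\mapsto\Phi^t_{\mathcal{R}}W$, $t\ge0$, is the unique solution of $\frac{d}{dt}\Phi^t_{\mathcal{R}}W=\mathfrak{V}_{\mathcal{R}}(\Phi^t_{\mathcal{R}}W)$ in $(\mathcal{W},\|\cdot\|_\infty)$ with $\Phi^0_{\mathcal{R}}W=W$. The extremist rule of order $k$: $\mathcal{R}_{F,\overline{K_k}}=1$ if $e(F)<\frac12\binom k2$; $\mathcal{R}_{F,K_k}=1$ if $e(F)>\frac12\binom k2$; $\mathcal{R}_{F,F}=1$ if $e(F)=\frac12\binom k2$; other entries $0$. For a sequence $(\mathcal{R}_k)_{k\ge2}$ of rules with $\mathcal{R}_k$ of order $k$, the sequence is rescalable at a graphon $W$ if the limit $\Psi^tW:=\lim_{k\to\infty}\Phi^{t/(k)_2}_{\mathcal{R}_k}W$ exists in $(\mathcal{W},\|\cdot\|_\infty)$ for all $t\in[0,\infty)$. If $\mathcal{B}$ is the set of graphons at which the sequence is rescalable, the rescaling core is the set of graphons $W$ in the interior of $\mathcal{B}$ (in the cut-norm topology on $\mathcal{W}_0$) at which all maps $U\mapsto\Psi^tU$, $t\ge0$, are continuous (in the cut-norm topology). *)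

theory Defs
  imports "HOL-Probability.Probability"
begin

subsection \<open>The ground space\<close>

definition atomless :: "'a measure \<Rightarrow> bool" where
  "atomless M \<longleftrightarrow>
     (\<forall>A\<in>sets M. 0 < emeasure M A \<longrightarrow>
        (\<exists>B\<in>sets M. B \<subseteq> A \<and> 0 < emeasure M B \<and> emeasure M B < emeasure M A))"

text \<open>Separability of the sigma-algebra for the pseudometric \<open>\<mu>(A \<triangle> B)\<close>. Every countably
  generated sigma-algebra is separable in this sense, and so is its completion.\<close>

definition separable_sigma_algebra :: "'a measure \<Rightarrow> bool" where
  "separable_sigma_algebra M \<longleftrightarrow>
     (\<exists>D. countable D \<and> D \<subseteq> sets M \<and>
        (\<forall>A\<in>sets M. \<forall>\<epsilon>>0. \<exists>B\<in>D. measure M ((A - B) \<union> (B - A)) < \<epsilon>))"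


subsection \<open>Kernels and graphons\<close>

text \<open>Kernels are given by representatives. The identification up to almost everywhere equality
  appears as \<open>AE\<close>-equality in the statements, and \<open>linf_norm\<close>, \<open>cut_dist\<close> are the
  (pseudo)norms and pseudometrics on representatives.\<close>

definition kernels :: "'a measure \<Rightarrow> ('a \<times> 'a \<Rightarrow> real) set" where
  "kernels M = {W. W \<in> borel_measurable (M \<Otimes>\<^sub>M M) \<and>
     (\<exists>C. \<forall>x\<in>space M. \<forall>y\<in>space M. \<bar>W (x, y)\<bar> \<le> C) \<and>
     (\<forall>x\<in>space M. \<forall>y\<in>space M. W (x, y) = W (y, x))}"

definition graphons :: "'a measure \<Rightarrow> ('a \<times> 'a \<Rightarrow> real) set" where
  "graphons M = {W \<in> kernels M. AE z in M \<Otimes>\<^sub>M M. 0 \<le> W z \<and> W z \<le> 1}"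

definition linf_norm :: "'a measure \<Rightarrow> ('a \<times> 'a \<Rightarrow> real) \<Rightarrow> ereal" where
  "linf_norm M W = esssup (M \<Otimes>\<^sub>M M) (\<lambda>z. ereal \<bar>W z\<bar>)"

definition l1_norm :: "'a measure \<Rightarrow> ('a \<times> 'a \<Rightarrow> real) \<Rightarrow> real" where
  "l1_norm M W = (\<integral>z. \<bar>W z\<bar> \<partial>(M \<Otimes>\<^sub>M M))"

definition cut_dist :: "'a measure \<Rightarrow> ('a \<times> 'a \<Rightarrow> real) \<Rightarrow> ('a \<times> 'a \<Rightarrow> real) \<Rightarrow> real" where
  "cut_dist M U W =
     (SUP (S, T)\<in>sets M \<times> sets M. \<bar>LINT z:S \<times> T|M \<Otimes>\<^sub>M M. U z - W z\<bar>)"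

definition cut_topology :: "'a measure \<Rightarrow> ('a \<times> 'a \<Rightarrow> real) topology" where
  "cut_topology M = topology (\<lambda>A. A \<subseteq> kernels M \<and>
     (\<forall>W\<in>A. \<exists>\<epsilon>>0. \<forall>U\<in>kernels M. cut_dist M U W < \<epsilon> \<longrightarrow> U \<in> A))"

lemma openin_cut_topology:
  "openin (cut_topology M) A \<longleftrightarrow> A \<subseteq> kernels M \<and>
     (\<forall>W\<in>A. \<exists>\<epsilon>>0. \<forall>U\<in>kernels M. cut_dist M U W < \<epsilon> \<longrightarrow> U \<in> A)"
proof -
  let ?P = "\<lambda>A. A \<subseteq> kernels M \<and>
     (\<forall>W\<in>A. \<exists>\<epsilon>>0. \<forall>U\<in>kernels M. cut_dist M U W < \<epsilon> \<longrightarrow> U \<in> A)"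
  have "istopology ?P"
    unfolding istopology_def
  proof (intro conjI allI impI)
    fix S T assume S: "?P S" and T: "?P T"
    show "S \<inter> T \<subseteq> kernels M" using S by blast
    show "\<forall>W\<in>S \<inter> T. \<exists>\<epsilon>>0. \<forall>U\<in>kernels M. cut_dist M U W < \<epsilon> \<longrightarrow> U \<in> S \<inter> T"
    proof
      fix W assume W: "W \<in> S \<inter> T"
      obtain d where d: "d > 0" "\<forall>U\<in>kernels M. cut_dist M U W < d \<longrightarrow> U \<in> S" using S W by blast
      obtain e where e: "e > 0" "\<forall>U\<in>kernels M. cut_dist M U W < e \<longrightarrow> U \<in> T" using T W by blast
      show "\<exists>\<epsilon>>0. \<forall>U\<in>kernels M. cut_dist M U W < \<epsilon> \<longrightarrow> U \<in> S \<inter> T"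
        by (rule exI[of _ "min d e"]) (use d e in auto)
    qed
  next
    fix K assume K: "\<forall>S\<in>K. ?P S"
    show "\<Union>K \<subseteq> kernels M" using K by blast
    show "\<forall>W\<in>\<Union>K. \<exists>\<epsilon>>0. \<forall>U\<in>kernels M. cut_dist M U W < \<epsilon> \<longrightarrow> U \<in> \<Union>K"
    proof
      fix W assume "W \<in> \<Union>K"
      then obtain S where S: "S \<in> K" "W \<in> S" by blast
      then obtain d where "d > 0" "\<forall>U\<in>kernels M. cut_dist M U W < d \<longrightarrow> U \<in> S" using K by blast
      then show "\<exists>\<epsilon>>0. \<forall>U\<in>kernels M. cut_dist M U W < \<epsilon> \<longrightarrow> U \<in> \<Union>K" using S by blast
    qed
  qed
  then show ?thesis by (simp add: cut_topology_def topology_inverse')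
qed

lemma topspace_cut_topology: "topspace (cut_topology M) = kernels M"
proof -
  have "openin (cut_topology M) (kernels M)"
    by (auto simp: openin_cut_topology intro: exI[of _ 1])
  then show ?thesis
    by (metis openin_cut_topology openin_subset openin_topspace subset_antisym)
qed


subsection \<open>Rules, velocities and trajectories\<close>

text \<open>A graph on \<open>{1..k}\<close> is identified with its set of edges, each edge being a two-element set.\<close>

type_synonym graph = "nat set set"

definition complete_graph_on :: "nat \<Rightarrow> graph" where
  "complete_graph_on k = {e. e \<subseteq> {1..k} \<and> card e = 2}"

definition graphs_on :: "nat \<Rightarrow> graph set" where
  "graphs_on k = Pow (complete_graph_on k)"

definition is_rule :: "nat \<Rightarrow> (graph \<Rightarrow> graph \<Rightarrow> real) \<Rightarrow> bool" where
  "is_rule k R \<longleftrightarrow>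
     (\<forall>F\<in>graphs_on k. (\<forall>H\<in>graphs_on k. 0 \<le> R F H \<and> R F H \<le> 1) \<and> (\<Sum>H\<in>graphs_on k. R F H) = 1)"

definition t_ind ::
  "'a measure \<Rightarrow> nat \<Rightarrow> graph \<Rightarrow> nat \<Rightarrow> nat \<Rightarrow> ('a \<times> 'a \<Rightarrow> real) \<Rightarrow> 'a \<Rightarrow> 'a \<Rightarrow> real" where
  "t_ind M k F a b W x y =
     (\<integral>w. (let v = w(a := x, b := y) in
        (\<Prod>(i, j)\<in>{(i, j). i \<in> {1..k} \<and> j \<in> {1..k} \<and> i < j \<and> {i, j} \<in> F}. W (v i, v j)) *
        (\<Prod>(i, j)\<in>{(i, j). i \<in> {1..k} \<and> j \<in> {1..k} \<and> i < j \<and> {i, j} \<notin> F}. 1 - W (v i, v j)))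
      \<partial>(\<Pi>\<^sub>M i\<in>{1..k} - {a, b}. M))"

definition velocity ::
  "'a measure \<Rightarrow> nat \<Rightarrow> (graph \<Rightarrow> graph \<Rightarrow> real) \<Rightarrow> ('a \<times> 'a \<Rightarrow> real) \<Rightarrow> 'a \<times> 'a \<Rightarrow> real" where
  "velocity M k R W = (\<lambda>(x, y).
     \<Sum>F\<in>graphs_on k. \<Sum>H\<in>graphs_on k.
       \<Sum>(a, b)\<in>{(a, b). a \<in> {1..k} \<and> b \<in> {1..k} \<and> a \<noteq> b}.
         R F H * t_ind M k F a b W x y *
         (of_bool ({a, b} \<in> H - F) - of_bool ({a, b} \<in> F - H)))"

text \<open>The derivative is taken in the \<open>L\<^sup>\<infinity>\<close>-norm; it is one-sided at \<open>t = 0\<close>.\<close>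

definition is_trajectory ::
  "'a measure \<Rightarrow> nat \<Rightarrow> (graph \<Rightarrow> graph \<Rightarrow> real) \<Rightarrow> ('a \<times> 'a \<Rightarrow> real) \<Rightarrow>
     (real \<Rightarrow> 'a \<times> 'a \<Rightarrow> real) \<Rightarrow> bool" where
  "is_trajectory M k R W \<Phi> \<longleftrightarrow>
     (\<forall>t\<ge>0. \<Phi> t \<in> kernels M) \<and>
     (AE z in M \<Otimes>\<^sub>M M. \<Phi> 0 z = W z) \<and>
     (\<forall>t\<ge>0. ((\<lambda>s. linf_norm M (\<lambda>z. (\<Phi> s z - \<Phi> t z) / (s - t) - velocity M k R (\<Phi> t) z))
        \<longlongrightarrow> 0) (at t within {0..}))"

text \<open>The trajectory is unique only up to almost everywhere equality at each time, so a
  representative is chosen; the same applies to \<open>rescaled_flow\<close> below.\<close>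

definition flow ::
  "'a measure \<Rightarrow> nat \<Rightarrow> (graph \<Rightarrow> graph \<Rightarrow> real) \<Rightarrow> real \<Rightarrow> ('a \<times> 'a \<Rightarrow> real) \<Rightarrow>
     'a \<times> 'a \<Rightarrow> real" where
  "flow M k R t W = (SOME \<Phi>. is_trajectory M k R W \<Phi>) t"


subsection \<open>Rescaling\<close>

definition is_rescaled_limit ::
  "'a measure \<Rightarrow> (nat \<Rightarrow> graph \<Rightarrow> graph \<Rightarrow> real) \<Rightarrow> real \<Rightarrow> ('a \<times> 'a \<Rightarrow> real) \<Rightarrow>
     ('a \<times> 'a \<Rightarrow> real) \<Rightarrow> bool" where
  "is_rescaled_limit M R t W U \<longleftrightarrow> U \<in> kernels M \<and>
     (\<lambda>k. linf_norm M (\<lambda>z. flow M k (R k) (t / (real k * (real k - 1))) W z - U z))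
       \<longlonglongrightarrow> 0"

definition rescalable_at ::
  "'a measure \<Rightarrow> (nat \<Rightarrow> graph \<Rightarrow> graph \<Rightarrow> real) \<Rightarrow> ('a \<times> 'a \<Rightarrow> real) \<Rightarrow> bool" where
  "rescalable_at M R W \<longleftrightarrow> (\<forall>t\<ge>0. \<exists>U. is_rescaled_limit M R t W U)"

definition rescaled_flow ::
  "'a measure \<Rightarrow> (nat \<Rightarrow> graph \<Rightarrow> graph \<Rightarrow> real) \<Rightarrow> real \<Rightarrow> ('a \<times> 'a \<Rightarrow> real) \<Rightarrow>
     'a \<times> 'a \<Rightarrow> real" where
  "rescaled_flow M R t W = (SOME U. is_rescaled_limit M R t W U)"

definition rescalable_set ::
  "'a measure \<Rightarrow> (nat \<Rightarrow> graph \<Rightarrow> graph \<Rightarrow> real) \<Rightarrow> ('a \<times> 'a \<Rightarrow> real) set" where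
  "rescalable_set M R = {W \<in> graphons M. rescalable_at M R W}"

definition rescaling_core ::
  "'a measure \<Rightarrow> (nat \<Rightarrow> graph \<Rightarrow> graph \<Rightarrow> real) \<Rightarrow> ('a \<times> 'a \<Rightarrow> real) set" where
  "rescaling_core M R =
     {W \<in> subtopology (cut_topology M) (graphons M) interior_of rescalable_set M R.
        \<forall>t\<ge>0. topcontinuous_at (subtopology (cut_topology M) (rescalable_set M R))
                 (cut_topology M) (rescaled_flow M R t) W}"


subsection \<open>The extremist rules\<close>

definition extremist_rule :: "nat \<Rightarrow> graph \<Rightarrow> graph \<Rightarrow> real" where
  "extremist_rule k F H =
     (if real (card F) < real (k choose 2) / 2 then of_bool (H = {})
      else if real (card F) > real (k choose 2) / 2 then of_bool (H = complete_graph_on k)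
      else of_bool (H = F))"

lemma is_rule_extremist_rule: "is_rule k (extremist_rule k)"
proof -
  have fin: "finite (graphs_on k)"
    unfolding graphs_on_def complete_graph_on_def
    by (rule finite_Pow_iff[THEN iffD2], rule finite_subset[of _ "Pow {1..k}"]) auto
  have *: "(\<Sum>H\<in>graphs_on k. of_bool (H = G) :: real) = 1" if "G \<in> graphs_on k" for G
    using that fin by (simp add: of_bool_def)
  have "{} \<in> graphs_on k" "complete_graph_on k \<in> graphs_on k"
    by (auto simp: graphs_on_def)
  then have G: "\<exists>G\<in>graphs_on k. extremist_rule k F = (\<lambda>H. of_bool (H = G))"
    if "F \<in> graphs_on k" for F
    using that unfolding extremist_rule_def by metis
  show ?thesis
    unfolding is_rule_def
  proof
    fix F assume "F \<in> graphs_on k"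
    then obtain G where "G \<in> graphs_on k" "extremist_rule k F = (\<lambda>H. of_bool (H = G))"
      using G by blast
    then show "(\<forall>H\<in>graphs_on k. 0 \<le> extremist_rule k F H \<and> extremist_rule k F H \<le> 1) \<and>
        (\<Sum>H\<in>graphs_on k. extremist_rule k F H) = 1"
      using * by simp
  qed
qed

end

theory Submission
  imports Defs "HOL-Real_Asymp.Real_Asymp"
begin

text \<open>The velocity at \<open>(x, y)\<close> is a sum over ordered pairs \<open>(a, b)\<close> of expectations over a random
  graph sampled from \<open>W\<close> with the vertices \<open>a\<close>, \<open>b\<close> placed at \<open>x\<close>, \<open>y\<close>. By Chebyshev's inequality its
  number of edges deviates from \<open>\<parallel>W\<parallel>\<^sub>1\<close> times the number of pairs by a fixed proportion only with
  probability \<open>O(1/k)\<close>, uniformly in \<open>W\<close>, \<open>x\<close>, \<open>y\<close>. Hence, away from density one half, the velocity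
  divided by \<open>k (k - 1)\<close> is uniformly close to \<open>c - W\<close>, where \<open>c\<close> is 1 above and 0 below density one
  half. The flow moves the density away from one half, so this persists along the trajectory, which
  is therefore uniformly close to the solution of \<open>w' = c - w\<close>. Because the limits on the two sides of
  density one half differ, continuity fails exactly there.\<close>

subsection \<open>Ordinary differential equations\<close>

text \<open>Kernels are given only up to null sets, and \<open>flow\<close> and
  \<open>rescaled_flow\<close> pick arbitrary representatives, whereas the estimates on the velocity
  are made at single points. The bridge is \<open>strong_trajectory\<close>: a solution with values
  in the unit interval at every point and differentiable in time uniformly over all points. Its
  existence, together with the uniqueness of any other trajectory against it up to null sets,
  transfers pointwise estimates to the flow. The Lipschitz constant behind both facts is exponential
  in k^2, which does no harm: it is used only at fixed k. The limit in k rests on the concentration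
  bound, whose error is relative to k (k - 1) and hence survives the rescaling of time, uniformly in
  t.\<close>

lemma integral_in_closed_subspace:
  fixes f :: "real \<Rightarrow> 'b::banach"
  assumes C: "subspace C" "closed C" and f: "f integrable_on {a..b}"
    and mem: "\<And>s. s \<in> {a..b} \<Longrightarrow> f s \<in> C"
  shows "integral {a..b} f \<in> C"
proof -
  have "(f has_integral integral {a..b} f) (cbox a b)"
    using f by (simp add: integrable_integral)
  note * = has_integral[THEN iffD1, rule_format, OF this]
  \<comment> \<open>Riemann sums are linear combinations of values of \<open>f\<close>, hence lie in
    \<open>C\<close>, and they approximate the gauge integral.\<close>
  have "integral {a..b} f \<in> closure C"
    unfolding closure_approachable
  proof (intro allI impI)
    fix e :: real assume "e > 0"
    from *[OF this] obtain \<gamma> where g: "gauge \<gamma>" and D: "\<forall>D. D tagged_division_of cbox a b \<and> \<gamma> fine D \<longrightarrow>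
      norm ((\<Sum>(x,k) \<in> D. measure lborel k *\<^sub>R f x) - integral {a..b} f) < e"
      by (elim exE conjE)
    obtain p where p: "p tagged_division_of cbox a b" "\<gamma> fine p"
      using fine_division_exists[OF g] by blast
    have "(\<Sum>(x,k) \<in> p. measure lborel k *\<^sub>R f x) \<in> C"
      using C(1) by (rule subspace_sum)
        (use p(1) C(1) mem in \<open>auto intro!: subspace_scale dest: tag_in_interval\<close>)
    then show "\<exists>y\<in>C. dist y (integral {a..b} f) < e"
      using D[rule_format, OF conjI[OF p]] by (auto simp: dist_norm)
  qed
  then show ?thesis using C(2) by simp
qed

text \<open>Picard iteration on the whole half line at once: in the weighted norm sup exp (-2 L t)
  |u t| the integral operator halves distances, so no short time intervals have to be glued. The
  closed subspace \<open>C\<close> is carried along because the vector field of interest is well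
  behaved only on measurable symmetric functions.\<close>

lemma global_ode_solution:
  fixes g :: "'b::banach \<Rightarrow> 'b"
  assumes C: "subspace C" "closed C"
    and maps: "\<And>x. x \<in> C \<Longrightarrow> g x \<in> C"
    and L: "L > 0" and lip: "\<And>x y. x \<in> C \<Longrightarrow> y \<in> C \<Longrightarrow> norm (g x - g y) \<le> L * norm (x - y)"
    and bdd: "\<And>x. x \<in> C \<Longrightarrow> norm (g x) \<le> B"
    and u0: "u0 \<in> C"
  obtains u where "u 0 = u0" "\<And>t. t \<ge> 0 \<Longrightarrow> u t \<in> C"
    "\<And>t. t \<ge> 0 \<Longrightarrow> (u has_vector_derivative g (u t)) (at t within {0..})"
proof -
  \<comment> \<open>The unknown is \<open>v t = exp (- 2 L t) u t\<close>, which turns the weighted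
    norm into the plain supremum norm. \<open>J v\<close> is the Picard iterate of \<open>u\<close>,
    and \<open>h v\<close> is its weighted form, extended to negative times by its value at 0
    because bounded continuous functions live on the whole line.\<close>
  define G where "G v s = g (exp (2 * L * s) *\<^sub>R apply_bcontfun v s)" for v s
  define J where "J v t = u0 + integral {0..t} (G v)" for v :: "real \<Rightarrow>\<^sub>C 'b" and t
  define h where "h v t = exp (- (2 * L * max 0 t)) *\<^sub>R J v (max 0 t)" for v :: "real \<Rightarrow>\<^sub>C 'b" and t
  define S where "S = (PiC UNIV (\<lambda>_. C) :: (real \<Rightarrow>\<^sub>C 'b) set)"
  have B: "B \<ge> 0" using bdd[OF u0] norm_ge_zero order_trans by blast
  have S_iff: "v \<in> S \<longleftrightarrow> (\<forall>t. apply_bcontfun v t \<in> C)" for v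
    by (auto simp: S_def mem_PiC_iff)
  have gcont: "continuous_on C g"
  proof (rule continuous_on_iff[THEN iffD2], intro ballI allI impI)
    fix x e assume x: "x \<in> C" and e: "(e::real) > 0"
    show "\<exists>d>0. \<forall>x'\<in>C. dist x' x < d \<longrightarrow> dist (g x') (g x) < e"
    proof (intro exI[of _ "e / L"] conjI ballI impI)
      show "e / L > 0" using e L by simp
      fix x' assume "x' \<in> C" "dist x' x < e / L"
      then show "dist (g x') (g x) < e"
        using lip[OF _ x, of x'] L by (simp add: dist_norm field_simps)
    qed
  qed
  have inC: "exp (2 * L * s) *\<^sub>R apply_bcontfun v s \<in> C" if "v \<in> S" for v s
    using that C(1) by (simp add: S_iff subspace_scale)
  have Gcont: "continuous_on A (G v)" if "v \<in> S" for v A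
    unfolding G_def
    by (rule continuous_on_compose2[OF gcont]) (use inC[OF that] in \<open>auto intro!: continuous_intros\<close>)
  have Gint: "G v integrable_on {a..b}" if "v \<in> S" for v a b
    by (rule integrable_continuous_real) (rule Gcont[OF that])
  have GB: "norm (G v s) \<le> B" if "v \<in> S" for v s
    unfolding G_def by (rule bdd) (rule inC[OF that])
  have JC: "J v t \<in> C" if "v \<in> S" for v t
    unfolding J_def
    by (intro subspace_add C(1) u0 integral_in_closed_subspace C Gint that)
      (simp add: G_def maps inC that)
  have Jderiv: "(J v has_vector_derivative G v t) (at t within {0..})" if v: "v \<in> S" and t: "t \<ge> 0" for v t
  proof -
    have "((\<lambda>t. integral {0..t} (G v)) has_vector_derivative G v t) (at t within {0..t+1})"
      by (rule integral_has_vector_derivative) (use t Gcont[OF v] in auto)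
    then have "(J v has_vector_derivative 0 + G v t) (at t within {0..t+1})"
      unfolding J_def by (intro derivative_intros)
    moreover have "at t within {0..t+1} = at t within {0..}"
      by (rule at_within_nhd[of _ "{t-1<..<t+1}"]) auto
    ultimately show ?thesis by simp
  qed
  have Jcont: "continuous_on {0..} (J v)" if v: "v \<in> S" for v
    by (rule continuous_on_vector_derivative) (use Jderiv[OF v] in auto)
  have hbc: "h v \<in> bcontfun" if v: "v \<in> S" for v
  proof (rule bcontfun_normI)
    have c: "continuous_on UNIV (\<lambda>t::real. J v (max 0 t))"
      by (rule continuous_on_compose2[OF Jcont[OF v]]) (auto intro!: continuous_intros)
    then show "continuous_on UNIV (h v)"
      unfolding h_def by (intro continuous_intros)
    fix t :: real
    let ?t = "max 0 t"
    have "norm (integral {0..?t} (G v)) \<le> B * (?t - 0)"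
      by (rule integral_bound) (use GB[OF v] Gcont[OF v] in auto)
    then have J: "norm (J v ?t) \<le> norm u0 + B * ?t"
      unfolding J_def by (intro norm_triangle_le) simp
    have e: "exp (- (2 * L * ?t)) \<le> 1" using L by simp
    \<comment> \<open>A bounded vector field lets \<open>J v\<close> grow at most linearly, which
      the exponential weight absorbs.\<close>
    have "2 * L * ?t \<le> exp (2 * L * ?t)" using exp_ge_add_one_self[of "2 * L * ?t"] by linarith
    then have e2: "exp (- (2 * L * ?t)) * ?t \<le> 1 / (2 * L)"
      using L by (simp add: exp_minus field_simps)
    have "norm (h v t) \<le> exp (- (2 * L * ?t)) * (norm u0 + B * ?t)"
      unfolding h_def using J by (simp add: mult_left_mono)
    also have "\<dots> = exp (- (2 * L * ?t)) * norm u0 + B * (exp (- (2 * L * ?t)) * ?t)"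
      by (simp add: algebra_simps)
    also have "\<dots> \<le> 1 * norm u0 + B * (1 / (2 * L))"
      by (intro add_mono mult_right_mono mult_left_mono e e2) (use B in auto)
    finally show "norm (h v t) \<le> 1 * norm u0 + B * (1 / (2 * L))" .
  qed
  define T where "T v = Bcontfun (h v)" for v
  have T_app: "apply_bcontfun (T v) t = h v t" if "v \<in> S" for v t
    unfolding T_def using hbc[OF that] by (simp add: Bcontfun_inverse)
  have TS: "T v \<in> S" if "v \<in> S" for v
    unfolding S_iff T_app[OF that] h_def by (intro allI subspace_scale C(1) JC that)
  have contr: "dist (T v) (T w) \<le> 1/2 * dist v w" if v: "v \<in> S" and w: "w \<in> S" for v w
  proof (rule dist_bound)
    fix t :: real
    let ?t = "max 0 t"
    \<comment> \<open>Origin of the factor 1/2: the weight has rate 2 L, so integrating L exp (2 L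
      s) yields half of the weight.\<close>
    have hi: "((\<lambda>s. L * exp (2 * L * s) * dist v w) has_integral
        (exp (2 * L * ?t) / 2 * dist v w - exp (2 * L * 0) / 2 * dist v w)) {0..?t}"
      by (rule fundamental_theorem_of_calculus)
        (auto intro!: derivative_eq_intros simp: has_real_derivative_iff_has_vector_derivative[symmetric])
    have "norm (integral {0..?t} (\<lambda>s. G v s - G w s)) \<le> integral {0..?t} (\<lambda>s. L * exp (2 * L * s) * dist v w)"
    proof (rule integral_norm_bound_integral)
      show "(\<lambda>s. G v s - G w s) integrable_on {0..?t}" by (intro integrable_diff Gint v w)
      show "(\<lambda>s. L * exp (2 * L * s) * dist v w) integrable_on {0..?t}" using hi by blast
      fix s :: real
      have "norm (G v s - G w s) \<le> L * norm (exp (2 * L * s) *\<^sub>R apply_bcontfun v s - exp (2 * L * s) *\<^sub>R apply_bcontfun w s)"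
        unfolding G_def by (rule lip; rule inC) (fact v w)+
      also have "\<dots> = L * (exp (2 * L * s) * dist (apply_bcontfun v s) (apply_bcontfun w s))"
        by (simp add: dist_norm flip: scaleR_diff_right)
      also have "\<dots> \<le> L * (exp (2 * L * s) * dist v w)"
        using L by (intro mult_left_mono dist_bounded) auto
      finally show "norm (G v s - G w s) \<le> L * exp (2 * L * s) * dist v w" by simp
    qed
    also have "\<dots> = exp (2 * L * ?t) / 2 * dist v w - exp (2 * L * 0) / 2 * dist v w"
      using hi by (rule integral_unique)
    also have "\<dots> \<le> exp (2 * L * ?t) * (dist v w / 2)" by simp
    finally have "norm (J v ?t - J w ?t) \<le> exp (2 * L * ?t) * (dist v w / 2)"
      by (simp add: J_def integral_diff Gint v w)
    then have "exp (- (2 * L * ?t)) * norm (J v ?t - J w ?t)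
      \<le> exp (- (2 * L * ?t)) * (exp (2 * L * ?t) * (dist v w / 2))"
      by (intro mult_left_mono) auto
    also have "\<dots> = dist v w / 2" by (simp add: exp_minus)
    finally show "dist (apply_bcontfun (T v) t) (apply_bcontfun (T w) t) \<le> 1/2 * dist v w"
      by (simp add: T_app v w h_def dist_norm flip: scaleR_diff_right)
  qed
  have closed: "closed S" unfolding S_def by (rule closed_PiC) (rule C(2))
  have "const_bcontfun u0 \<in> S" using u0 by (simp add: S_iff const_bcontfun.rep_eq)
  then have ne: "S \<noteq> {}" by blast
  obtain v where v: "v \<in> S" "T v = v"
    using Banach_fix[OF complete_eq_closed[THEN iffD2, OF closed] ne, of "1/2" T] TS contr
    by (auto simp: image_subset_iff)
  have J_eq: "J v t = exp (2 * L * t) *\<^sub>R apply_bcontfun v t" if "t \<ge> 0" for t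
  proof -
    have "apply_bcontfun v t = exp (- (2 * L * t)) *\<^sub>R J v t"
      using T_app[OF v(1), of t] that by (simp add: v(2) h_def)
    then show ?thesis by (simp flip: exp_add)
  qed
  show thesis
  proof (rule that[of "J v"])
    show "J v 0 = u0" by (simp add: J_def)
    show "J v t \<in> C" for t by (rule JC[OF v(1)])
    show "(J v has_vector_derivative g (J v t)) (at t within {0..})" if "t \<ge> 0" for t
      using Jderiv[OF v(1) that] J_eq[OF that] by (simp add: G_def)
  qed
qed

text \<open>The crossing time is the maximum of the compact set where \<open>f \<le> c\<close>;
  equality there comes from the intermediate value theorem. The barrier arguments below all start
  from it.\<close>

lemma last_crossing:
  fixes f :: "real \<Rightarrow> real"
  assumes cont: "continuous_on {0..} f" and t1: "0 \<le> t1" and f: "f 0 \<le> c" "f t1 > c"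
  obtains t0 where "0 \<le> t0" "t0 < t1" "f t0 = c" "\<And>s. t0 < s \<Longrightarrow> s \<le> t1 \<Longrightarrow> f s > c"
proof -
  define A where "A = {s\<in>{0..t1}. f s \<le> c}"
  have "continuous_on {0..t1} f" using cont by (rule continuous_on_subset) auto
  then have "closed A" unfolding A_def
    by (intro continuous_on_closed_Collect_le continuous_intros) auto
  moreover have "bounded A" unfolding A_def by (rule bounded_subset[of "{0..t1}"]) auto
  moreover have ne: "A \<noteq> {}" using t1 f by (auto simp: A_def)
  ultimately have "compact A" by (simp add: compact_eq_bounded_closed)
  from compact_attains_sup[OF this ne] obtain t0 where t0: "t0 \<in> A" "\<And>s. s \<in> A \<Longrightarrow> s \<le> t0" by blast
  have above: "f s > c" if "t0 < s" "s \<le> t1" for s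
    using t0(2)[of s] that t0(1) by (auto simp: A_def not_le[symmetric])
  have lt: "t0 < t1" using t0(1) f(2) by (cases "t0 = t1") (auto simp: A_def)
  have "f t0 = c"
  proof (rule ccontr)
    assume "f t0 \<noteq> c"
    then have "f t0 < c" using t0(1) by (auto simp: A_def)
    moreover have "continuous_on {t0..t1} f" using cont by (rule continuous_on_subset) (use t0(1) in \<open>auto simp: A_def\<close>)
    ultimately obtain x where "t0 \<le> x" "x \<le> t1" "f x = c"
      using IVT'[of f t0 c t1] lt f(2) by auto
    with above[of x] \<open>f t0 < c\<close> show False by (cases "x = t0") auto
  qed
  then show thesis using that[of t0] t0(1) lt above by (auto simp: A_def)
qed

text \<open>After the last crossing \<open>f\<close> cannot increase. The sign of the derivative is
  asked for only strictly above the barrier, which suits a truncated vector field: its sign is known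
  exactly where the truncation is active.\<close>

lemma stays_le:
  fixes f :: "real \<Rightarrow> real"
  assumes deriv: "\<And>t. t \<ge> 0 \<Longrightarrow> (f has_real_derivative f' t) (at t within {0..})"
    and f0: "f 0 \<le> c" and neg: "\<And>t. t \<ge> 0 \<Longrightarrow> f t > c \<Longrightarrow> f' t \<le> 0" and t: "t \<ge> 0"
  shows "f t \<le> c"
proof (rule ccontr)
  assume "\<not> f t \<le> c"
  have cont: "continuous_on {0..} f" by (rule DERIV_continuous_on) (use deriv in auto)
  then obtain t0 where t0: "0 \<le> t0" "t0 < t" "f t0 = c" "\<And>s. t0 < s \<Longrightarrow> s \<le> t \<Longrightarrow> f s > c"
    by (rule last_crossing[of f t c, OF _ t f0]) (use \<open>\<not> f t \<le> c\<close> in auto)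
  have "f t \<le> f t0"
  proof (rule DERIV_nonpos_imp_decreasing_open[of t0 t f])
    show "t0 \<le> t" using t0 by simp
    show "continuous_on {t0..t} f" by (rule continuous_on_subset[OF cont]) (use t0 in auto)
    fix x assume x: "t0 < x" "x < t"
    have "at x within {0..} = at x" by (rule at_within_interior) (use x t0 in auto)
    then show "\<exists>y. (f has_real_derivative y) (at x) \<and> y \<le> 0"
      using deriv[of x] neg[of x] t0(4)[of x] t0(1) x by auto
  qed
  then show False using t0 \<open>\<not> f t \<le> c\<close> by simp
qed

text \<open>Counterpart for a derivative whose sign is known only on the barrier itself and must
  therefore be strict there: at the last visit to \<open>c\<close> the function would have to rise
  rather than fall.\<close>

lemma stays_ge_of_deriv_pos:
  fixes f :: "real \<Rightarrow> real"
  assumes deriv: "\<And>t. t \<ge> 0 \<Longrightarrow> (f has_real_derivative f' t) (at t within {0..})"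
    and f0: "f 0 \<ge> c" and pos: "\<And>t. t \<ge> 0 \<Longrightarrow> f t = c \<Longrightarrow> f' t > 0" and t: "t \<ge> 0"
  shows "f t \<ge> c"
proof (rule ccontr)
  assume n: "\<not> c \<le> f t"
  have cont: "continuous_on {0..} f" by (rule DERIV_continuous_on) (use deriv in auto)
  then have cont': "continuous_on {0..} (\<lambda>t. - f t)" by (intro continuous_intros)
  obtain t0 where t0: "0 \<le> t0" "t0 < t" "- f t0 = - c" "\<And>s. t0 < s \<Longrightarrow> s \<le> t \<Longrightarrow> - f s > - c"
    by (rule last_crossing[OF cont' t, of "- c"]) (use f0 n in auto)
  have "f' t0 > 0" using pos t0 by simp
  then obtain h where h: "h > 0" "\<And>r. 0 < r \<Longrightarrow> t0 + r \<in> {0..} \<Longrightarrow> r < h \<Longrightarrow> f t0 < f (t0 + r)"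
    using has_real_derivative_pos_inc_right[OF deriv[OF t0(1)]] by blast
  define r where "r = min (h/2) (t - t0)"
  have "f t0 < f (t0 + r)" by (rule h(2)) (use h(1) t0 in \<open>auto simp: r_def min_def\<close>)
  moreover have "- f (t0 + r) > - c" by (rule t0(4)) (use h(1) t0 in \<open>auto simp: r_def min_def\<close>)
  ultimately show False using t0 by simp
qed

text \<open>\<open>d\<close> will be an essential supremum, so its growth is expressed by one-sided
  increments instead of a derivative. The increments are controlled only while
  \<open>d t \<le> 1\<close>, because the Lipschitz estimate for the velocity covers only values
  near the unit interval. The barrier grows at rate \<open>L + 1\<close>, the additional 1 absorbing
  the error \<open>e\<close>.\<close>

lemma local_gronwall_zero:
  fixes d :: "real \<Rightarrow> real"
  assumes cont: "continuous_on {0..} d" and d0: "d 0 \<le> 0" and L: "L \<ge> 0"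
    and step: "\<And>t e. t \<ge> 0 \<Longrightarrow> d t \<le> 1 \<Longrightarrow> e > 0 \<Longrightarrow>
       \<exists>h>0. \<forall>s. t < s \<and> s < t + h \<longrightarrow> d s \<le> d t + (s - t) * (L * d t + e)"
    and t: "t \<ge> 0"
  shows "d t \<le> 0"
proof (rule ccontr)
  assume n: "\<not> d t \<le> 0"
  \<comment> \<open>Chosen so that \<open>b t\<close> is half of \<open>min (d t) 1\<close>: then
    \<open>d\<close> ends above the barrier, while at the crossing, where \<open>d\<close> equals
    \<open>b\<close>, it is below 1 as \<open>step\<close> demands.\<close>
  define \<epsilon> where "\<epsilon> = min (d t) 1 / (2 * exp ((L + 1) * t))"
  define b where "b s = \<epsilon> * exp ((L + 1) * s)" for s
  have eps: "\<epsilon> > 0" using n by (simp add: \<epsilon>_def)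
  have bt: "b t = min (d t) 1 / 2" by (simp add: b_def \<epsilon>_def)
  have bmono: "b s \<le> b t" if "s \<le> t" for s
    unfolding b_def using eps L that by (intro mult_left_mono) auto
  have bge: "\<epsilon> \<le> b s" if "s \<ge> 0" for s
    unfolding b_def using eps L that by simp
  have "continuous_on {0..} (\<lambda>s. d s - b s)" unfolding b_def by (intro continuous_intros cont)
  then obtain t0 where t0: "0 \<le> t0" "t0 < t" "d t0 - b t0 = 0" "\<And>s. t0 < s \<Longrightarrow> s \<le> t \<Longrightarrow> d s - b s > 0"
    by (rule last_crossing[OF _ t, of _ 0]) (use d0 bge[of 0] eps n bt in \<open>auto simp: min_def split: if_splits\<close>)
  have "d t0 \<le> 1" using t0 bmono[of t0] bt by (auto simp: min_def split: if_splits)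
  from step[OF t0(1) this eps] obtain h where h: "h > 0"
    "\<And>s. t0 < s \<Longrightarrow> s < t0 + h \<Longrightarrow> d s \<le> d t0 + (s - t0) * (L * d t0 + \<epsilon>)" by blast
  define s where "s = min (t0 + h / 2) t"
  have s: "t0 < s" "s < t0 + h" "s \<le> t" using h t0 by (auto simp: s_def min_def)
  \<comment> \<open>Since \<open>\<epsilon> \<le> b t0 = d t0\<close>, the slope
    \<open>(L + 1) * b t0\<close> of the barrier dominates \<open>L * d t0 + \<epsilon>\<close>, so
    \<open>d\<close> cannot overtake it.\<close>
  have "b s = b t0 * exp ((L + 1) * (s - t0))"
    by (simp add: b_def algebra_simps flip: exp_add)
  moreover have "b t0 * exp ((L + 1) * (s - t0)) \<ge> b t0 * (1 + (L + 1) * (s - t0))"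
    using bge[OF t0(1)] eps by (intro mult_left_mono exp_ge_add_one_self) auto
  moreover have "(s - t0) * \<epsilon> \<le> (s - t0) * b t0"
    using s bge[OF t0(1)] by (intro mult_left_mono) auto
  ultimately have "d s \<le> b s" using h(2)[OF s(1,2)] t0(3) by (simp add: algebra_simps)
  then show False using t0(4)[OF s(1,3)] by simp
qed

text \<open>An error \<open>K * \<eta>\<close> in the drift, integrated against the decay exp (- K
  s), accumulates to at most \<open>\<eta>\<close>. The bound contains neither \<open>K\<close> nor
  \<open>t\<close>, which is why it is unaffected by the rescaling of time with
  \<open>K = k (k - 1)\<close>.\<close>

lemma perturbed_linear_ode:
  fixes f :: "real \<Rightarrow> real"
  assumes deriv: "\<And>t. t \<ge> 0 \<Longrightarrow> (f has_real_derivative f' t) (at t within {0..})"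
    and K: "K \<ge> 0" "\<eta> \<ge> 0"
    and near: "\<And>t. t \<ge> 0 \<Longrightarrow> \<bar>f' t - K * (c - f t)\<bar> \<le> K * \<eta>" and t: "t \<ge> 0"
  shows "\<bar>f t - (c + exp (- (K * t)) * (f 0 - c))\<bar> \<le> \<eta>"
proof -
  have *: "\<sigma> * (exp (K * t) * (f t - c) - (f 0 - c)) \<le> \<eta> * exp (K * t)" if \<sigma>: "\<sigma> = 1 \<or> \<sigma> = -1" for \<sigma> :: real
  proof -
    \<comment> \<open>With the integrating factor exp (K s), the deviation minus its allowance is
      nonincreasing and starts at \<open>- \<eta>\<close>. The sign \<open>\<sigma>\<close> selects
      the upper or the lower bound.\<close>
    define h where "h s = \<sigma> * (exp (K * s) * (f s - c) - (f 0 - c)) - \<eta> * exp (K * s)" for s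
    have "h t \<le> 0"
    proof (rule stays_le[of h "\<lambda>s. exp (K * s) * (\<sigma> * (f' s - K * (c - f s)) - K * \<eta>)"])
      fix s :: real assume s: "s \<ge> 0"
      show "(h has_real_derivative exp (K * s) * (\<sigma> * (f' s - K * (c - f s)) - K * \<eta>)) (at s within {0..})"
        unfolding h_def
        by (rule derivative_eq_intros deriv[OF s] refl)+ (simp add: algebra_simps)
      have "\<sigma> * (f' s - K * (c - f s)) \<le> K * \<eta>" using near[OF s] \<sigma> by auto
      then show "exp (K * s) * (\<sigma> * (f' s - K * (c - f s)) - K * \<eta>) \<le> 0"
        by (simp add: mult_le_0_iff)
    qed (use K t in \<open>auto simp: h_def\<close>)
    then show ?thesis by (simp add: h_def)
  qed
  have "\<bar>exp (K * t) * (f t - c) - (f 0 - c)\<bar> \<le> \<eta> * exp (K * t)"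
    using *[of 1] *[of "-1"] by (simp add: abs_le_iff)
  then have "exp (- (K * t)) * \<bar>exp (K * t) * (f t - c) - (f 0 - c)\<bar> \<le> exp (- (K * t)) * (\<eta> * exp (K * t))"
    by (intro mult_left_mono) auto
  also have "\<dots> = \<eta>" by (simp add: exp_minus)
  also have "exp (- (K * t)) * \<bar>exp (K * t) * (f t - c) - (f 0 - c)\<bar>
    = \<bar>exp (- (K * t)) * (exp (K * t) * (f t - c) - (f 0 - c))\<bar>" by (simp add: abs_mult)
  also have "exp (- (K * t)) * (exp (K * t) * (f t - c) - (f 0 - c))
    = f t - (c + exp (- (K * t)) * (f 0 - c))"
    by (simp add: right_diff_distrib mult.assoc[symmetric] flip: exp_add)
  finally show ?thesis .
qed

subsection \<open>Independent edges\<close>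

text \<open>The probability that a random subset of \<open>E\<close>, containing each
  \<open>e\<close> independently with probability \<open>q e\<close>, equals \<open>F\<close>. Being
  a polynomial in \<open>q\<close>, it also makes sense outside the unit interval, where general
  kernels may take values.\<close>

definition bernoulli_weight :: "('e \<Rightarrow> real) \<Rightarrow> 'e set \<Rightarrow> 'e set \<Rightarrow> real" where
  "bernoulli_weight q E F = (\<Prod>e\<in>E. if e \<in> F then q e else 1 - q e)"

lemma bernoulli_weight_split:
  assumes "finite E" "F \<subseteq> E"
  shows "bernoulli_weight q E F = (\<Prod>e\<in>F. q e) * (\<Prod>e\<in>E - F. 1 - q e)"
proof -
  have "E \<inter> {e. e \<in> F} = F" "E \<inter> - {e. e \<in> F} = E - F" using assms by auto
  then show ?thesis
    using assms by (simp add: bernoulli_weight_def prod.If_cases)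
qed

lemma bernoulli_weight_nonneg:
  assumes "\<And>e. e \<in> E \<Longrightarrow> 0 \<le> q e \<and> q e \<le> 1"
  shows "bernoulli_weight q E F \<ge> 0"
  unfolding bernoulli_weight_def using assms by (intro prod_nonneg) auto

text \<open>Replacing \<open>1 - q e\<close> by 0 for \<open>e\<close> in \<open>T\<close>
  annihilates the sets that miss part of \<open>T\<close> and leaves the other weights alone; the
  sum over all sets then factors into a product of \<open>q e + g e\<close>.\<close>

lemma sum_bernoulli_weight_superset:
  assumes E: "finite E" and T: "T \<subseteq> E"
  shows "(\<Sum>F\<in>Pow E. bernoulli_weight q E F * of_bool (T \<subseteq> F)) = (\<Prod>e\<in>T. q e)"
proof -
  define g where "g e = (if e \<in> T then 0 else 1 - q e)" for e
  have "bernoulli_weight q E F * of_bool (T \<subseteq> F) = (\<Prod>e\<in>F. q e) * (\<Prod>e\<in>E - F. g e)"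
    if F: "F \<subseteq> E" for F
  proof (cases "T \<subseteq> F")
    case True
    then have "(\<Prod>e\<in>E - F. g e) = (\<Prod>e\<in>E - F. 1 - q e)"
      by (intro prod.cong) (auto simp: g_def)
    then show ?thesis using True bernoulli_weight_split[OF E F] by simp
  next
    case False
    then obtain e where "e \<in> T" "e \<notin> F" by blast
    then have "(\<Prod>e\<in>E - F. g e) = 0"
      using E T by (intro prod_zero) (auto simp: g_def)
    then show ?thesis using False by simp
  qed
  then have "(\<Sum>F\<in>Pow E. bernoulli_weight q E F * of_bool (T \<subseteq> F))
      = (\<Sum>F\<in>Pow E. (\<Prod>e\<in>F. q e) * (\<Prod>e\<in>E - F. g e))"
    by (intro sum.cong) auto
  also have "\<dots> = (\<Prod>e\<in>E. q e + g e)" by (rule prod_add[symmetric, OF E])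
  also have "\<dots> = (\<Prod>e\<in>E. if e \<in> T then q e else 1)"
    by (intro prod.cong) (auto simp: g_def)
  also have "\<dots> = (\<Prod>e\<in>E \<inter> {e. e \<in> T}. q e)"
    using E by (simp add: prod.If_cases)
  also have "E \<inter> {e. e \<in> T} = T" using T by auto
  finally show ?thesis .
qed

lemma sum_bernoulli_weight:
  "finite E \<Longrightarrow> (\<Sum>F\<in>Pow E. bernoulli_weight q E F) = 1"
  using sum_bernoulli_weight_superset[of E "{}" q] by simp

lemma sum_bernoulli_weight_mem:
  "finite E \<Longrightarrow> e \<in> E \<Longrightarrow> (\<Sum>F\<in>Pow E. bernoulli_weight q E F * of_bool (e \<in> F)) = q e"
  using sum_bernoulli_weight_superset[of E "{e}" q] by simp

text \<open>Squared bias plus variance, the variance being at most 1 per edge. The centre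
  \<open>\<mu>\<close> is free because \<open>q\<close> will itself depend on sampled vertices, and
  deviations are measured from a centre independent of the sample.\<close>

lemma bernoulli_second_moment:
  assumes E: "finite E" and q: "\<And>e. e \<in> E \<Longrightarrow> 0 \<le> q e \<and> q e \<le> 1"
  shows "(\<Sum>F\<in>Pow E. bernoulli_weight q E F * (real (card F) - \<mu>)\<^sup>2) \<le> ((\<Sum>e\<in>E. q e) - \<mu>)\<^sup>2 + card E"
proof -
  let ?w = "bernoulli_weight q E" and ?S = "\<Sum>e\<in>E. q e"
  have cardF: "real (card F) = (\<Sum>e\<in>E. of_bool (e \<in> F))" if "F \<in> Pow E" for F
  proof -
    have "E \<inter> F = F" using that by auto
    then show ?thesis using E by (simp add: of_bool_def sum.If_cases)
  qed
  have m1: "(\<Sum>F\<in>Pow E. ?w F * real (card F)) = ?S"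
  proof -
    have "(\<Sum>F\<in>Pow E. ?w F * real (card F)) = (\<Sum>F\<in>Pow E. \<Sum>e\<in>E. ?w F * of_bool (e \<in> F))"
      by (intro sum.cong refl) (simp only: cardF sum_distrib_left)
    also have "\<dots> = (\<Sum>e\<in>E. \<Sum>F\<in>Pow E. ?w F * of_bool (e \<in> F))" by (rule sum.swap)
    also have "\<dots> = ?S" by (intro sum.cong refl sum_bernoulli_weight_mem E)
    finally show ?thesis .
  qed
  have m2: "(\<Sum>F\<in>Pow E. ?w F * (real (card F))\<^sup>2) \<le> ?S\<^sup>2 + card E"
  proof -
    have "(\<Sum>F\<in>Pow E. ?w F * (real (card F))\<^sup>2)
        = (\<Sum>F\<in>Pow E. \<Sum>e\<in>E. \<Sum>f\<in>E. ?w F * of_bool ({e, f} \<subseteq> F))"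
    proof (intro sum.cong refl)
      fix F assume F: "F \<in> Pow E"
      have "(real (card F))\<^sup>2 = (\<Sum>e\<in>E. \<Sum>f\<in>E. of_bool ({e, f} \<subseteq> F))"
        unfolding power2_eq_square cardF[OF F] sum_product by (intro sum.cong) auto
      then show "?w F * (real (card F))\<^sup>2 = (\<Sum>e\<in>E. \<Sum>f\<in>E. ?w F * of_bool ({e, f} \<subseteq> F))"
        by (simp add: sum_distrib_left)
    qed
    also have "\<dots> = (\<Sum>e\<in>E. \<Sum>F\<in>Pow E. \<Sum>f\<in>E. ?w F * of_bool ({e, f} \<subseteq> F))"
      by (rule sum.swap)
    also have "\<dots> = (\<Sum>e\<in>E. \<Sum>f\<in>E. \<Sum>F\<in>Pow E. ?w F * of_bool ({e, f} \<subseteq> F))"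
      by (intro sum.cong refl sum.swap)
    also have "\<dots> = (\<Sum>e\<in>E. \<Sum>f\<in>E. \<Prod>h\<in>{e, f}. q h)"
      by (intro sum.cong refl sum_bernoulli_weight_superset E) auto
    also have "\<dots> \<le> (\<Sum>e\<in>E. \<Sum>f\<in>E. q e * q f + of_bool (e = f))"
    proof (intro sum_mono)
      fix e f assume "e \<in> E" "f \<in> E"
      then show "(\<Prod>h\<in>{e, f}. q h) \<le> q e * q f + of_bool (e = f)"
        using q[of e] by (cases "e = f") (auto intro: add_increasing)
    qed
    also have "\<dots> = ?S\<^sup>2 + card E"
      using E by (simp add: sum.distrib power2_eq_square sum_product of_bool_def)
    finally show ?thesis .
  qed
  have "(\<Sum>F\<in>Pow E. ?w F * (real (card F) - \<mu>)\<^sup>2)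
     = (\<Sum>F\<in>Pow E. ?w F * (real (card F))\<^sup>2) - 2 * \<mu> * (\<Sum>F\<in>Pow E. ?w F * real (card F))
        + \<mu>\<^sup>2 * (\<Sum>F\<in>Pow E. ?w F)"
    by (simp add: sum_distrib_left sum_subtractf[symmetric] sum.distrib[symmetric] power2_diff algebra_simps)
  also have "\<dots> \<le> (?S\<^sup>2 + card E) - 2 * \<mu> * ?S + \<mu>\<^sup>2"
    using m1 m2 sum_bernoulli_weight[OF E] by simp
  finally show ?thesis by (simp add: power2_diff algebra_simps)
qed

text \<open>Dividing by \<open>B\<close> brings all factors into the unit ball, where differences of
  products telescope.\<close>

lemma prod_diff_le:
  fixes z w :: "'e \<Rightarrow> real"
  assumes "finite A" "B \<ge> 1"
    and "\<And>i. i \<in> A \<Longrightarrow> \<bar>z i\<bar> \<le> B" "\<And>i. i \<in> A \<Longrightarrow> \<bar>w i\<bar> \<le> B"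
    and d: "\<And>i. i \<in> A \<Longrightarrow> \<bar>z i - w i\<bar> \<le> \<delta>" "\<delta> \<ge> 0"
  shows "\<bar>prod z A - prod w A\<bar> \<le> B ^ card A * card A * \<delta>"
proof -
  have "\<bar>(\<Prod>i\<in>A. z i / B) - (\<Prod>i\<in>A. w i / B)\<bar> \<le> (\<Sum>i\<in>A. \<bar>z i / B - w i / B\<bar>)"
    using norm_prod_diff[of A "\<lambda>i. z i / B" "\<lambda>i. w i / B"] assms by (simp add: abs_divide divide_le_eq_1)
  also have "\<dots> \<le> (\<Sum>i\<in>A. \<delta>)"
  proof (rule sum_mono)
    fix i assume i: "i \<in> A"
    have "\<bar>z i / B - w i / B\<bar> = \<bar>z i - w i\<bar> / B"
      using assms(2) by (simp add: diff_divide_distrib[symmetric] abs_divide)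
    also have "\<dots> \<le> \<bar>z i - w i\<bar> / 1" using assms(2) by (intro divide_left_mono) auto
    finally show "\<bar>z i / B - w i / B\<bar> \<le> \<delta>" using d(1)[OF i] by simp
  qed
  finally have "\<bar>(\<Prod>i\<in>A. z i / B) - (\<Prod>i\<in>A. w i / B)\<bar> \<le> card A * \<delta>" by simp
  then have "\<bar>(prod z A - prod w A) / B ^ card A\<bar> \<le> card A * \<delta>"
    by (simp add: prod_dividef diff_divide_distrib)
  then show ?thesis using assms(2) by (simp add: abs_divide field_simps)
qed

text \<open>The interval from -1 to 2 is invariant under passing from u to 1 - u, so every factor
  has modulus at most 2. It leaves a margin of 1 around the unit interval for trajectories not yet
  known to stay inside.\<close>

lemma bernoulli_weight_diff_le:
  fixes \<delta> :: real
  assumes "finite E" "\<And>e. e \<in> E \<Longrightarrow> -1 \<le> q e \<and> q e \<le> 2" "\<And>e. e \<in> E \<Longrightarrow> -1 \<le> r e \<and> r e \<le> 2"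
    and "\<And>e. e \<in> E \<Longrightarrow> \<bar>q e - r e\<bar> \<le> \<delta>" "\<delta> \<ge> 0"
  shows "\<bar>bernoulli_weight q E F - bernoulli_weight r E F\<bar> \<le> 2 ^ card E * real (card E) * \<delta>"
  unfolding bernoulli_weight_def
proof (rule prod_diff_le)
  fix e assume e: "e \<in> E"
  show "\<bar>if e \<in> F then q e else 1 - q e\<bar> \<le> 2" using assms(2)[OF e] by auto
  show "\<bar>if e \<in> F then r e else 1 - r e\<bar> \<le> 2" using assms(3)[OF e] by auto
  show "\<bar>(if e \<in> F then q e else 1 - q e) - (if e \<in> F then r e else 1 - r e)\<bar> \<le> \<delta>"
    using assms(4)[OF e] by auto
qed (use assms in auto)

subsection \<open>Edges of the complete graph\<close>

lemma finite_complete_graph_on [simp]: "finite (complete_graph_on k)"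
  unfolding complete_graph_on_def by (rule finite_subset[of _ "Pow {1..k}"]) auto

lemma finite_graphs_on [simp]: "finite (graphs_on k)"
  by (simp add: graphs_on_def)

lemma card_complete_graph_on: "card (complete_graph_on k) = k choose 2"
  unfolding complete_graph_on_def using n_subsets[of "{1..k}" 2] by simp

lemma complete_graph_on_Min_Max:
  assumes "e \<in> complete_graph_on k"
  shows "Min e \<in> {1..k}" "Max e \<in> {1..k}" "Min e < Max e" "e = {Min e, Max e}"
proof -
  obtain i j where ij: "e = {i, j}" "i \<noteq> j" "i \<in> {1..k}" "j \<in> {1..k}"
    using assms by (auto simp: complete_graph_on_def card_2_iff)
  then show "Min e \<in> {1..k}" "Max e \<in> {1..k}" "Min e < Max e" "e = {Min e, Max e}"
    by (auto simp: min_def max_def)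
qed

lemma edge_in_complete_graph_on:
  "a \<in> {1..k} \<Longrightarrow> b \<in> {1..k} \<Longrightarrow> a \<noteq> b \<Longrightarrow> {a, b} \<in> complete_graph_on k"
  by (auto simp: complete_graph_on_def)

lemma prod_ordered_pairs:
  assumes "F \<subseteq> complete_graph_on k"
  shows "(\<Prod>(i, j)\<in>{(i, j). i \<in> {1..k} \<and> j \<in> {1..k} \<and> i < j \<and> {i, j} \<in> F}. h i j)
    = (\<Prod>e\<in>F. h (Min e) (Max e))"
proof -
  have "{Min e, Max e} = e" "Min e \<in> {1..k}" "Max e \<in> {1..k}" "Min e < Max e" if "e \<in> F" for e
    using complete_graph_on_Min_Max[of e k] that assms by auto
  then show ?thesis
    by (intro prod.reindex_bij_witness[of _ "\<lambda>e. (Min e, Max e)" "\<lambda>(i, j). {i, j}"]) auto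
qed

definition vertex_pairs :: "nat \<Rightarrow> (nat \<times> nat) set" where
  "vertex_pairs k = {(a, b). a \<in> {1..k} \<and> b \<in> {1..k} \<and> a \<noteq> b}"

lemma finite_vertex_pairs [simp]: "finite (vertex_pairs k)"
  unfolding vertex_pairs_def by (rule finite_subset[of _ "{1..k} \<times> {1..k}"]) auto

lemma card_vertex_pairs: "real (card (vertex_pairs k)) = real k * (real k - 1)"
proof -
  have "vertex_pairs k = {1..k} \<times> {1..k} - (\<lambda>i. (i, i)) ` {1..k}"
    by (auto simp: vertex_pairs_def)
  then have "card (vertex_pairs k) = card ({1..k} \<times> {1..k}) - card ((\<lambda>i. (i, i)) ` {1..k})"
    by (simp only:) (rule card_Diff_subset, auto)
  also have "card ((\<lambda>i. (i, i)) ` {1..k}) = k" by (subst card_image) (auto simp: inj_on_def)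
  finally have "card (vertex_pairs k) = k * k - k" by (simp add: card_cartesian_product)
  then show ?thesis by (cases k) (auto simp: algebra_simps)
qed

subsection \<open>The velocity as an expectation over sampled vertices\<close>

text \<open>The expected change of the indicator of the edge ab when \<open>F\<close> is replaced by
  a graph drawn from row \<open>F\<close> of the rule.\<close>

definition edge_gain :: "nat \<Rightarrow> (graph \<Rightarrow> graph \<Rightarrow> real) \<Rightarrow> nat \<Rightarrow> nat \<Rightarrow> graph \<Rightarrow> real" where
  "edge_gain k R a b F = (\<Sum>H\<in>graphs_on k. R F H * (of_bool ({a, b} \<in> H - F) - of_bool ({a, b} \<in> F - H)))"

lemma edge_gain_bounds:
  assumes R: "is_rule k R" and F: "F \<in> graphs_on k"
  shows "{a, b} \<in> F \<Longrightarrow> -1 \<le> edge_gain k R a b F \<and> edge_gain k R a b F \<le> 0"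
    and "{a, b} \<notin> F \<Longrightarrow> 0 \<le> edge_gain k R a b F \<and> edge_gain k R a b F \<le> 1"
    and "\<bar>edge_gain k R a b F\<bar> \<le> 1"
proof -
  have nn: "0 \<le> R F H" if "H \<in> graphs_on k" for H using R F that by (auto simp: is_rule_def)
  have s: "(\<Sum>H\<in>graphs_on k. R F H) = 1" using R F by (auto simp: is_rule_def)
  have 1: "-1 \<le> edge_gain k R a b F \<and> edge_gain k R a b F \<le> 0" if "{a, b} \<in> F"
  proof -
    have "edge_gain k R a b F = - (\<Sum>H\<in>graphs_on k. R F H * of_bool ({a, b} \<notin> H))"
      unfolding edge_gain_def sum_negf[symmetric] by (intro sum.cong) (use that in auto)
    moreover have "(\<Sum>H\<in>graphs_on k. R F H * of_bool ({a, b} \<notin> H)) \<le> (\<Sum>H\<in>graphs_on k. R F H)"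
      by (intro sum_mono) (use nn in auto)
    moreover have "(\<Sum>H\<in>graphs_on k. R F H * of_bool ({a, b} \<notin> H)) \<ge> 0"
      by (intro sum_nonneg) (use nn in auto)
    ultimately show ?thesis using s by simp
  qed
  have 2: "0 \<le> edge_gain k R a b F \<and> edge_gain k R a b F \<le> 1" if "{a, b} \<notin> F"
  proof -
    have "edge_gain k R a b F = (\<Sum>H\<in>graphs_on k. R F H * of_bool ({a, b} \<in> H))"
      unfolding edge_gain_def by (intro sum.cong) (use that in auto)
    moreover have "(\<Sum>H\<in>graphs_on k. R F H * of_bool ({a, b} \<in> H)) \<le> (\<Sum>H\<in>graphs_on k. R F H)"
      by (intro sum_mono) (use nn in auto)
    moreover have "(\<Sum>H\<in>graphs_on k. R F H * of_bool ({a, b} \<in> H)) \<ge> 0"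
      by (intro sum_nonneg) (use nn in auto)
    ultimately show ?thesis using s by simp
  qed
  show "{a, b} \<in> F \<Longrightarrow> -1 \<le> edge_gain k R a b F \<and> edge_gain k R a b F \<le> 0"
    "{a, b} \<notin> F \<Longrightarrow> 0 \<le> edge_gain k R a b F \<and> edge_gain k R a b F \<le> 1"
    using 1 2 by blast+
  show "\<bar>edge_gain k R a b F\<bar> \<le> 1" using 1 2 by (cases "{a, b} \<in> F") auto
qed

definition mean_gain :: "nat \<Rightarrow> (graph \<Rightarrow> graph \<Rightarrow> real) \<Rightarrow> nat \<Rightarrow> nat \<Rightarrow> (nat set \<Rightarrow> real) \<Rightarrow> real" where
  "mean_gain k R a b q =
     (\<Sum>F\<in>graphs_on k. edge_gain k R a b F * bernoulli_weight q (complete_graph_on k) F)"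

definition lip_const :: "nat \<Rightarrow> real" where
  "lip_const k = card (graphs_on k) * (2 ^ card (complete_graph_on k) * card (complete_graph_on k))"

lemma lip_const_nonneg: "lip_const k \<ge> 0"
  by (simp add: lip_const_def)

lemma mean_gain_lipschitz:
  fixes \<delta> :: real
  assumes R: "is_rule k R"
    and "\<And>e. e \<in> complete_graph_on k \<Longrightarrow> -1 \<le> q e \<and> q e \<le> 2"
    and "\<And>e. e \<in> complete_graph_on k \<Longrightarrow> -1 \<le> r e \<and> r e \<le> 2"
    and "\<And>e. e \<in> complete_graph_on k \<Longrightarrow> \<bar>q e - r e\<bar> \<le> \<delta>" "\<delta> \<ge> 0"
  shows "\<bar>mean_gain k R a b q - mean_gain k R a b r\<bar> \<le> lip_const k * \<delta>"
proof -
  let ?E = "complete_graph_on k"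
  have diff: "\<bar>bernoulli_weight q ?E F - bernoulli_weight r ?E F\<bar> \<le> 2 ^ card ?E * real (card ?E) * \<delta>" for F
    by (rule bernoulli_weight_diff_le) (use assms in auto)
  have "\<bar>mean_gain k R a b q - mean_gain k R a b r\<bar>
    = \<bar>\<Sum>F\<in>graphs_on k. edge_gain k R a b F * (bernoulli_weight q ?E F - bernoulli_weight r ?E F)\<bar>"
    by (simp add: mean_gain_def sum_subtractf algebra_simps)
  also have "\<dots> \<le> (\<Sum>F\<in>graphs_on k. \<bar>edge_gain k R a b F * (bernoulli_weight q ?E F - bernoulli_weight r ?E F)\<bar>)"
    by (rule sum_abs)
  also have "\<dots> \<le> (\<Sum>F\<in>graphs_on k. 1 * (2 ^ card ?E * real (card ?E) * \<delta>))"
    unfolding abs_mult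
    by (intro sum_mono mult_mono edge_gain_bounds[OF R] diff) auto
  also have "\<dots> = lip_const k * \<delta>" by (simp add: lip_const_def)
  finally show ?thesis .
qed

text \<open>If the edge ab has probability 0, every graph of nonzero weight lacks it, and a missing
  edge can only be gained; dually for probability 1. These two sign conditions are what confines
  trajectories to the unit interval.\<close>

lemma mean_gain_bounds:
  assumes R: "is_rule k R" and ab: "(a, b) \<in> vertex_pairs k"
    and q: "\<And>e. e \<in> complete_graph_on k \<Longrightarrow> 0 \<le> q e \<and> q e \<le> 1"
  shows "\<bar>mean_gain k R a b q\<bar> \<le> 1"
    and "q {a, b} = 0 \<Longrightarrow> mean_gain k R a b q \<ge> 0"
    and "q {a, b} = 1 \<Longrightarrow> mean_gain k R a b q \<le> 0"
proof -
  let ?E = "complete_graph_on k"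
  have e: "{a, b} \<in> ?E" using ab edge_in_complete_graph_on by (auto simp: vertex_pairs_def)
  note nn = bernoulli_weight_nonneg[of ?E q, OF q]
  have "\<bar>mean_gain k R a b q\<bar> \<le> (\<Sum>F\<in>graphs_on k. \<bar>edge_gain k R a b F * bernoulli_weight q ?E F\<bar>)"
    unfolding mean_gain_def by (rule sum_abs)
  also have "\<dots> \<le> (\<Sum>F\<in>graphs_on k. 1 * bernoulli_weight q ?E F)"
    unfolding abs_mult using nn by (intro sum_mono mult_mono edge_gain_bounds[OF R]) auto
  also have "\<dots> = 1" by (simp add: graphs_on_def sum_bernoulli_weight)
  finally show "\<bar>mean_gain k R a b q\<bar> \<le> 1" .
  show "mean_gain k R a b q \<ge> 0" if "q {a, b} = 0"
    unfolding mean_gain_def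
  proof (rule sum_nonneg)
    fix F assume F: "F \<in> graphs_on k"
    show "0 \<le> edge_gain k R a b F * bernoulli_weight q ?E F"
    proof (cases "{a, b} \<in> F")
      case True
      have "bernoulli_weight q ?E F = 0"
        unfolding bernoulli_weight_def by (rule prod_zero) (use e True that in auto)
      then show ?thesis by simp
    qed (use nn edge_gain_bounds(2)[OF R F] in auto)
  qed
  show "mean_gain k R a b q \<le> 0" if "q {a, b} = 1"
    unfolding mean_gain_def
  proof (rule sum_nonpos)
    fix F assume F: "F \<in> graphs_on k"
    show "edge_gain k R a b F * bernoulli_weight q ?E F \<le> 0"
    proof (cases "{a, b} \<in> F")
      case False
      have "bernoulli_weight q ?E F = 0"
        unfolding bernoulli_weight_def by (rule prod_zero) (use e False that in auto)
      then show ?thesis by simp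
    qed (use nn edge_gain_bounds(1)[OF R F] in \<open>auto simp: mult_nonpos_nonneg\<close>)
  qed
qed

text \<open>Reading an edge from its smaller to its larger vertex matches the pairs i < j in
  \<open>t_ind\<close>.\<close>

definition edge_values :: "('a \<times> 'a \<Rightarrow> real) \<Rightarrow> (nat \<Rightarrow> 'a) \<Rightarrow> nat set \<Rightarrow> real" where
  "edge_values W v e = W (v (Min e), v (Max e))"

text \<open>Given the sampled vertices, the edges are independent with probabilities read off from
  \<open>W\<close>, so the integrand of \<open>t_ind\<close> is the weight of
  \<open>F\<close>.\<close>

lemma t_ind_eq_bernoulli_weight:
  assumes F: "F \<in> graphs_on k"
  shows "t_ind M k F a b W x y =
    (\<integral>w. bernoulli_weight (edge_values W (w(a := x, b := y))) (complete_graph_on k) F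
      \<partial>(\<Pi>\<^sub>M i\<in>{1..k} - {a, b}. M))"
proof -
  let ?E = "complete_graph_on k"
  have sub: "F \<subseteq> ?E" using F by (simp add: graphs_on_def)
  have "{(i, j). i \<in> {1..k} \<and> j \<in> {1..k} \<and> i < j \<and> {i, j} \<notin> F}
     = {(i, j). i \<in> {1..k} \<and> j \<in> {1..k} \<and> i < j \<and> {i, j} \<in> ?E - F}"
    using edge_in_complete_graph_on by auto
  then have "(\<Prod>(i, j)\<in>{(i, j). i \<in> {1..k} \<and> j \<in> {1..k} \<and> i < j \<and> {i, j} \<in> F}. W (v i, v j)) *
        (\<Prod>(i, j)\<in>{(i, j). i \<in> {1..k} \<and> j \<in> {1..k} \<and> i < j \<and> {i, j} \<notin> F}. 1 - W (v i, v j))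
      = bernoulli_weight (edge_values W v) ?E F" for v
    using prod_ordered_pairs[OF sub, of "\<lambda>i j. W (v i, v j)"]
      prod_ordered_pairs[of "?E - F" k "\<lambda>i j. 1 - W (v i, v j)"]
    by (simp add: bernoulli_weight_split[OF _ sub] edge_values_def)
  then show ?thesis by (simp add: t_ind_def Let_def)
qed

locale graphon_space = prob_space M for M :: "'a measure"

sublocale graphon_space \<subseteq> sq: pair_prob_space M M ..

lemma (in prob_space) abs_integral_le_const:
  fixes f :: "'a \<Rightarrow> real"
  assumes "\<And>x. x \<in> space M \<Longrightarrow> \<bar>f x\<bar> \<le> B" "B \<ge> 0"
  shows "\<bar>\<integral>x. f x \<partial>M\<bar> \<le> B"
proof (cases "integrable M f")
  case True
  have "\<bar>\<integral>x. f x \<partial>M\<bar> \<le> (\<integral>x. \<bar>f x\<bar> \<partial>M)" by (rule integral_abs_bound)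
  also have "\<dots> \<le> B" by (rule integral_le_const) (use True assms in auto)
  finally show ?thesis .
\<comment> \<open>A non-integrable function has integral 0 by convention, which obeys the bound
  because \<open>B \<ge> 0\<close>.\<close>
qed (use assms in \<open>simp add: not_integrable_integral_eq\<close>)

lemma AE_mono_on_space:
  assumes "AE x in N. P x" "\<And>x. x \<in> space N \<Longrightarrow> P x \<Longrightarrow> Q x"
  shows "AE x in N. Q x"
  using assms(1) by (rule AE_mp) (use assms(2) in auto)

context graphon_space
begin

section \<open>Sampled vertices: measurability, integrability and bounds\<close>

abbreviation samples :: "nat \<Rightarrow> nat \<Rightarrow> nat \<Rightarrow> (nat \<Rightarrow> 'a) measure" where
  "samples k a b \<equiv> (\<Pi>\<^sub>M i\<in>{1..k} - {a, b}. M)"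

lemma prob_space_samples: "prob_space (samples k a b)"
  by (rule prob_space_PiM) (rule prob_space_axioms)

lemma in_space_samples:
  assumes "w \<in> space (samples k a b)" "x \<in> space M" "y \<in> space M" "i \<in> {1..k}"
  shows "(w(a := x, b := y)) i \<in> space M"
proof (cases "i \<in> {a, b}")
  case True
  then show ?thesis using assms(2,3) by (cases "i = b") auto
next
  case False
  then have "w i \<in> space M"
    using PiE_mem[of w "{1..k} - {a, b}" "\<lambda>_. space M" i] assms(1,4) by (simp add: space_PiM)
  then show ?thesis using False by simp
qed

lemma measurable_vertex:
  assumes "i \<in> {1..k}"
  shows "(\<lambda>p. ((snd p)(a := fst (fst p), b := snd (fst p))) i)
    \<in> (M \<Otimes>\<^sub>M M) \<Otimes>\<^sub>M samples k a b \<rightarrow>\<^sub>M M"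
proof (cases "i \<in> {a, b}")
  case True
  then show ?thesis by (cases "i = b") auto
next
  case False
  then have "(\<lambda>p. snd p i) \<in> (M \<Otimes>\<^sub>M M) \<Otimes>\<^sub>M samples k a b \<rightarrow>\<^sub>M M"
    using assms by (intro measurable_compose[OF measurable_snd] measurable_component_singleton) auto
  then show ?thesis using False by simp
qed

lemma measurable_edge_values:
  assumes "W \<in> borel_measurable (M \<Otimes>\<^sub>M M)" "e \<in> complete_graph_on k"
  shows "(\<lambda>p. edge_values W ((snd p)(a := fst (fst p), b := snd (fst p))) e)
    \<in> borel_measurable ((M \<Otimes>\<^sub>M M) \<Otimes>\<^sub>M samples k a b)"
  unfolding edge_values_def
  by (rule measurable_compose[OF _ assms(1)])
    (intro measurable_Pair measurable_vertex complete_graph_on_Min_Max(1,2)[OF assms(2)])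

lemma measurable_bernoulli_weight:
  assumes "\<And>e. e \<in> E \<Longrightarrow> (\<lambda>p. q p e) \<in> borel_measurable N"
  shows "(\<lambda>p. bernoulli_weight (q p) E F) \<in> borel_measurable N"
  unfolding bernoulli_weight_def
proof (rule borel_measurable_prod)
  fix e assume "e \<in> E"
  then show "(\<lambda>p. if e \<in> F then q p e else 1 - q p e) \<in> borel_measurable N"
    using assms[of e] by (cases "e \<in> F") auto
qed

lemma measurable_mean_gain:
  assumes "\<And>e. e \<in> complete_graph_on k \<Longrightarrow> (\<lambda>p. q p e) \<in> borel_measurable N"
  shows "(\<lambda>p. mean_gain k R a b (q p)) \<in> borel_measurable N"
  unfolding mean_gain_def
  by (intro borel_measurable_sum borel_measurable_times borel_measurable_const
      measurable_bernoulli_weight assms)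

lemma measurable_edge_values_sample:
  assumes "W \<in> borel_measurable (M \<Otimes>\<^sub>M M)" "e \<in> complete_graph_on k" "x \<in> space M" "y \<in> space M"
  shows "(\<lambda>w. edge_values W (w(a := x, b := y)) e) \<in> borel_measurable (samples k a b)"
proof -
  have "(\<lambda>w. ((x, y), w)) \<in> samples k a b \<rightarrow>\<^sub>M (M \<Otimes>\<^sub>M M) \<Otimes>\<^sub>M samples k a b"
    by (rule measurable_Pair1') (use assms in \<open>simp add: space_pair_measure\<close>)
  from measurable_compose[OF this measurable_edge_values[OF assms(1,2)]]
  show ?thesis by simp
qed

definition pair_velocity where
  "pair_velocity k R a b W x y =
     (\<integral>w. mean_gain k R a b (edge_values W (w(a := x, b := y))) \<partial>samples k a b)"

lemma kernel_bounded_edge_values: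
  assumes "W \<in> kernels M"
  obtains C where "C \<ge> 0" "\<And>w x y k a b e. w \<in> space (samples k a b) \<Longrightarrow> x \<in> space M \<Longrightarrow> y \<in> space M \<Longrightarrow>
    e \<in> complete_graph_on k \<Longrightarrow> \<bar>edge_values W (w(a := x, b := y)) e\<bar> \<le> C"
proof -
  obtain C where C: "\<forall>x\<in>space M. \<forall>y\<in>space M. \<bar>W (x, y)\<bar> \<le> C"
    using assms by (auto simp: kernels_def)
  show thesis
  proof (rule that[of "\<bar>C\<bar>"])
    fix w x y k a b e assume *: "w \<in> space (samples k a b)" "x \<in> space M" "y \<in> space M" "e \<in> complete_graph_on k"
    have "\<bar>edge_values W (w(a := x, b := y)) e\<bar> \<le> C"
      unfolding edge_values_def
      using C in_space_samples[OF *(1-3)] complete_graph_on_Min_Max(1,2)[OF *(4)] by blast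
    then show "\<bar>edge_values W (w(a := x, b := y)) e\<bar> \<le> \<bar>C\<bar>" by linarith
  qed simp
qed

lemma integrable_bernoulli_weight:
  assumes W: "W \<in> kernels M" and xy: "x \<in> space M" "y \<in> space M"
  shows "integrable (samples k a b)
    (\<lambda>w. bernoulli_weight (edge_values W (w(a := x, b := y))) (complete_graph_on k) F)"
proof -
  interpret S: prob_space "samples k a b" by (rule prob_space_samples)
  obtain C where C: "C \<ge> 0" "\<And>w x y k a b e. w \<in> space (samples k a b) \<Longrightarrow> x \<in> space M \<Longrightarrow> y \<in> space M \<Longrightarrow>
    e \<in> complete_graph_on k \<Longrightarrow> \<bar>edge_values W (w(a := x, b := y)) e\<bar> \<le> C"
    using kernel_bounded_edge_values[OF W] by blast
  have meas: "W \<in> borel_measurable (M \<Otimes>\<^sub>M M)" using W by (simp add: kernels_def)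
  show ?thesis
  proof (rule S.integrable_const_bound[of _ "(1 + C) ^ card (complete_graph_on k)"])
    show "(\<lambda>w. bernoulli_weight (edge_values W (w(a := x, b := y))) (complete_graph_on k) F)
      \<in> borel_measurable (samples k a b)"
      by (rule measurable_bernoulli_weight) (rule measurable_edge_values_sample[OF meas _ xy])
    show "AE w in samples k a b. norm (bernoulli_weight (edge_values W (w(a := x, b := y))) (complete_graph_on k) F)
      \<le> (1 + C) ^ card (complete_graph_on k)"
    proof (rule AE_I2)
      fix w assume w: "w \<in> space (samples k a b)"
      have "\<bar>if e \<in> F then edge_values W (w(a := x, b := y)) e else 1 - edge_values W (w(a := x, b := y)) e\<bar> \<le> 1 + C"
        if "e \<in> complete_graph_on k" for e
        using C(2)[OF w xy that] by (auto simp: abs_le_iff)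
      then have "(\<Prod>e\<in>complete_graph_on k. \<bar>if e \<in> F then edge_values W (w(a := x, b := y)) e else 1 - edge_values W (w(a := x, b := y)) e\<bar>)
         \<le> (\<Prod>e\<in>complete_graph_on k. 1 + C)"
        by (intro prod_mono) auto
      then show "norm (bernoulli_weight (edge_values W (w(a := x, b := y))) (complete_graph_on k) F)
          \<le> (1 + C) ^ card (complete_graph_on k)"
        by (simp add: bernoulli_weight_def abs_prod)
    qed
  qed
qed

lemma integrable_mean_gain:
  assumes W: "W \<in> kernels M" and xy: "x \<in> space M" "y \<in> space M"
  shows "integrable (samples k a b) (\<lambda>w. mean_gain k R c d (edge_values W (w(a := x, b := y))))"
  unfolding mean_gain_def
  by (intro Bochner_Integration.integrable_sum integrable_mult_right integrable_bernoulli_weight assms)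

text \<open>Summing over \<open>H\<close> first turns the rule into \<open>edge_gain\<close>; the
  sum over \<open>F\<close> then moves inside the integral, all weights being integrable because
  kernels are bounded.\<close>

lemma velocity_eq_sum_pair_velocity:
  assumes W: "W \<in> kernels M" and xy: "x \<in> space M" "y \<in> space M"
  shows "velocity M k R W (x, y) = (\<Sum>(a, b)\<in>vertex_pairs k. pair_velocity k R a b W x y)"
proof -
  have pv: "pair_velocity k R a b W x y = (\<Sum>F\<in>graphs_on k. edge_gain k R a b F * t_ind M k F a b W x y)" for a b
  proof -
    have "pair_velocity k R a b W x y = (\<Sum>F\<in>graphs_on k. \<integral>w. edge_gain k R a b F *
      bernoulli_weight (edge_values W (w(a := x, b := y))) (complete_graph_on k) F \<partial>samples k a b)"
      unfolding pair_velocity_def mean_gain_def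
      by (intro Bochner_Integration.integral_sum integrable_mult_right integrable_bernoulli_weight assms)
    also have "\<dots> = (\<Sum>F\<in>graphs_on k. edge_gain k R a b F * t_ind M k F a b W x y)"
      by (intro sum.cong refl) (simp add: t_ind_eq_bernoulli_weight)
    finally show ?thesis .
  qed
  let ?s = "\<lambda>F H a b. of_bool ({a, b} \<in> H - F) - of_bool ({a, b} \<in> F - H) :: real"
  have "velocity M k R W (x, y) = (\<Sum>F\<in>graphs_on k. \<Sum>H\<in>graphs_on k. \<Sum>(a, b)\<in>vertex_pairs k.
      R F H * t_ind M k F a b W x y * ?s F H a b)"
    by (simp add: velocity_def vertex_pairs_def)
  also have "\<dots> = (\<Sum>F\<in>graphs_on k. \<Sum>(a, b)\<in>vertex_pairs k. \<Sum>H\<in>graphs_on k.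
      R F H * t_ind M k F a b W x y * ?s F H a b)"
    unfolding case_prod_beta by (intro sum.cong refl sum.swap)
  also have "\<dots> = (\<Sum>(a, b)\<in>vertex_pairs k. \<Sum>F\<in>graphs_on k. \<Sum>H\<in>graphs_on k.
      R F H * t_ind M k F a b W x y * ?s F H a b)"
    unfolding case_prod_beta by (rule sum.swap)
  also have "\<dots> = (\<Sum>(a, b)\<in>vertex_pairs k. pair_velocity k R a b W x y)"
    unfolding pv edge_gain_def sum_distrib_right case_prod_beta by (intro sum.cong refl) (simp add: mult_ac)
  finally show ?thesis .
qed

lemma measurable_pair_velocity:
  assumes "W \<in> kernels M"
  shows "(\<lambda>z. pair_velocity k R a b W (fst z) (snd z)) \<in> borel_measurable (M \<Otimes>\<^sub>M M)"
proof -
  interpret S: prob_space "samples k a b" by (rule prob_space_samples)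
  have meas: "W \<in> borel_measurable (M \<Otimes>\<^sub>M M)" using assms by (simp add: kernels_def)
  show ?thesis
    unfolding pair_velocity_def
    by (rule S.borel_measurable_lebesgue_integral)
      (unfold case_prod_beta, intro measurable_mean_gain measurable_edge_values meas)
qed

lemma measurable_velocity:
  assumes "W \<in> kernels M"
  shows "velocity M k R W \<in> borel_measurable (M \<Otimes>\<^sub>M M)"
proof -
  have "(\<lambda>z. \<Sum>(a, b)\<in>vertex_pairs k. pair_velocity k R a b W (fst z) (snd z)) \<in> borel_measurable (M \<Otimes>\<^sub>M M)"
    unfolding case_prod_beta by (intro borel_measurable_sum measurable_pair_velocity assms)
  then show ?thesis
    by (rule measurable_cong[THEN iffD1, rotated])
      (auto simp: space_pair_measure velocity_eq_sum_pair_velocity[OF assms])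
qed

lemma pair_velocity_swap: "a \<noteq> b \<Longrightarrow> pair_velocity k R a b W x y = pair_velocity k R b a W y x"
  unfolding pair_velocity_def mean_gain_def edge_gain_def
  by (simp add: insert_commute fun_upd_twist)

lemma velocity_symmetric:
  assumes "W \<in> kernels M" "x \<in> space M" "y \<in> space M"
  shows "velocity M k R W (x, y) = velocity M k R W (y, x)"
  unfolding velocity_eq_sum_pair_velocity[OF assms] velocity_eq_sum_pair_velocity[OF assms(1,3,2)]
  by (rule sum.reindex_bij_witness[of _ prod.swap prod.swap])
    (auto simp: vertex_pairs_def intro: pair_velocity_swap)

text \<open>Symmetry of the kernel enters here: if b < a, the root edge is read as
  \<open>W (y, x)\<close>.\<close>

lemma edge_values_root:
  assumes "W \<in> kernels M" "x \<in> space M" "y \<in> space M" "a \<noteq> b"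
  shows "edge_values W (w(a := x, b := y)) {a, b} = W (x, y)"
  using assms by (auto simp: edge_values_def min_def max_def kernels_def)

lemma edge_values_bounds:
  assumes "\<And>x y. x \<in> space M \<Longrightarrow> y \<in> space M \<Longrightarrow> P (W (x, y))"
    and "w \<in> space (samples k a b)" "x \<in> space M" "y \<in> space M" "e \<in> complete_graph_on k"
  shows "P (edge_values W (w(a := x, b := y)) e)"
  unfolding edge_values_def
  by (intro assms(1) in_space_samples[OF assms(2-4)] complete_graph_on_Min_Max(1,2)[OF assms(5)])

lemma abs_sum_vertex_pairs_le:
  assumes "\<And>a b. (a, b) \<in> vertex_pairs k \<Longrightarrow> \<bar>h a b\<bar> \<le> (B::real)"
  shows "\<bar>\<Sum>(a, b)\<in>vertex_pairs k. h a b\<bar> \<le> real k * (real k - 1) * B"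
proof -
  have "\<bar>\<Sum>(a, b)\<in>vertex_pairs k. h a b\<bar> \<le> (\<Sum>(a, b)\<in>vertex_pairs k. \<bar>h a b\<bar>)"
    unfolding case_prod_beta by (rule sum_abs)
  also have "\<dots> \<le> (\<Sum>z\<in>vertex_pairs k. B)" by (intro sum_mono) (use assms in auto)
  finally show ?thesis by (simp add: card_vertex_pairs)
qed

lemma velocity_lipschitz:
  assumes R: "is_rule k R" and U: "U \<in> kernels M" and W: "W \<in> kernels M"
    and Ub: "\<And>x y. x \<in> space M \<Longrightarrow> y \<in> space M \<Longrightarrow> -1 \<le> U (x, y) \<and> U (x, y) \<le> 2"
    and Wb: "\<And>x y. x \<in> space M \<Longrightarrow> y \<in> space M \<Longrightarrow> -1 \<le> W (x, y) \<and> W (x, y) \<le> 2"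
    and d: "\<And>x y. x \<in> space M \<Longrightarrow> y \<in> space M \<Longrightarrow> \<bar>U (x, y) - W (x, y)\<bar> \<le> \<delta>" "\<delta> \<ge> 0"
    and xy: "x \<in> space M" "y \<in> space M"
  shows "\<bar>velocity M k R U (x, y) - velocity M k R W (x, y)\<bar> \<le> real k * (real k - 1) * (lip_const k * \<delta>)"
proof -
  have "\<bar>pair_velocity k R a b U x y - pair_velocity k R a b W x y\<bar> \<le> lip_const k * \<delta>" for a b
  proof -
    interpret S: prob_space "samples k a b" by (rule prob_space_samples)
    have "pair_velocity k R a b U x y - pair_velocity k R a b W x y =
      (\<integral>w. mean_gain k R a b (edge_values U (w(a := x, b := y))) -
          mean_gain k R a b (edge_values W (w(a := x, b := y))) \<partial>samples k a b)"
      unfolding pair_velocity_def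
      by (intro Bochner_Integration.integral_diff[symmetric] integrable_mean_gain U W xy)
    also have "\<bar>\<dots>\<bar> \<le> lip_const k * \<delta>"
    proof (rule S.abs_integral_le_const)
      fix w assume w: "w \<in> space (samples k a b)"
      show "\<bar>mean_gain k R a b (edge_values U (w(a := x, b := y))) -
          mean_gain k R a b (edge_values W (w(a := x, b := y)))\<bar> \<le> lip_const k * \<delta>"
      proof (rule mean_gain_lipschitz[OF R _ _ _ d(2)])
        fix e assume e: "e \<in> complete_graph_on k"
        show "-1 \<le> edge_values U (w(a := x, b := y)) e \<and> edge_values U (w(a := x, b := y)) e \<le> 2"
          by (rule edge_values_bounds[where P = "\<lambda>u. -1 \<le> u \<and> u \<le> 2" and W = U, OF Ub w xy e])
        show "-1 \<le> edge_values W (w(a := x, b := y)) e \<and> edge_values W (w(a := x, b := y)) e \<le> 2"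
          by (rule edge_values_bounds[where P = "\<lambda>u. -1 \<le> u \<and> u \<le> 2" and W = W, OF Wb w xy e])
        show "\<bar>edge_values U (w(a := x, b := y)) e - edge_values W (w(a := x, b := y)) e\<bar> \<le> \<delta>"
          unfolding edge_values_def
          by (intro d(1) in_space_samples[OF w xy] complete_graph_on_Min_Max(1,2)[OF e])
      qed
    qed (use d(2) lip_const_nonneg in auto)
    finally show ?thesis .
  qed
  then show ?thesis
    unfolding velocity_eq_sum_pair_velocity[OF U xy] velocity_eq_sum_pair_velocity[OF W xy]
      case_prod_beta sum_subtractf[symmetric]
    using abs_sum_vertex_pairs_le[of k "\<lambda>a b. pair_velocity k R a b U x y - pair_velocity k R a b W x y"]
    by (simp add: case_prod_beta)
qed

text \<open>In every sample the root edge has probability \<open>W (x, y)\<close>, so where this is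
  0 or 1 each ordered pair pushes back into the unit interval; elsewhere each pair contributes at
  most 1 in modulus.\<close>

lemma velocity_bounds:
  assumes R: "is_rule k R" and W: "W \<in> kernels M"
    and Wb: "\<And>x y. x \<in> space M \<Longrightarrow> y \<in> space M \<Longrightarrow> 0 \<le> W (x, y) \<and> W (x, y) \<le> 1"
    and xy: "x \<in> space M" "y \<in> space M"
  shows "\<bar>velocity M k R W (x, y)\<bar> \<le> real k * (real k - 1)"
    and "W (x, y) = 0 \<Longrightarrow> velocity M k R W (x, y) \<ge> 0"
    and "W (x, y) = 1 \<Longrightarrow> velocity M k R W (x, y) \<le> 0"
proof -
  have b: "0 \<le> edge_values W (w(a := x, b := y)) e \<and> edge_values W (w(a := x, b := y)) e \<le> 1"
    if "w \<in> space (samples k a b)" "e \<in> complete_graph_on k" for w a b e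
    by (rule edge_values_bounds[where P = "\<lambda>u. 0 \<le> u \<and> u \<le> 1" and W = W, OF Wb that(1) xy that(2)])
  have "\<bar>pair_velocity k R a b W x y\<bar> \<le> 1" if "(a, b) \<in> vertex_pairs k" for a b
    unfolding pair_velocity_def
    by (rule prob_space.abs_integral_le_const[OF prob_space_samples])
      (use mean_gain_bounds(1)[OF R that b] in auto)
  then show "\<bar>velocity M k R W (x, y)\<bar> \<le> real k * (real k - 1)"
    unfolding velocity_eq_sum_pair_velocity[OF W xy]
    using abs_sum_vertex_pairs_le[of k "\<lambda>a b. pair_velocity k R a b W x y" 1] by simp
  have root: "edge_values W (w(a := x, b := y)) {a, b} = W (x, y)" if "(a, b) \<in> vertex_pairs k" for w a b
    using edge_values_root[OF W xy] that by (auto simp: vertex_pairs_def)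
  show "velocity M k R W (x, y) \<ge> 0" if "W (x, y) = 0"
    unfolding velocity_eq_sum_pair_velocity[OF W xy] pair_velocity_def case_prod_beta
  proof (intro sum_nonneg Bochner_Integration.integral_nonneg)
    fix p w assume p: "p \<in> vertex_pairs k" and w: "w \<in> space (samples k (fst p) (snd p))"
    then show "0 \<le> mean_gain k R (fst p) (snd p) (edge_values W (w(fst p := x, snd p := y)))"
      using mean_gain_bounds(2)[OF R, of "fst p" "snd p", OF _ b[OF w]] root[of "fst p" "snd p"] that by simp
  qed
  have "(\<integral>w. mean_gain k R a b (edge_values W (w(a := x, b := y))) \<partial>samples k a b) \<le> 0"
    if ab: "(a, b) \<in> vertex_pairs k" and "W (x, y) = 1" for a b
  proof -
    have "0 \<le> (\<integral>w. - mean_gain k R a b (edge_values W (w(a := x, b := y))) \<partial>samples k a b)"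
      by (rule Bochner_Integration.integral_nonneg)
        (use mean_gain_bounds(3)[OF R ab b] root[OF ab] that in auto)
    then show ?thesis by simp
  qed
  then show "velocity M k R W (x, y) \<le> 0" if "W (x, y) = 1"
    unfolding velocity_eq_sum_pair_velocity[OF W xy] pair_velocity_def
    by (intro sum_nonpos) (use that in auto)
qed

section \<open>Independence of the velocity from the representative of the kernel\<close>

lemma distr_PiM_pair:
  assumes "i \<in> I" "j \<in> I" "i \<noteq> j"
  shows "distr (\<Pi>\<^sub>M i\<in>I. M) (M \<Otimes>\<^sub>M M) (\<lambda>w. (w i, w j)) = M \<Otimes>\<^sub>M M"
proof (rule pair_measure_eqI[symmetric])
  interpret P: product_prob_space "\<lambda>_. M" I ..
  show "sigma_finite_measure M" ..
  then show "sigma_finite_measure M" .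
  fix A B assume A: "A \<in> sets M" and B: "B \<in> sets M"
  have meas: "(\<lambda>w. (w i, w j)) \<in> (\<Pi>\<^sub>M i\<in>I. M) \<rightarrow>\<^sub>M M \<Otimes>\<^sub>M M"
    by (intro measurable_Pair measurable_component_singleton assms)
  have "emeasure (distr (\<Pi>\<^sub>M i\<in>I. M) (M \<Otimes>\<^sub>M M) (\<lambda>w. (w i, w j))) (A \<times> B)
    = emeasure (\<Pi>\<^sub>M i\<in>I. M) {w\<in>space (\<Pi>\<^sub>M i\<in>I. M). \<forall>l\<in>{i, j}. w l \<in> (if l = i then A else B)}"
    using A B assms(3) by (subst emeasure_distr[OF meas]) (auto intro!: arg_cong[where f = "emeasure _"])
  also have "\<dots> = (\<Prod>l\<in>{i, j}. emeasure M (if l = i then A else B))"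
    by (rule P.emeasure_PiM_Collect) (use assms A B in auto)
  also have "\<dots> = emeasure M A * emeasure M B" using assms(3) by simp
  finally show "emeasure M A * emeasure M B = emeasure (distr (\<Pi>\<^sub>M i\<in>I. M) (M \<Otimes>\<^sub>M M) (\<lambda>w. (w i, w j))) (A \<times> B)"
    by simp
qed simp

lemma AE_fst: "AE x in M. P x \<Longrightarrow> AE z in M \<Otimes>\<^sub>M M. P (fst z)"
  by (rule AE_distrD[of fst "M \<Otimes>\<^sub>M M" M P]) (simp, subst distr_pair_fst)

lemma AE_snd:
  assumes "AE x in M. P x"
  shows "AE z in M \<Otimes>\<^sub>M M. P (snd z)"
proof -
  have "AE z in distr (M \<Otimes>\<^sub>M M) (M \<Otimes>\<^sub>M M) (\<lambda>(x, y). (y, x)). P (fst z)"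
    unfolding sq.distr_pair_swap[symmetric] by (rule AE_fst[OF assms])
  then have "AE z in M \<Otimes>\<^sub>M M. P (fst (case z of (x, y) \<Rightarrow> (y, x)))"
    by (rule AE_distrD[rotated]) (rule measurable_pair_swap')
  then show ?thesis by (simp add: case_prod_beta)
qed

text \<open>Three kinds of edges occur. Without a root, the two endpoints have joint law
  \<open>M \<Otimes>\<^sub>M M\<close>, so a null set of pairs stays null. With one root, almost
  every slice of the null set is null. The root edge is the point (x, y) itself, possibly
  swapped.\<close>

lemma AE_edge_values_cong:
  assumes U: "U \<in> kernels M" and W: "W \<in> kernels M" and eq: "AE z in M \<Otimes>\<^sub>M M. U z = W z"
    and e: "e \<in> complete_graph_on k"
  shows "AE z in M \<Otimes>\<^sub>M M. AE w in samples k a b.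
    edge_values U (w(a := fst z, b := snd z)) e = edge_values W (w(a := fst z, b := snd z)) e"
proof -
  define Q where "Q x y \<longleftrightarrow> U (x, y) = W (x, y)" for x y
  have Qsym: "Q x y \<longleftrightarrow> Q y x" if "x \<in> space M" "y \<in> space M" for x y
    using U W that unfolding Q_def kernels_def by auto
  have one: "AE x in M. AE w in samples k a b. Q x (w j)" if j: "j \<in> {1..k} - {a, b}" for j
  proof -
    have "AE x in M. AE y in M. Q x y" using sq.AE_pair[OF eq] by (simp add: Q_def)
    then show ?thesis
    proof (rule AE_mono_on_space)
      fix x assume "AE y in M. Q x y"
      then show "AE w in samples k a b. Q x (w j)"
        using AE_PiM_component[of "{1..k} - {a, b}" "\<lambda>_. M" j "Q x"] j prob_space_axioms by auto
    qed
  qed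
  have two: "AE w in samples k a b. Q (w i) (w j)" if ij: "i \<in> {1..k} - {a, b}" "j \<in> {1..k} - {a, b}" "i \<noteq> j" for i j
  proof -
    have "AE z in distr (samples k a b) (M \<Otimes>\<^sub>M M) (\<lambda>w. (w i, w j)). U z = W z"
      unfolding distr_PiM_pair[OF ij] by (rule eq)
    then have "AE w in samples k a b. U (w i, w j) = W (w i, w j)"
      by (rule AE_distrD[rotated]) (intro measurable_Pair measurable_component_singleton ij)
    then show ?thesis by (simp add: Q_def)
  qed
  \<comment> \<open>An edge with exactly one root is treated with the root in first place, as the
    slices in \<open>one\<close> require. The opposite orientation is reduced to this one by
    \<open>Qsym\<close>.\<close>
  have gen: "AE z in M \<Otimes>\<^sub>M M. AE w in samples k a b.
      Q ((w(a := fst z, b := snd z)) i) ((w(a := fst z, b := snd z)) j)"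
    if ij: "i \<in> {1..k}" "j \<in> {1..k}" "i \<noteq> j" and first: "i \<in> {a, b} \<or> j \<notin> {a, b}" for i j
  proof -
    consider "i \<notin> {a, b}" "j \<notin> {a, b}" | "i \<in> {a, b}" "j \<notin> {a, b}"
      | "i = a" "j = b" | "i = b" "j = a" using first ij(3) by auto
    then show ?thesis
    proof cases
      case 1
      with two[of i j] ij show ?thesis by simp
    next
      case 2
      have f: "AE x in M. AE w in samples k a b. Q x (w j)" using one[of j] 2 ij by auto
      show ?thesis
      proof (cases "i = b")
        case True
        then show ?thesis using AE_snd[OF f] 2 by simp
      next
        case False
        then have "i = a" using 2 by auto
        then show ?thesis using AE_fst[OF f] 2 False by simp
      qed
    next
      case 3
      then show ?thesis using eq ij by (auto simp: Q_def elim!: AE_mp)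
    next
      case 4
      have "AE z in M \<Otimes>\<^sub>M M. Q (snd z) (fst z)"
        using eq
      proof (rule AE_mono_on_space)
        fix z assume "z \<in> space (M \<Otimes>\<^sub>M M)" "U z = W z"
        then show "Q (snd z) (fst z)" using Qsym[of "fst z" "snd z"]
          by (auto simp: Q_def space_pair_measure)
      qed
      then show ?thesis using 4 ij by (auto elim!: AE_mp)
    qed
  qed
  let ?i = "Min e" and ?j = "Max e"
  note ij = complete_graph_on_Min_Max(1-3)[OF e]
  show ?thesis
  proof (cases "?i \<in> {a, b} \<or> ?j \<notin> {a, b}")
    case True
    then show ?thesis using gen[of ?i ?j] ij by (auto simp: Q_def edge_values_def)
  next
    case False
    then have "AE z in M \<Otimes>\<^sub>M M. AE w in samples k a b.
      Q ((w(a := fst z, b := snd z)) ?j) ((w(a := fst z, b := snd z)) ?i)"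
      using gen[of ?j ?i] ij by auto
    then show ?thesis
    proof (rule AE_mono_on_space)
      fix z assume z: "z \<in> space (M \<Otimes>\<^sub>M M)" and
        "AE w in samples k a b. Q ((w(a := fst z, b := snd z)) ?j) ((w(a := fst z, b := snd z)) ?i)"
      from this(2) show "AE w in samples k a b. edge_values U (w(a := fst z, b := snd z)) e = edge_values W (w(a := fst z, b := snd z)) e"
      proof (rule AE_mono_on_space)
        fix w assume w: "w \<in> space (samples k a b)"
          and "Q ((w(a := fst z, b := snd z)) ?j) ((w(a := fst z, b := snd z)) ?i)"
        then show "edge_values U (w(a := fst z, b := snd z)) e = edge_values W (w(a := fst z, b := snd z)) e"
          using Qsym[OF in_space_samples[OF w _ _ ij(1)] in_space_samples[OF w _ _ ij(2)], of "fst z" "snd z" "fst z" "snd z"] z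
          unfolding edge_values_def Q_def by (auto simp: space_pair_measure mem_Times_iff)
      qed
    qed
  qed
qed

text \<open>Only finitely many pairs and edges are involved, so the exceptional null sets combine. A
  kernel may thus be altered on a null set before its velocity is estimated.\<close>

lemma AE_velocity_cong:
  assumes U: "U \<in> kernels M" and W: "W \<in> kernels M" and eq: "AE z in M \<Otimes>\<^sub>M M. U z = W z"
  shows "AE z in M \<Otimes>\<^sub>M M. velocity M k R U z = velocity M k R W z"
proof -
  let ?c = "\<lambda>z w a b e. edge_values U (w(a := fst z, b := snd z)) e = edge_values W (w(a := fst z, b := snd z)) e"
  have "AE z in M \<Otimes>\<^sub>M M. \<forall>p\<in>vertex_pairs k. \<forall>e\<in>complete_graph_on k.
      AE w in samples k (fst p) (snd p). ?c z w (fst p) (snd p) e"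
    by (intro AE_finite_allI AE_edge_values_cong[OF U W eq]) auto
  then show ?thesis
  proof (rule AE_mono_on_space)
    fix z assume z: "z \<in> space (M \<Otimes>\<^sub>M M)"
      and c: "\<forall>p\<in>vertex_pairs k. \<forall>e\<in>complete_graph_on k. AE w in samples k (fst p) (snd p). ?c z w (fst p) (snd p) e"
    obtain x y where [simp]: "z = (x, y)" by (cases z)
    have xy: "x \<in> space M" "y \<in> space M" using z by (auto simp: space_pair_measure)
    have "pair_velocity k R a b U x y = pair_velocity k R a b W x y" if "(a, b) \<in> vertex_pairs k" for a b
      unfolding pair_velocity_def
    proof (rule integral_cong_AE)
      show "(\<lambda>w. mean_gain k R a b (edge_values U (w(a := x, b := y)))) \<in> borel_measurable (samples k a b)"
        "(\<lambda>w. mean_gain k R a b (edge_values W (w(a := x, b := y)))) \<in> borel_measurable (samples k a b)"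
        using integrable_mean_gain[OF U xy] integrable_mean_gain[OF W xy] by auto
      have "AE w in samples k a b. \<forall>e\<in>complete_graph_on k. ?c z w a b e"
        by (rule AE_finite_allI) (simp, rule c[rule_format, of "(a, b)", unfolded fst_conv snd_conv, OF that])
      then show "AE w in samples k a b. mean_gain k R a b (edge_values U (w(a := x, b := y)))
        = mean_gain k R a b (edge_values W (w(a := x, b := y)))"
      proof (rule AE_mono_on_space)
        fix w assume "\<forall>e\<in>complete_graph_on k. ?c z w a b e"
        then show "mean_gain k R a b (edge_values U (w(a := x, b := y)))
        = mean_gain k R a b (edge_values W (w(a := x, b := y)))"
          unfolding mean_gain_def bernoulli_weight_def
          by (intro sum.cong refl arg_cong2[where f = "(*)"] prod.cong) auto
      qed
    qed
    then show "velocity M k R U z = velocity M k R W z"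
      by (auto simp: velocity_eq_sum_pair_velocity U W xy intro: sum.cong)
  qed
qed

end

lemma has_real_derivative_withinI_estimate:
  fixes f :: "real \<Rightarrow> real"
  assumes "\<And>e. e > 0 \<Longrightarrow> \<exists>d>0. \<forall>s\<in>S. \<bar>s - t\<bar> < d \<longrightarrow> \<bar>f s - f t - (s - t) * D\<bar> \<le> e * \<bar>s - t\<bar>"
  shows "(f has_real_derivative D) (at t within S)"
  unfolding has_field_derivative_def has_derivative_within_alt
  using assms by (auto intro!: bounded_linear_mult_right simp: mult.commute)

text \<open>Trajectories will take values in a space of bounded functions, to which
  \<open>global_ode_solution\<close> has to apply.\<close>

instance bcontfun :: (metric_space, banach) banach ..

context graphon_space
begin

subsection \<open>Existence of trajectories\<close>

lemma kernelsD:
  assumes "W \<in> kernels M"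
  shows "W \<in> borel_measurable (M \<Otimes>\<^sub>M M)" "\<exists>C. \<forall>x\<in>space M. \<forall>y\<in>space M. \<bar>W (x, y)\<bar> \<le> C"
    "\<And>x y. x \<in> space M \<Longrightarrow> y \<in> space M \<Longrightarrow> W (x, y) = W (y, x)"
  using assms by (auto simp: kernels_def)

text \<open>Demanded at every point rather than almost everywhere, so that all edge probabilities of
  all samples are genuine probabilities.\<close>

definition unit_valued :: "('a \<times> 'a \<Rightarrow> real) \<Rightarrow> bool" where
  "unit_valued W \<longleftrightarrow> (\<forall>x\<in>space M. \<forall>y\<in>space M. 0 \<le> W (x, y) \<and> W (x, y) \<le> 1)"

lemma unit_valuedD: "unit_valued W \<Longrightarrow> x \<in> space M \<Longrightarrow> y \<in> space M \<Longrightarrow> 0 \<le> W (x, y) \<and> W (x, y) \<le> 1"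
  by (simp add: unit_valued_def)

text \<open>A version of \<open>is_trajectory\<close> without exceptional null sets. The derivative
  estimate is uniform over all points, so it can be evaluated at a single pair as well as integrated
  over the space; multiplied out by \<open>\<bar>s - t\<bar>\<close>, it includes
  \<open>s = t\<close>.\<close>

definition strong_trajectory where
  "strong_trajectory k R W u \<longleftrightarrow>
     (\<forall>t\<ge>0. u t \<in> kernels M \<and> unit_valued (u t)) \<and>
     (\<forall>x\<in>space M. \<forall>y\<in>space M. u 0 (x, y) = W (x, y)) \<and>
     (\<forall>t\<ge>0. \<forall>e>0. \<exists>d>0. \<forall>s\<in>{0..}. \<bar>s - t\<bar> < d \<longrightarrow> (\<forall>x\<in>space M. \<forall>y\<in>space M.
        \<bar>u s (x, y) - u t (x, y) - (s - t) * velocity M k R (u t) (x, y)\<bar> \<le> e * \<bar>s - t\<bar>))"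

text \<open>Picard iteration takes place in the Banach space of all bounded functions on pairs of points,
  obtained as bounded continuous functions for the discrete topology. The velocity is composed with
  truncation to the unit interval to make it globally Lipschitz; the sign of the velocity at the
  values 0 and 1 then shows that the truncation is never active.\<close>

lemma strong_trajectory_exists:
  assumes R: "is_rule k R" and W: "W \<in> kernels M" "unit_valued W"
  obtains u where "strong_trajectory k R W u"
proof -
  define app :: "('a \<times> 'a) discrete \<Rightarrow>\<^sub>C real \<Rightarrow> 'a \<times> 'a \<Rightarrow> real"
    where "app f z = apply_bcontfun f (discrete z)" for f z
  \<comment> \<open>Boundedness is automatic in the ambient space, so \<open>C\<close> singles out
    the measurable symmetric functions. Both properties survive pointwise limits, which makes
    \<open>C\<close> closed.\<close>
  define C where "C = {f. app f \<in> kernels M}"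
  define cl :: "('a \<times> 'a) discrete \<Rightarrow>\<^sub>C real \<Rightarrow> 'a \<times> 'a \<Rightarrow> real"
    where "cl f z = max 0 (min 1 (app f z))" for f z
  \<comment> \<open>Bounds on the velocity concern points of the space only; setting it to 0
    elsewhere makes \<open>V f\<close> bounded on the whole type.\<close>
  define V where "V f z = (if z \<in> space M \<times> space M then velocity M k R (cl f) z else 0)" for f z
  define g where "g f = (Bcontfun (\<lambda>z. V f (of_discrete z)) :: ('a \<times> 'a) discrete \<Rightarrow>\<^sub>C real)" for f
  define K where "K = real k * (real k - 1)"
  have K: "K \<ge> 0" unfolding K_def by (cases k) auto
  have cont: "continuous_on UNIV (h :: ('a \<times> 'a) discrete \<Rightarrow> real)" for h
    by (simp add: continuous_on_open_vimage open_discrete)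
  have cl_unit: "unit_valued (cl f)" for f by (simp add: unit_valued_def cl_def)
  have cl_kernel: "cl f \<in> kernels M" if "f \<in> C" for f
    using that unfolding C_def cl_def kernels_def by (auto intro!: exI[of _ 1])
  have VK: "\<bar>V f z\<bar> \<le> K" if "f \<in> C" for f z
    using velocity_bounds(1)[OF R cl_kernel[OF that] unit_valuedD[OF cl_unit], of "fst z" "snd z"] K
    by (auto simp: V_def K_def)
  have app_g: "app (g f) z = V f z" if "f \<in> C" for f z
    using bcontfun_normI[OF cont, of "\<lambda>z. V f (of_discrete z)" K] VK[OF that]
    by (simp add: app_def g_def Bcontfun_inverse discrete_inverse)
  have normI: "norm f \<le> B" if "\<And>z. \<bar>app f z\<bar> \<le> B" for f B
    by (rule norm_bound) (use that in \<open>metis app_def of_discrete_inverse real_norm_def\<close>)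
  have normD: "\<bar>app f z\<bar> \<le> norm f" for f z
    using norm_bounded[of f "discrete z"] by (simp add: app_def)
  have app_simps: "app (f + h) z = app f z + app h z" "app (f - h) z = app f z - app h z"
    "app (r *\<^sub>R f) z = r * app f z" "app 0 z = 0" for f h r z
    by (simp_all add: app_def)
  have bounded_app: "\<exists>B. \<forall>x\<in>space M. \<forall>y\<in>space M. \<bar>app f (x, y)\<bar> \<le> B" for f
    using normD by blast
  have C_iff: "f \<in> C \<longleftrightarrow> app f \<in> borel_measurable (M \<Otimes>\<^sub>M M) \<and>
      (\<forall>x\<in>space M. \<forall>y\<in>space M. app f (x, y) = app f (y, x))" for f
    using bounded_app by (simp add: C_def kernels_def)
  have sub: "subspace C"
  proof (rule subspaceI)
    show "0 \<in> C" by (simp add: C_iff app_simps[abs_def])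
    show "f + h \<in> C" if "f \<in> C" "h \<in> C" for f h
      using that unfolding C_iff app_simps[abs_def] by (auto intro: borel_measurable_add borel_measurable_times)
    show "r *\<^sub>R f \<in> C" if "f \<in> C" for f r
      using that unfolding C_iff app_simps[abs_def] by (auto intro: borel_measurable_add borel_measurable_times)
  qed
  have closed: "closed C"
    unfolding closed_sequential_limits
  proof (intro allI impI, elim conjE)
    fix fs f assume fs: "\<forall>n. fs n \<in> C" and lim: "fs \<longlonglongrightarrow> f"
    have pt: "(\<lambda>n. app (fs n) z) \<longlonglongrightarrow> app f z" for z
    proof (rule Lim_null_comparison[THEN LIM_zero_cancel])
      show "\<forall>\<^sub>F n in sequentially. norm (app (fs n) z - app f z) \<le> norm (fs n - f)"
        using normD[of "_ - f" z] by (simp add: app_simps)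
      show "(\<lambda>n. norm (fs n - f)) \<longlonglongrightarrow> 0" using lim by (simp add: LIM_zero tendsto_norm_zero)
    qed
    show "f \<in> C"
      unfolding C_iff
    proof (intro conjI ballI)
      show "app f \<in> borel_measurable (M \<Otimes>\<^sub>M M)"
        by (rule borel_measurable_LIMSEQ_real[OF pt]) (use fs in \<open>simp add: C_iff\<close>)
      fix x y assume "x \<in> space M" "y \<in> space M"
      then have "(\<lambda>n. app (fs n) (x, y)) = (\<lambda>n. app (fs n) (y, x))" using fs by (auto simp: C_iff)
      then show "app f (x, y) = app f (y, x)"
        using pt[of "(x, y)"] pt[of "(y, x)"] LIMSEQ_unique by metis
    qed
  qed
  have gC: "g f \<in> C" if f: "f \<in> C" for f
    unfolding C_iff
  proof (intro conjI ballI)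
    have "app (g f) z = velocity M k R (cl f) z" if "z \<in> space (M \<Otimes>\<^sub>M M)" for z
      using that by (simp add: app_g f V_def space_pair_measure)
    then show "app (g f) \<in> borel_measurable (M \<Otimes>\<^sub>M M)"
      using measurable_velocity[OF cl_kernel[OF f]] by (simp cong: measurable_cong)
    fix x y assume "x \<in> space M" "y \<in> space M"
    then show "app (g f) (x, y) = app (g f) (y, x)"
      using velocity_symmetric[OF cl_kernel[OF f]] by (simp add: app_g f V_def)
  qed
  \<comment> \<open>The summand 1 keeps \<open>L\<close> positive when \<open>k \<le> 1\<close>,
    where \<open>K\<close> vanishes.\<close>
  define L where "L = K * lip_const k + 1"
  have L: "L > 0" using K lip_const_nonneg[of k] by (simp add: L_def add_nonneg_pos)
  have lip: "norm (g f - g h) \<le> L * norm (f - h)" if f: "f \<in> C" and h: "h \<in> C" for f h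
  proof (rule normI)
    fix z
    show "\<bar>app (g f - g h) z\<bar> \<le> L * norm (f - h)"
    proof (cases "z \<in> space M \<times> space M")
      case True
      then obtain x y where z: "z = (x, y)" "x \<in> space M" "y \<in> space M" by auto
      have "\<bar>velocity M k R (cl f) (x, y) - velocity M k R (cl h) (x, y)\<bar>
        \<le> real k * (real k - 1) * (lip_const k * norm (f - h))"
      proof (rule velocity_lipschitz[OF R cl_kernel[OF f] cl_kernel[OF h] _ _ _ _ z(2,3)])
        fix x y
        have "\<bar>app f (x, y) - app h (x, y)\<bar> \<le> norm (f - h)"
          using normD[of "f - h" "(x, y)"] by (simp add: app_simps)
        then show "\<bar>cl f (x, y) - cl h (x, y)\<bar> \<le> norm (f - h)"
          by (auto simp: cl_def max_def min_def)
      qed (auto simp: cl_def)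
      also have "\<dots> \<le> L * norm (f - h)" by (simp add: L_def K_def algebra_simps)
      finally show ?thesis using z by (simp add: app_simps app_g f h V_def)
    qed (use L in \<open>simp add: app_simps app_g f h V_def\<close>)
  qed
  have bdd: "norm (g f) \<le> K" if "f \<in> C" for f
    by (rule normI) (simp add: app_g that VK)
  define u0 where "u0 = (Bcontfun (\<lambda>z. if of_discrete z \<in> space M \<times> space M then W (of_discrete z) else 0) :: ('a \<times> 'a) discrete \<Rightarrow>\<^sub>C real)"
  have "\<bar>if of_discrete z \<in> space M \<times> space M then W (of_discrete z) else 0\<bar> \<le> 1" for z
    using unit_valuedD[OF W(2), of "fst (of_discrete z)" "snd (of_discrete z)"] by auto
  then have app_u0: "app u0 z = (if z \<in> space M \<times> space M then W z else 0)" for z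
    using bcontfun_normI[OF cont, of "\<lambda>z. if of_discrete z \<in> space M \<times> space M then W (of_discrete z) else 0" 1]
    by (simp add: app_def u0_def Bcontfun_inverse discrete_inverse)
  have u0: "u0 \<in> C"
    unfolding C_iff
  proof (intro conjI ballI)
    have "app u0 z = W z" if "z \<in> space (M \<Otimes>\<^sub>M M)" for z
      using that by (simp add: app_u0 space_pair_measure)
    then show "app u0 \<in> borel_measurable (M \<Otimes>\<^sub>M M)"
      using kernelsD(1)[OF W(1)] by (simp cong: measurable_cong)
    show "app u0 (x, y) = app u0 (y, x)" if "x \<in> space M" "y \<in> space M" for x y
      using that kernelsD(3)[OF W(1)] by (simp add: app_u0)
  qed
  obtain u where u: "u 0 = u0" "\<And>t. t \<ge> 0 \<Longrightarrow> u t \<in> C"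
    "\<And>t. t \<ge> 0 \<Longrightarrow> (u has_vector_derivative g (u t)) (at t within {0..})"
    by (rule global_ode_solution[where C = C and g = g and L = L and B = K and ?u0.0 = u0])
      (use sub closed gC L lip bdd u0 in auto)
  have est: "\<exists>d>0. \<forall>s\<in>{0..}. \<bar>s - t\<bar> < d \<longrightarrow> (\<forall>z. \<bar>app (u s) z - app (u t) z - (s - t) * V (u t) z\<bar> \<le> e * \<bar>s - t\<bar>)"
    if t: "t \<ge> 0" and e: "e > 0" for t e
  proof -
    obtain d where d: "d > 0" "\<forall>s\<in>{0..}. norm (s - t) < d \<longrightarrow> norm (u s - u t - (s - t) *\<^sub>R g (u t)) \<le> e * norm (s - t)"
      using u(3)[OF t] e unfolding has_vector_derivative_def has_derivative_within_alt by blast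
    have "\<bar>app (u s) z - app (u t) z - (s - t) * V (u t) z\<bar> \<le> norm (u s - u t - (s - t) *\<^sub>R g (u t))" for s z
      using normD[of "u s - u t - (s - t) *\<^sub>R g (u t)" z] by (simp add: app_simps app_g u(2) t)
    note * = order_trans[OF this]
    show ?thesis
      by (intro exI[of _ d] conjI ballI impI allI *) (use d in auto)
  qed
  have deriv: "((\<lambda>t. app (u t) z) has_real_derivative V (u t) z) (at t within {0..})" if "t \<ge> 0" for t z
    by (rule has_real_derivative_withinI_estimate) (use est[OF that] in blast)
  have deriv': "((\<lambda>t. - app (u t) z) has_real_derivative - V (u t) z) (at t within {0..})" if "t \<ge> 0" for t z
    by (intro derivative_intros deriv that)
  have unit: "0 \<le> app (u t) (x, y) \<and> app (u t) (x, y) \<le> 1" if t: "t \<ge> 0" and xy: "x \<in> space M" "y \<in> space M" for t x y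
  proof
    note vb = velocity_bounds(2,3)[OF R cl_kernel[OF u(2)] unit_valuedD[OF cl_unit] xy]
    have c: "app (u s) (x, y) > 1 \<Longrightarrow> cl (u s) (x, y) = 1" "app (u s) (x, y) < 0 \<Longrightarrow> cl (u s) (x, y) = 0" for s
      by (auto simp: cl_def)
    show "app (u t) (x, y) \<le> 1"
      by (rule stays_le[OF deriv _ _ t])
        (use unit_valuedD[OF W(2) xy] xy vb(2) c(1) in \<open>auto simp: u(1) app_u0 V_def\<close>)
    have "- app (u t) (x, y) \<le> 0"
      by (rule stays_le[OF deriv' _ _ t])
        (use unit_valuedD[OF W(2) xy] xy vb(1) c(2) in \<open>auto simp: u(1) app_u0 V_def\<close>)
    then show "0 \<le> app (u t) (x, y)" by simp
  qed
  then have cl_eq: "cl (u t) (x, y) = app (u t) (x, y)" if "t \<ge> 0" "x \<in> space M" "y \<in> space M" for t x y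
    using that by (force simp: cl_def)
  show thesis
  \<comment> \<open>The truncation is returned instead of \<open>app (u t)\<close>: the two agree on
    the space, and \<open>V (u t)\<close> is by definition the velocity of the truncation.\<close>
  proof (rule that[of "\<lambda>t. cl (u t)"], unfold strong_trajectory_def, intro conjI allI impI ballI)
    show "cl (u t) \<in> kernels M" "unit_valued (cl (u t))" if "t \<ge> 0" for t
      using that cl_kernel u(2) cl_unit by auto
    show "cl (u 0) (x, y) = W (x, y)" if "x \<in> space M" "y \<in> space M" for x y
      using that by (simp add: cl_eq) (simp add: u(1) app_u0)
    fix t e :: real assume t: "t \<ge> 0" and e: "e > 0"
    obtain d where d: "d > 0" "\<forall>s\<in>{0..}. \<bar>s - t\<bar> < d \<longrightarrow> (\<forall>z. \<bar>app (u s) z - app (u t) z - (s - t) * V (u t) z\<bar> \<le> e * \<bar>s - t\<bar>)"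
      using est[OF t e] by blast
    show "\<exists>d>0. \<forall>s\<in>{0..}. \<bar>s - t\<bar> < d \<longrightarrow> (\<forall>x\<in>space M. \<forall>y\<in>space M.
      \<bar>cl (u s) (x, y) - cl (u t) (x, y) - (s - t) * velocity M k R (cl (u t)) (x, y)\<bar> \<le> e * \<bar>s - t\<bar>)"
    proof (intro exI[of _ d] conjI ballI impI)
      fix s x y assume *: "s \<in> {0..}" "\<bar>s - t\<bar> < d" "x \<in> space M" "y \<in> space M"
      have "\<bar>app (u s) (x, y) - app (u t) (x, y) - (s - t) * V (u t) (x, y)\<bar> \<le> e * \<bar>s - t\<bar>"
        using d * by blast
      then show "\<bar>cl (u s) (x, y) - cl (u t) (x, y) - (s - t) * velocity M k R (cl (u t)) (x, y)\<bar> \<le> e * \<bar>s - t\<bar>"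
        using * t by (simp add: cl_eq V_def)
    qed (rule d(1))
  qed
qed

lemma strong_trajectoryD:
  assumes "strong_trajectory k R W u"
  shows "t \<ge> 0 \<Longrightarrow> u t \<in> kernels M" "t \<ge> 0 \<Longrightarrow> unit_valued (u t)"
    "x \<in> space M \<Longrightarrow> y \<in> space M \<Longrightarrow> u 0 (x, y) = W (x, y)"
    "t \<ge> 0 \<Longrightarrow> e > 0 \<Longrightarrow> \<exists>d>0. \<forall>s\<in>{0..}. \<bar>s - t\<bar> < d \<longrightarrow> (\<forall>x\<in>space M. \<forall>y\<in>space M.
        \<bar>u s (x, y) - u t (x, y) - (s - t) * velocity M k R (u t) (x, y)\<bar> \<le> e * \<bar>s - t\<bar>)"
  using assms unfolding strong_trajectory_def by auto

lemma strong_trajectory_pointwise: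
  assumes u: "strong_trajectory k R W u" and t: "t \<ge> 0" and xy: "x \<in> space M" "y \<in> space M"
  shows "((\<lambda>t. u t (x, y)) has_real_derivative velocity M k R (u t) (x, y)) (at t within {0..})"
  by (rule has_real_derivative_withinI_estimate) (use strong_trajectoryD(4)[OF u t] xy in blast)

lemma prob_space_square: "prob_space (M \<Otimes>\<^sub>M M)"
  by (rule sq.P.prob_space_axioms)

lemma integrable_bounded_on_space:
  assumes "f \<in> borel_measurable (M \<Otimes>\<^sub>M M)" "\<And>x y. x \<in> space M \<Longrightarrow> y \<in> space M \<Longrightarrow> \<bar>f (x, y)\<bar> \<le> B"
  shows "integrable (M \<Otimes>\<^sub>M M) (f :: _ \<Rightarrow> real)"
  by (rule finite_measure.integrable_const_bound[OF prob_space.finite_measure[OF prob_space_square], of _ B])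
    (use assms in \<open>auto simp: space_pair_measure intro!: AE_I2\<close>)

lemma integrable_kernel:
  assumes "W \<in> kernels M"
  shows "integrable (M \<Otimes>\<^sub>M M) W"
proof -
  obtain C where "\<forall>x\<in>space M. \<forall>y\<in>space M. \<bar>W (x, y)\<bar> \<le> C" using kernelsD(2)[OF assms] by blast
  then show ?thesis by (intro integrable_bounded_on_space[of W C] kernelsD(1)[OF assms]) blast
qed

text \<open>Uniformity of the estimate over all points lets differentiation in time pass under the
  integral.\<close>

lemma strong_trajectory_integral:
  assumes R: "is_rule k R" and u: "strong_trajectory k R W u" and t: "t \<ge> 0"
  shows "((\<lambda>t. \<integral>z. u t z \<partial>(M \<Otimes>\<^sub>M M)) has_real_derivative (\<integral>z. velocity M k R (u t) z \<partial>(M \<Otimes>\<^sub>M M))) (at t within {0..})"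
proof (rule has_real_derivative_withinI_estimate)
  fix e :: real assume e: "e > 0"
  obtain d where d: "d > 0" "\<forall>s\<in>{0..}. \<bar>s - t\<bar> < d \<longrightarrow> (\<forall>x\<in>space M. \<forall>y\<in>space M.
        \<bar>u s (x, y) - u t (x, y) - (s - t) * velocity M k R (u t) (x, y)\<bar> \<le> e * \<bar>s - t\<bar>)"
    using strong_trajectoryD(4)[OF u t e] by blast
  note ut = strong_trajectoryD(1)[OF u t] unit_valuedD[OF strong_trajectoryD(2)[OF u t]]
  have iV: "integrable (M \<Otimes>\<^sub>M M) (velocity M k R (u t))"
    by (rule integrable_bounded_on_space[OF measurable_velocity[OF ut(1)] velocity_bounds(1)[OF R ut]])
  show "\<exists>d>0. \<forall>s\<in>{0..}. \<bar>s - t\<bar> < d \<longrightarrow> \<bar>(\<integral>z. u s z \<partial>(M \<Otimes>\<^sub>M M)) - (\<integral>z. u t z \<partial>(M \<Otimes>\<^sub>M M)) -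
      (s - t) * (\<integral>z. velocity M k R (u t) z \<partial>(M \<Otimes>\<^sub>M M))\<bar> \<le> e * \<bar>s - t\<bar>"
  proof (intro exI[of _ d] conjI ballI impI)
    fix s assume s: "s \<in> {0..}" "\<bar>s - t\<bar> < d"
    have iu: "integrable (M \<Otimes>\<^sub>M M) (u s)" "integrable (M \<Otimes>\<^sub>M M) (u t)"
      using s t strong_trajectoryD(1)[OF u] by (auto intro!: integrable_kernel)
    have "(\<integral>z. u s z \<partial>(M \<Otimes>\<^sub>M M)) - (\<integral>z. u t z \<partial>(M \<Otimes>\<^sub>M M)) -
      (s - t) * (\<integral>z. velocity M k R (u t) z \<partial>(M \<Otimes>\<^sub>M M))
      = (\<integral>z. u s z - u t z - (s - t) * velocity M k R (u t) z \<partial>(M \<Otimes>\<^sub>M M))"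
      using iu iV by simp
    also have "\<bar>\<dots>\<bar> \<le> e * \<bar>s - t\<bar>"
      by (rule prob_space.abs_integral_le_const[OF prob_space_square])
        (use d(2) s e in \<open>auto simp: space_pair_measure\<close>)
    finally show "\<bar>(\<integral>z. u s z \<partial>(M \<Otimes>\<^sub>M M)) - (\<integral>z. u t z \<partial>(M \<Otimes>\<^sub>M M)) -
      (s - t) * (\<integral>z. velocity M k R (u t) z \<partial>(M \<Otimes>\<^sub>M M))\<bar> \<le> e * \<bar>s - t\<bar>" .
  qed (rule d(1))
qed

subsection \<open>Uniqueness of trajectories\<close>

lemma linf_norm_le:
  assumes "f \<in> borel_measurable (M \<Otimes>\<^sub>M M)" "AE z in M \<Otimes>\<^sub>M M. \<bar>f z\<bar> \<le> c"
  shows "linf_norm M f \<le> ereal c"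
  unfolding linf_norm_def by (rule esssup_I) (use assms in auto)

lemma AE_le_linf_norm:
  assumes "linf_norm M f \<le> ereal c"
  shows "AE z in M \<Otimes>\<^sub>M M. \<bar>f z\<bar> \<le> c"
proof -
  have "AE z in M \<Otimes>\<^sub>M M. ereal \<bar>f z\<bar> \<le> linf_norm M f" unfolding linf_norm_def by (rule esssup_AE)
  then show ?thesis
  proof (rule AE_mono_on_space)
    fix z assume "ereal \<bar>f z\<bar> \<le> linf_norm M f"
    then have "ereal \<bar>f z\<bar> \<le> ereal c" using assms by (rule order_trans)
    then show "\<bar>f z\<bar> \<le> c" by simp
  qed
qed

text \<open>A negative essential supremum would bound absolute values almost everywhere by a
  negative number, impossible on a probability space.\<close>

lemma linf_norm_nonneg: "0 \<le> linf_norm M f"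
proof (rule ccontr)
  assume n: "\<not> 0 \<le> linf_norm M f"
  have "AE z in M \<Otimes>\<^sub>M M. ereal \<bar>f z\<bar> \<le> linf_norm M f" unfolding linf_norm_def by (rule esssup_AE)
  then have "AE z in M \<Otimes>\<^sub>M M. False"
  proof (rule AE_mono_on_space)
    fix z assume "ereal \<bar>f z\<bar> \<le> linf_norm M f"
    moreover have "0 \<le> ereal \<bar>f z\<bar>" by simp
    ultimately show False using n order_trans by blast
  qed
  then show False using sq.P.AE_False by simp
qed

lemma tendsto_linf_norm_0_iff:
  "((\<lambda>s. linf_norm M (f s)) \<longlongrightarrow> 0) F \<longleftrightarrow> (\<forall>e>0. \<forall>\<^sub>F s in F. linf_norm M (f s) \<le> ereal e)"
proof
  assume l: "((\<lambda>s. linf_norm M (f s)) \<longlongrightarrow> 0) F"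
  show "\<forall>e>0. \<forall>\<^sub>F s in F. linf_norm M (f s) \<le> ereal e"
  proof (intro allI impI)
    fix e :: real assume "e > 0"
    then have "\<forall>\<^sub>F s in F. linf_norm M (f s) < ereal e" using order_tendstoD(2)[OF l, of "ereal e"] by simp
    then show "\<forall>\<^sub>F s in F. linf_norm M (f s) \<le> ereal e" by (rule eventually_mono) simp
  qed
next
  assume r: "\<forall>e>0. \<forall>\<^sub>F s in F. linf_norm M (f s) \<le> ereal e"
  show "((\<lambda>s. linf_norm M (f s)) \<longlongrightarrow> 0) F"
  proof (rule order_tendstoI)
    fix a :: ereal assume "a < 0"
    then show "\<forall>\<^sub>F s in F. a < linf_norm M (f s)"
      by (intro always_eventually allI) (rule less_le_trans[OF _ linf_norm_nonneg])
  next
    fix a :: ereal assume "0 < a"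
    then obtain e where e: "0 < ereal e" "ereal e < a" using ereal_dense2 by blast
    then have "\<forall>\<^sub>F s in F. linf_norm M (f s) \<le> ereal e" using r by simp
    then show "\<forall>\<^sub>F s in F. linf_norm M (f s) < a"
      by (rule eventually_mono) (use e in auto)
  qed
qed

lemma AE_I_on_space:
  assumes "\<And>x y. x \<in> space M \<Longrightarrow> y \<in> space M \<Longrightarrow> P (x, y)"
  shows "AE z in M \<Otimes>\<^sub>M M. P z"
  by (rule AE_I2) (use assms in \<open>auto simp: space_pair_measure\<close>)

lemma strong_trajectory_is_trajectory:
  assumes u: "strong_trajectory k R W u" and W: "AE z in M \<Otimes>\<^sub>M M. W z = W0 z"
  shows "is_trajectory M k R W0 u"
  unfolding is_trajectory_def
proof (intro conjI allI impI)
  show "u t \<in> kernels M" if "t \<ge> 0" for t using strong_trajectoryD(1)[OF u that] .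
  have "AE z in M \<Otimes>\<^sub>M M. u 0 z = W z" by (rule AE_I_on_space) (rule strong_trajectoryD(3)[OF u])
  then show "AE z in M \<Otimes>\<^sub>M M. u 0 z = W0 z" using W by eventually_elim simp
  fix t :: real assume t: "t \<ge> 0"
  show "((\<lambda>s. linf_norm M (\<lambda>z. (u s z - u t z) / (s - t) - velocity M k R (u t) z)) \<longlongrightarrow> 0) (at t within {0..})"
    unfolding tendsto_linf_norm_0_iff
  proof (intro allI impI)
    fix e :: real assume e: "e > 0"
    obtain d where d: "d > 0" "\<forall>s\<in>{0..}. \<bar>s - t\<bar> < d \<longrightarrow> (\<forall>x\<in>space M. \<forall>y\<in>space M.
        \<bar>u s (x, y) - u t (x, y) - (s - t) * velocity M k R (u t) (x, y)\<bar> \<le> e * \<bar>s - t\<bar>)"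
      using strong_trajectoryD(4)[OF u t e] by blast
    show "\<forall>\<^sub>F s in at t within {0..}. linf_norm M (\<lambda>z. (u s z - u t z) / (s - t) - velocity M k R (u t) z) \<le> ereal e"
      unfolding eventually_at
    proof (intro exI[of _ d] conjI ballI impI)
      fix s assume s: "s \<in> {0..}" "s \<noteq> t \<and> dist s t < d"
      show "linf_norm M (\<lambda>z. (u s z - u t z) / (s - t) - velocity M k R (u t) z) \<le> ereal e"
      proof (rule linf_norm_le)
        show "(\<lambda>z. (u s z - u t z) / (s - t) - velocity M k R (u t) z) \<in> borel_measurable (M \<Otimes>\<^sub>M M)"
          using s t strong_trajectoryD(1)[OF u]
          by (intro borel_measurable_diff borel_measurable_divide borel_measurable_const measurable_velocity kernelsD(1)) auto
        show "AE z in M \<Otimes>\<^sub>M M. \<bar>(u s z - u t z) / (s - t) - velocity M k R (u t) z\<bar> \<le> e"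
        proof (rule AE_I_on_space)
          fix x y assume xy: "x \<in> space M" "y \<in> space M"
          have "\<bar>u s (x, y) - u t (x, y) - (s - t) * velocity M k R (u t) (x, y)\<bar> \<le> e * \<bar>s - t\<bar>"
            using d(2) s xy by (simp add: dist_real_def)
          moreover have "(u s (x, y) - u t (x, y)) / (s - t) - velocity M k R (u t) (x, y)
            = (u s (x, y) - u t (x, y) - (s - t) * velocity M k R (u t) (x, y)) / (s - t)"
            using s by (simp add: diff_divide_distrib)
          ultimately show "\<bar>(u s (x, y) - u t (x, y)) / (s - t) - velocity M k R (u t) (x, y)\<bar> \<le> e"
            using s by (simp add: abs_divide divide_le_eq)
        qed
      qed
    qed (rule d(1))
  qed
qed

lemma trajectory_step:
  assumes \<Phi>: "is_trajectory M k R W \<Phi>" and t: "t \<ge> 0" and e: "e > 0"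
  obtains h where "h > 0" "\<And>s. s \<ge> 0 \<Longrightarrow> \<bar>s - t\<bar> < h \<Longrightarrow>
    AE z in M \<Otimes>\<^sub>M M. \<bar>\<Phi> s z - \<Phi> t z - (s - t) * velocity M k R (\<Phi> t) z\<bar> \<le> e * \<bar>s - t\<bar>"
proof -
  have "((\<lambda>s. linf_norm M (\<lambda>z. (\<Phi> s z - \<Phi> t z) / (s - t) - velocity M k R (\<Phi> t) z)) \<longlongrightarrow> 0) (at t within {0..})"
    using \<Phi> t by (simp add: is_trajectory_def)
  then have "\<forall>\<^sub>F s in at t within {0..}. linf_norm M (\<lambda>z. (\<Phi> s z - \<Phi> t z) / (s - t) - velocity M k R (\<Phi> t) z) \<le> ereal e"
    using e unfolding tendsto_linf_norm_0_iff by blast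
  then obtain h where h: "h > 0" "\<And>s. s \<ge> 0 \<Longrightarrow> s \<noteq> t \<Longrightarrow> \<bar>s - t\<bar> < h \<Longrightarrow>
      linf_norm M (\<lambda>z. (\<Phi> s z - \<Phi> t z) / (s - t) - velocity M k R (\<Phi> t) z) \<le> ereal e"
    unfolding eventually_at by (auto simp: dist_real_def)
  show thesis
  proof (rule that[OF h(1)])
    fix s assume s: "s \<ge> 0" "\<bar>s - t\<bar> < h"
    show "AE z in M \<Otimes>\<^sub>M M. \<bar>\<Phi> s z - \<Phi> t z - (s - t) * velocity M k R (\<Phi> t) z\<bar> \<le> e * \<bar>s - t\<bar>"
    proof (cases "s = t")
      case False
      from AE_le_linf_norm[OF h(2)[OF s(1) False s(2)]] show ?thesis
      proof (rule AE_mono_on_space)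
        fix z assume "\<bar>(\<Phi> s z - \<Phi> t z) / (s - t) - velocity M k R (\<Phi> t) z\<bar> \<le> e"
        moreover have "(\<Phi> s z - \<Phi> t z) / (s - t) - velocity M k R (\<Phi> t) z
            = (\<Phi> s z - \<Phi> t z - (s - t) * velocity M k R (\<Phi> t) z) / (s - t)"
          using False by (simp add: diff_divide_distrib)
        ultimately show "\<bar>\<Phi> s z - \<Phi> t z - (s - t) * velocity M k R (\<Phi> t) z\<bar> \<le> e * \<bar>s - t\<bar>"
          using False by (simp add: abs_divide divide_le_eq)
      qed
    qed simp
  qed
qed

text \<open>The bound k (k - 1) is available only for values in the unit interval. For an arbitrary
  trajectory a bound is read off the motion itself: the kernels at times \<open>t\<close> and
  \<open>t + h / 2\<close> are bounded, and the velocity is within 1 of their difference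
  quotient.\<close>

lemma trajectory_velocity_AE_bounded:
  assumes \<Phi>: "is_trajectory M k R W \<Phi>" and t: "t \<ge> 0"
  obtains B where "B \<ge> 0" "AE z in M \<Otimes>\<^sub>M M. \<bar>velocity M k R (\<Phi> t) z\<bar> \<le> B"
proof -
  obtain h where h: "h > 0" "\<And>s. s \<ge> 0 \<Longrightarrow> \<bar>s - t\<bar> < h \<Longrightarrow>
    AE z in M \<Otimes>\<^sub>M M. \<bar>\<Phi> s z - \<Phi> t z - (s - t) * velocity M k R (\<Phi> t) z\<bar> \<le> 1 * \<bar>s - t\<bar>"
    using trajectory_step[OF \<Phi> t zero_less_one] by blast
  define s where "s = t + h / 2"
  have s: "s \<ge> 0" "\<bar>s - t\<bar> = h / 2" using t h by (auto simp: s_def)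
  have ker: "\<Phi> s \<in> kernels M" "\<Phi> t \<in> kernels M" using \<Phi> s(1) t by (auto simp: is_trajectory_def)
  obtain C where C: "\<forall>x\<in>space M. \<forall>y\<in>space M. \<bar>\<Phi> s (x, y)\<bar> \<le> C" using kernelsD(2)[OF ker(1)] by blast
  obtain D where D: "\<forall>x\<in>space M. \<forall>y\<in>space M. \<bar>\<Phi> t (x, y)\<bar> \<le> D" using kernelsD(2)[OF ker(2)] by blast
  have "AE z in M \<Otimes>\<^sub>M M. \<bar>velocity M k R (\<Phi> t) z\<bar> \<le> \<bar>(h / 2 + C + D) / (h / 2)\<bar>"
    using h(2)[OF s(1)]
  proof (rule AE_mono_on_space)
    show "\<bar>s - t\<bar> < h" using s h by simp
    fix z assume z: "z \<in> space (M \<Otimes>\<^sub>M M)" and b: "\<bar>\<Phi> s z - \<Phi> t z - (s - t) * velocity M k R (\<Phi> t) z\<bar> \<le> 1 * \<bar>s - t\<bar>"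
    have "\<bar>\<Phi> s z\<bar> \<le> C" "\<bar>\<Phi> t z\<bar> \<le> D" using C D z by (auto simp: space_pair_measure)
    then have "\<bar>r\<bar> \<le> h / 2 + C + D" if "\<bar>\<Phi> s z - \<Phi> t z - r\<bar> \<le> h / 2" for r
      using that by linarith
    then have "\<bar>(s - t) * velocity M k R (\<Phi> t) z\<bar> \<le> h / 2 + C + D" using b s(2) by simp
    then have "h / 2 * \<bar>velocity M k R (\<Phi> t) z\<bar> \<le> h / 2 + C + D" by (simp add: abs_mult s(2))
    then have "\<bar>velocity M k R (\<Phi> t) z\<bar> \<le> (h / 2 + C + D) / (h / 2)" using h(1) by (simp add: field_simps)
    then show "\<bar>velocity M k R (\<Phi> t) z\<bar> \<le> \<bar>(h / 2 + C + D) / (h / 2)\<bar>" by linarith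
  qed
  then show thesis by (rule that[rotated]) simp
qed

text \<open>On a null set \<open>U\<close> may be far from \<open>W\<close>, outside the range of
  the pointwise estimate. Clipping the difference to at most \<open>\<delta>\<close> changes
  \<open>U\<close> only there, and \<open>\<delta> \<le> 1\<close> places the clipped kernel between
  -1 and 2.\<close>

lemma velocity_lipschitz_AE:
  assumes R: "is_rule k R" and U: "U \<in> kernels M" and W: "W \<in> kernels M" "unit_valued W"
    and d: "AE z in M \<Otimes>\<^sub>M M. \<bar>U z - W z\<bar> \<le> \<delta>" "0 \<le> \<delta>" "\<delta> \<le> 1"
  shows "AE z in M \<Otimes>\<^sub>M M. \<bar>velocity M k R U z - velocity M k R W z\<bar> \<le> real k * (real k - 1) * (lip_const k * \<delta>)"
proof -
  define U' where "U' z = W z + max (- \<delta>) (min \<delta> (U z - W z))" for z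
  have [measurable]: "U \<in> borel_measurable (M \<Otimes>\<^sub>M M)" "W \<in> borel_measurable (M \<Otimes>\<^sub>M M)"
    using kernelsD(1) U W by auto
  have near: "\<bar>U' z - W z\<bar> \<le> \<delta>" for z using d(2) by (auto simp: U'_def)
  have b: "-1 \<le> U' (x, y) \<and> U' (x, y) \<le> 2" if "x \<in> space M" "y \<in> space M" for x y
    using near[of "(x, y)"] unit_valuedD[OF W(2) that] d(3) by auto
  have U': "U' \<in> kernels M"
    unfolding kernels_def
  proof (intro CollectI conjI ballI)
    show "U' \<in> borel_measurable (M \<Otimes>\<^sub>M M)" unfolding U'_def by measurable
    show "\<exists>C. \<forall>x\<in>space M. \<forall>y\<in>space M. \<bar>U' (x, y)\<bar> \<le> C"
    proof (intro exI[of _ 2] ballI)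
      show "\<bar>U' (x, y)\<bar> \<le> 2" if "x \<in> space M" "y \<in> space M" for x y using b[OF that] by auto
    qed
    show "U' (x, y) = U' (y, x)" if "x \<in> space M" "y \<in> space M" for x y
      using kernelsD(3)[OF U that] kernelsD(3)[OF W(1) that] by (simp add: U'_def)
  qed
  have "AE z in M \<Otimes>\<^sub>M M. U z = U' z"
    using d(1) by (rule AE_mono_on_space) (auto simp: U'_def)
  from AE_velocity_cong[OF U U' this, of k R] show ?thesis
  proof (rule AE_mono_on_space)
    fix z assume z: "z \<in> space (M \<Otimes>\<^sub>M M)" and eq: "velocity M k R U z = velocity M k R U' z"
    then obtain x y where xy: "z = (x, y)" "x \<in> space M" "y \<in> space M" by (auto simp: space_pair_measure)
    have w: "-1 \<le> W (x, y) \<and> W (x, y) \<le> 2" if "x \<in> space M" "y \<in> space M" for x y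
      using unit_valuedD[OF W(2) that] by auto
    have near': "\<bar>U' (x, y) - W (x, y)\<bar> \<le> \<delta>" if "x \<in> space M" "y \<in> space M" for x y
      by (rule near)
    show "\<bar>velocity M k R U z - velocity M k R W z\<bar> \<le> real k * (real k - 1) * (lip_const k * \<delta>)"
      using velocity_lipschitz[OF R U' W(1) b w near' d(2) xy(2,3)] eq by (simp add: xy(1))
  qed
qed

text \<open>An arbitrary trajectory is not known to stay in the unit interval, so the Lipschitz
  estimate applies only while it is within distance 1 of \<open>u\<close>; this is the form of
  hypothesis that \<open>local_gronwall_zero\<close> accepts.\<close>

lemma trajectory_unique:
  assumes R: "is_rule k R" and \<Phi>: "is_trajectory M k R W0 \<Phi>"
    and u: "strong_trajectory k R W u" and W: "AE z in M \<Otimes>\<^sub>M M. W0 z = W z" and t: "t \<ge> 0"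
  shows "AE z in M \<Otimes>\<^sub>M M. \<Phi> t z = u t z"
proof -
  define d where "d t = real_of_ereal (linf_norm M (\<lambda>z. \<Phi> t z - u t z))" for t
  have ker: "\<Phi> t \<in> kernels M" "u t \<in> kernels M" "unit_valued (u t)" if "t \<ge> 0" for t
    using \<Phi> that strong_trajectoryD(1,2)[OF u] by (auto simp: is_trajectory_def)
  have meas: "(\<lambda>z. \<Phi> t z - u t z) \<in> borel_measurable (M \<Otimes>\<^sub>M M)" if "t \<ge> 0" for t
    using ker[OF that] kernelsD(1) by (intro borel_measurable_diff) auto
  have d_eq: "ereal (d t) = linf_norm M (\<lambda>z. \<Phi> t z - u t z)" if t: "t \<ge> 0" for t
  proof -
    obtain C where C: "\<forall>x\<in>space M. \<forall>y\<in>space M. \<bar>\<Phi> t (x, y)\<bar> \<le> C" using kernelsD(2)[OF ker(1)[OF t]] by blast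
    have "linf_norm M (\<lambda>z. \<Phi> t z - u t z) \<le> ereal (C + 1)"
    proof (rule linf_norm_le[OF meas[OF t] AE_I_on_space])
      fix x y assume xy: "x \<in> space M" "y \<in> space M"
      then have "\<bar>\<Phi> t (x, y)\<bar> \<le> C" using C by blast
      then show "\<bar>\<Phi> t (x, y) - u t (x, y)\<bar> \<le> C + 1"
        using unit_valuedD[OF ker(3)[OF t] xy] by linarith
    qed
    then show ?thesis
      using linf_norm_nonneg[of "\<lambda>z. \<Phi> t z - u t z"] unfolding d_def
      by (cases "linf_norm M (\<lambda>z. \<Phi> t z - u t z)") auto
  qed
  have d_AE: "AE z in M \<Otimes>\<^sub>M M. \<bar>\<Phi> t z - u t z\<bar> \<le> d t" if "t \<ge> 0" for t
    by (rule AE_le_linf_norm) (simp add: d_eq that)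
  have d_le: "d t \<le> c" if "t \<ge> 0" "AE z in M \<Otimes>\<^sub>M M. \<bar>\<Phi> t z - u t z\<bar> \<le> c" for t c
    using linf_norm_le[OF meas[OF that(1)] that(2)] d_eq[OF that(1), symmetric] by simp
  have d_nonneg: "d t \<ge> 0" for t using linf_norm_nonneg by (simp add: d_def real_of_ereal_pos)
  \<comment> \<open>The bound \<open>B\<close> on the velocity difference is left open because it is
    used twice: with a crude finite bound for continuity of \<open>d\<close>, and with
    \<open>L * d t\<close> for its growth. Each of the two trajectories contributes one
    \<open>e\<close>.\<close>
  have key: "\<exists>h>0. \<forall>s\<ge>0. \<bar>s - t\<bar> < h \<longrightarrow> \<bar>d s - d t\<bar> \<le> \<bar>s - t\<bar> * (B + 2 * e)"
    if t: "t \<ge> 0" and e: "e > 0" and B: "AE z in M \<Otimes>\<^sub>M M. \<bar>velocity M k R (\<Phi> t) z - velocity M k R (u t) z\<bar> \<le> B"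
    for t e B
  proof -
    obtain h1 where h1: "h1 > 0" "\<And>s. s \<ge> 0 \<Longrightarrow> \<bar>s - t\<bar> < h1 \<Longrightarrow>
      AE z in M \<Otimes>\<^sub>M M. \<bar>\<Phi> s z - \<Phi> t z - (s - t) * velocity M k R (\<Phi> t) z\<bar> \<le> e * \<bar>s - t\<bar>"
      using trajectory_step[OF \<Phi> t e] by blast
    obtain h2 where h2: "h2 > 0" "\<And>s. s \<ge> 0 \<Longrightarrow> \<bar>s - t\<bar> < h2 \<Longrightarrow>
      AE z in M \<Otimes>\<^sub>M M. \<bar>u s z - u t z - (s - t) * velocity M k R (u t) z\<bar> \<le> e * \<bar>s - t\<bar>"
      using trajectory_step[OF strong_trajectory_is_trajectory[OF u, of W] t e] by auto
    show ?thesis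
    proof (intro exI[of _ "min h1 h2"] conjI allI impI)
      show "min h1 h2 > 0" using h1 h2 by simp
      fix s assume s: "s \<ge> 0" "\<bar>s - t\<bar> < min h1 h2"
      then have sh: "\<bar>s - t\<bar> < h1" "\<bar>s - t\<bar> < h2" by auto
      have st: "AE z in M \<Otimes>\<^sub>M M. \<bar>(\<Phi> s z - u s z) - (\<Phi> t z - u t z)\<bar> \<le> \<bar>s - t\<bar> * (B + 2 * e)"
        using h1(2)[OF s(1) sh(1)] h2(2)[OF s(1) sh(2)] B
      proof eventually_elim
        case (elim z)
        have "\<bar>(s - t) * (velocity M k R (\<Phi> t) z - velocity M k R (u t) z)\<bar> \<le> \<bar>s - t\<bar> * B"
          unfolding abs_mult using elim(3) by (intro mult_left_mono) auto
        then have "\<bar>(s - t) * velocity M k R (\<Phi> t) z - (s - t) * velocity M k R (u t) z\<bar> \<le> \<bar>s - t\<bar> * B"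
          by (simp add: right_diff_distrib)
        moreover have "\<bar>s - t\<bar> * (B + 2 * e) = \<bar>s - t\<bar> * B + e * \<bar>s - t\<bar> + e * \<bar>s - t\<bar>" by (simp add: algebra_simps)
        ultimately show ?case using elim(1,2) by linarith
      qed
      have "AE z in M \<Otimes>\<^sub>M M. \<bar>\<Phi> s z - u s z\<bar> \<le> d t + \<bar>s - t\<bar> * (B + 2 * e)"
        using st d_AE[OF t] by eventually_elim linarith
      then have "d s \<le> d t + \<bar>s - t\<bar> * (B + 2 * e)" by (rule d_le[OF s(1)])
      moreover have "AE z in M \<Otimes>\<^sub>M M. \<bar>\<Phi> t z - u t z\<bar> \<le> d s + \<bar>s - t\<bar> * (B + 2 * e)"
        using st d_AE[OF s(1)] by eventually_elim linarith
      then have "d t \<le> d s + \<bar>s - t\<bar> * (B + 2 * e)" by (rule d_le[OF t])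
      ultimately show "\<bar>d s - d t\<bar> \<le> \<bar>s - t\<bar> * (B + 2 * e)" by linarith
    qed
  qed
  define L where "L = real k * (real k - 1) * lip_const k"
  have L: "L \<ge> 0" unfolding L_def using lip_const_nonneg[of k] by (cases k) auto
  have "d t \<le> 0"
  proof (rule local_gronwall_zero[OF _ _ L _ t])
    show "continuous_on {0..} d"
      unfolding continuous_on_iff
    proof (intro ballI allI impI)
      fix t e :: real assume "t \<in> {0..}" and e: "e > 0"
      then have t: "t \<ge> 0" by simp
      \<comment> \<open>For continuity at \<open>t\<close>, any finite bounds on the two velocities
        at that time suffice.\<close>
      obtain B where B: "B \<ge> 0" "AE z in M \<Otimes>\<^sub>M M. \<bar>velocity M k R (\<Phi> t) z\<bar> \<le> B"
        using trajectory_velocity_AE_bounded[OF \<Phi> t] by blast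
      obtain B' where B': "B' \<ge> 0" "AE z in M \<Otimes>\<^sub>M M. \<bar>velocity M k R (u t) z\<bar> \<le> B'"
        using trajectory_velocity_AE_bounded[OF strong_trajectory_is_trajectory[OF u, of W] t] by auto
      have "AE z in M \<Otimes>\<^sub>M M. \<bar>velocity M k R (\<Phi> t) z - velocity M k R (u t) z\<bar> \<le> B + B'"
        using B(2) B'(2) by eventually_elim linarith
      from key[OF t zero_less_one this] obtain h where h: "h > 0"
        "\<And>s. s \<ge> 0 \<Longrightarrow> \<bar>s - t\<bar> < h \<Longrightarrow> \<bar>d s - d t\<bar> \<le> \<bar>s - t\<bar> * (B + B' + 2 * 1)" by blast
      show "\<exists>r>0. \<forall>s\<in>{0..}. dist s t < r \<longrightarrow> dist (d s) (d t) < e"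
      proof (intro exI[of _ "min h (e / (B + B' + 3))"] conjI ballI impI)
        show "min h (e / (B + B' + 3)) > 0" using h(1) e B(1) B'(1) by simp
        fix s assume s: "s \<in> {0..}" "dist s t < min h (e / (B + B' + 3))"
        then have "\<bar>s - t\<bar> * (B + B' + 3) < e" using B(1) B'(1) by (simp add: dist_real_def pos_less_divide_eq)
        moreover have "\<bar>s - t\<bar> * (B + B' + 2 * 1) \<le> \<bar>s - t\<bar> * (B + B' + 3)" by (intro mult_left_mono) auto
        ultimately show "dist (d s) (d t) < e" using h(2)[of s] s by (simp add: dist_real_def)
      qed
    qed
    show "d 0 \<le> 0"
    proof (rule d_le)
      have "AE z in M \<Otimes>\<^sub>M M. \<Phi> 0 z = W0 z" using \<Phi> by (simp add: is_trajectory_def)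
      moreover have "AE z in M \<Otimes>\<^sub>M M. u 0 z = W z" by (rule AE_I_on_space) (rule strong_trajectoryD(3)[OF u])
      ultimately show "AE z in M \<Otimes>\<^sub>M M. \<bar>\<Phi> 0 z - u 0 z\<bar> \<le> 0" using W by eventually_elim simp
    qed simp
    fix t e :: real assume t: "t \<ge> 0" and le1: "d t \<le> 1" and e: "e > 0"
    have "AE z in M \<Otimes>\<^sub>M M. \<bar>velocity M k R (\<Phi> t) z - velocity M k R (u t) z\<bar> \<le> L * d t"
      using velocity_lipschitz_AE[OF R ker[OF t] d_AE[OF t] d_nonneg le1] by (simp add: L_def mult.assoc)
    from key[OF t half_gt_zero[OF e] this] obtain h where h: "h > 0"
      "\<And>s. s \<ge> 0 \<Longrightarrow> \<bar>s - t\<bar> < h \<Longrightarrow> \<bar>d s - d t\<bar> \<le> \<bar>s - t\<bar> * (L * d t + 2 * (e / 2))" by blast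
    show "\<exists>h>0. \<forall>s. t < s \<and> s < t + h \<longrightarrow> d s \<le> d t + (s - t) * (L * d t + e)"
    proof (intro exI[of _ h] conjI allI impI)
      fix s assume s: "t < s \<and> s < t + h"
      then show "d s \<le> d t + (s - t) * (L * d t + e)" using h(2)[of s] t by simp
    qed (rule h(1))
  qed
  then show ?thesis using d_AE[OF t] by (auto elim!: AE_mono_on_space)
qed

text \<open>The existence of \<open>u\<close> shows that the choice in \<open>flow\<close> yields a
  trajectory, and uniqueness identifies it up to null sets, also for an initial \<open>W0\<close>
  that leaves the unit interval on a null set.\<close>

lemma flow_AE_eq:
  assumes R: "is_rule k R" and u: "strong_trajectory k R W u"
    and W: "AE z in M \<Otimes>\<^sub>M M. W0 z = W z" and t: "t \<ge> 0"
  shows "AE z in M \<Otimes>\<^sub>M M. flow M k R t W0 z = u t z"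
    and "flow M k R t W0 \<in> kernels M"
proof -
  have "AE z in M \<Otimes>\<^sub>M M. W z = W0 z" using W by eventually_elim simp
  then have "is_trajectory M k R W0 u" by (rule strong_trajectory_is_trajectory[OF u])
  then have "is_trajectory M k R W0 (SOME \<Phi>. is_trajectory M k R W0 \<Phi>)"
    by (rule someI[of "is_trajectory M k R W0"])
  moreover have "\<Phi> t \<in> kernels M" if "is_trajectory M k R W0 \<Phi>" for \<Phi>
    using that t by (simp add: is_trajectory_def)
  ultimately show "AE z in M \<Otimes>\<^sub>M M. flow M k R t W0 z = u t z" "flow M k R t W0 \<in> kernels M"
    using trajectory_unique[OF R _ u W t] unfolding flow_def by blast+
qed
end

text \<open>Each row of the rule is a point mass at some graph G, so the gain is the indicator of ab
  in G minus that in \<open>F\<close>.\<close>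

lemma edge_gain_extremist_rule:
  assumes F: "F \<in> graphs_on k" and ab: "(a, b) \<in> vertex_pairs k"
  shows "edge_gain k (extremist_rule k) a b F =
    (if real (card F) < real (k choose 2) / 2 then - of_bool ({a, b} \<in> F)
     else if real (card F) > real (k choose 2) / 2 then of_bool ({a, b} \<notin> F) else 0)"
proof -
  have G: "{} \<in> graphs_on k" "complete_graph_on k \<in> graphs_on k" by (auto simp: graphs_on_def)
  have e: "{a, b} \<in> complete_graph_on k" using ab edge_in_complete_graph_on by (auto simp: vertex_pairs_def)
  have *: "edge_gain k R a b F = of_bool ({a, b} \<in> G - F) - of_bool ({a, b} \<in> F - G)"
    if "R F = (\<lambda>H. of_bool (H = G))" "G \<in> graphs_on k" for R G
    using that unfolding edge_gain_def by (simp add: of_bool_def if_distrib[of "\<lambda>x. x * _"] cong: if_cong)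
  consider "real (card F) < real (k choose 2) / 2" | "real (card F) > real (k choose 2) / 2"
    | "real (card F) = real (k choose 2) / 2" by linarith
  then show ?thesis
  proof cases
    case 1
    then have "extremist_rule k F = (\<lambda>H. of_bool (H = {}))" by (simp add: extremist_rule_def[abs_def])
    from *[of "extremist_rule k" "{}", OF this G(1)] 1 show ?thesis by simp
  next
    case 2
    then have "extremist_rule k F = (\<lambda>H. of_bool (H = complete_graph_on k))" by (simp add: extremist_rule_def[abs_def])
    from *[of "extremist_rule k" "complete_graph_on k", OF this G(2)] 2 e show ?thesis by simp
  next
    case 3
    then have "extremist_rule k F = (\<lambda>H. of_bool (H = F))" by (simp add: extremist_rule_def[abs_def])
    from *[of "extremist_rule k" F, OF this F] 3 show ?thesis by simp
  qed
qed

lemma card_edges_meeting_le: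
  assumes "finite S"
  shows "card {f \<in> complete_graph_on k. f \<inter> S \<noteq> {}} \<le> card S * k"
proof -
  have "{f \<in> complete_graph_on k. f \<inter> S \<noteq> {}} \<subseteq> (\<lambda>(i, j). {i, j}) ` (S \<times> {1..k})"
  proof
    fix f assume "f \<in> {f \<in> complete_graph_on k. f \<inter> S \<noteq> {}}"
    then have f': "f \<in> complete_graph_on k" "f \<inter> S \<noteq> {}" by auto
    obtain i j where f: "f = {i, j}" "i \<in> {1..k}" "j \<in> {1..k}"
      using complete_graph_on_Min_Max[OF f'(1)] by blast
    with f'(2) consider "i \<in> S" | "j \<in> S" by blast
    then show "f \<in> (\<lambda>(i, j). {i, j}) ` (S \<times> {1..k})"
    proof cases
      case 1 then show ?thesis using f by (intro image_eqI[of _ _ "(i, j)"]) auto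
    next
      case 2 then show ?thesis using f by (intro image_eqI[of _ _ "(j, i)"]) auto
    qed
  qed
  then have "card {f \<in> complete_graph_on k. f \<inter> S \<noteq> {}} \<le> card ((\<lambda>(i, j). {i, j}) ` (S \<times> {1..k}))"
    using assms by (intro card_mono) auto
  also have "\<dots> \<le> card (S \<times> {1..k})" using assms by (intro card_image_le) auto
  finally show ?thesis by (simp add: card_cartesian_product)
qed

context graphon_space
begin

subsection \<open>Concentration of the number of edges\<close>

text \<open>The endpoints of \<open>f\<close> are neither roots nor vertices of \<open>e\<close>, so
  the value of \<open>f\<close> is independent of that of \<open>e\<close> and has mean exactly
  \<open>p\<close>. Integrating first over the two coordinates in \<open>f\<close> gives 0. The edge
  \<open>e\<close> may contain roots, and its own mean may differ from \<open>p\<close>.\<close>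

lemma expectation_disjoint_edges_eq_0:
  assumes W: "W \<in> kernels M" and xy: "x \<in> space M" "y \<in> space M"
    and e: "e \<in> complete_graph_on k" and f: "f \<in> complete_graph_on k" and disj: "f \<inter> ({a, b} \<union> e) = {}"
    and p: "p = (\<integral>z. W z \<partial>(M \<Otimes>\<^sub>M M))"
  shows "(\<integral>w. (edge_values W (w(a := x, b := y)) e - p) * (edge_values W (w(a := x, b := y)) f - p) \<partial>samples k a b) = 0"
proof -
  interpret P: product_sigma_finite "\<lambda>_::nat. M" ..
  let ?q = "\<lambda>w. edge_values W (w(a := x, b := y))"
  define I where "I = {1..k} - {a, b} - f"
  have f_sub: "f \<subseteq> {1..k}" "finite f" using f finite_subset by (auto simp: complete_graph_on_def)
  have e_sub: "e \<subseteq> {1..k}" using e by (auto simp: complete_graph_on_def)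
  have U: "{1..k} - {a, b} = I \<union> f" using f_sub disj by (auto simp: I_def)
  note mm = complete_graph_on_Min_Max
  have fm: "Min f \<in> f" "Max f \<in> f" using mm(4)[OF f] by auto
  have em: "Min e \<in> e" "Max e \<in> e" using mm(4)[OF e] by auto
  obtain C where C: "C \<ge> 0" "\<And>w x y k a b e. w \<in> space (samples k a b) \<Longrightarrow> x \<in> space M \<Longrightarrow> y \<in> space M \<Longrightarrow>
    e \<in> complete_graph_on k \<Longrightarrow> \<bar>edge_values W (w(a := x, b := y)) e\<bar> \<le> C"
    using kernel_bounded_edge_values[OF W] by blast
  note meas = measurable_edge_values_sample[OF kernelsD(1)[OF W] _ xy]
  interpret S: prob_space "samples k a b" by (rule prob_space_samples)
  have int: "integrable (samples k a b) (\<lambda>w. (?q w e - p) * (?q w f - p))"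
  proof (rule S.integrable_const_bound[of _ "(C + \<bar>p\<bar>) * (C + \<bar>p\<bar>)"])
    show "(\<lambda>w. (?q w e - p) * (?q w f - p)) \<in> borel_measurable (samples k a b)"
      by (intro borel_measurable_times borel_measurable_diff borel_measurable_const meas e f)
    have "\<bar>?q w g - p\<bar> \<le> C + \<bar>p\<bar>" if "w \<in> space (samples k a b)" "g \<in> complete_graph_on k" for w g
      using C(2)[OF that(1) xy that(2)] by linarith
    then show "AE w in samples k a b. norm ((?q w e - p) * (?q w f - p)) \<le> (C + \<bar>p\<bar>) * (C + \<bar>p\<bar>)"
      using e f C(1) by (intro AE_I2) (simp add: abs_mult, intro mult_mono, auto)
  qed
  have zero: "(\<integral>v. W (v (Min f), v (Max f)) - p \<partial>(\<Pi>\<^sub>M i\<in>f. M)) = 0"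
  proof -
    have "(\<integral>v. W (v (Min f), v (Max f)) - p \<partial>(\<Pi>\<^sub>M i\<in>f. M))
       = (\<integral>z. W z - p \<partial>distr (\<Pi>\<^sub>M i\<in>f. M) (M \<Otimes>\<^sub>M M) (\<lambda>v. (v (Min f), v (Max f))))"
      using kernelsD(1)[OF W]
      by (intro integral_distr[symmetric] measurable_Pair measurable_component_singleton fm) auto
    also have "\<dots> = (\<integral>z. W z - p \<partial>(M \<Otimes>\<^sub>M M))"
      using distr_PiM_pair[OF fm] mm(3)[OF f] by simp
    also have "\<dots> = 0"
      using integrable_kernel[OF W] prob_space.prob_space[OF prob_space_square]
      by (simp add: p)
    finally show ?thesis .
  qed
  have qe: "?q (merge I f (u, v)) e = ?q u e" for u v
  proof -
    have "((merge I f (u, v))(a := x, b := y)) i = (u(a := x, b := y)) i" if "i \<in> e" for i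
      using that disj e_sub by (auto simp: I_def merge_def)
    then show ?thesis using em by (simp add: edge_values_def)
  qed
  have qf: "?q (merge I f (u, v)) f = W (v (Min f), v (Max f))" for u v
  proof -
    have "((merge I f (u, v))(a := x, b := y)) i = v i" if "i \<in> f" for i
      using that disj by (auto simp: I_def merge_def)
    then show ?thesis using fm by (simp add: edge_values_def)
  qed
  have "(\<integral>w. (?q w e - p) * (?q w f - p) \<partial>samples k a b)
    = (\<integral>u. (\<integral>v. (?q (merge I f (u, v)) e - p) * (?q (merge I f (u, v)) f - p) \<partial>(\<Pi>\<^sub>M i\<in>f. M)) \<partial>(\<Pi>\<^sub>M i\<in>I. M))"
    using int unfolding U by (intro P.product_integral_fold) (auto simp: I_def f_sub)
  also have "\<dots> = (\<integral>u. (?q u e - p) * (\<integral>v. W (v (Min f), v (Max f)) - p \<partial>(\<Pi>\<^sub>M i\<in>f. M)) \<partial>(\<Pi>\<^sub>M i\<in>I. M))"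
    unfolding qe qf by simp
  finally show ?thesis unfolding zero by simp
qed

lemma expectation_unit_valued:
  assumes "W \<in> kernels M" "unit_valued W"
  shows "0 \<le> (\<integral>z. W z \<partial>(M \<Otimes>\<^sub>M M))" "(\<integral>z. W z \<partial>(M \<Otimes>\<^sub>M M)) \<le> 1"
proof -
  have u: "0 \<le> W z \<and> W z \<le> 1" if "z \<in> space (M \<Otimes>\<^sub>M M)" for z
    using that unit_valuedD[OF assms(2)] by (auto simp: space_pair_measure)
  show "0 \<le> (\<integral>z. W z \<partial>(M \<Otimes>\<^sub>M M))" using u by (intro Bochner_Integration.integral_nonneg) auto
  show "(\<integral>z. W z \<partial>(M \<Otimes>\<^sub>M M)) \<le> 1"
    using u by (intro prob_space.integral_le_const[OF prob_space_square] integrable_kernel assms) auto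
qed

text \<open>Only pairs in which \<open>f\<close> meets \<open>e\<close> or a root contribute, each
  by at most 1. At most 4 vertices are involved and each lies on at most \<open>k\<close> edges,
  which leaves at most 4 k choices of \<open>f\<close> for every \<open>e\<close>.\<close>

lemma edge_sum_second_moment:
  assumes W: "W \<in> kernels M" "unit_valued W" and xy: "x \<in> space M" "y \<in> space M"
    and p: "p = (\<integral>z. W z \<partial>(M \<Otimes>\<^sub>M M))"
  shows "integrable (samples k a b) (\<lambda>w. ((\<Sum>e\<in>complete_graph_on k. edge_values W (w(a := x, b := y)) e) -
      real (k choose 2) * p)\<^sup>2)"
    and "(\<integral>w. ((\<Sum>e\<in>complete_graph_on k. edge_values W (w(a := x, b := y)) e) -
      real (k choose 2) * p)\<^sup>2 \<partial>samples k a b) \<le> real (k choose 2) * (4 * real k)"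
proof -
  let ?E = "complete_graph_on k"
  let ?q = "\<lambda>w. edge_values W (w(a := x, b := y))"
  interpret S: prob_space "samples k a b" by (rule prob_space_samples)
  have p01: "0 \<le> p" "p \<le> 1" using expectation_unit_valued[OF W] p by auto
  have q1: "\<bar>?q w e - p\<bar> \<le> 1" if "w \<in> space (samples k a b)" "e \<in> ?E" for w e
    using edge_values_bounds[where P = "\<lambda>u. 0 \<le> u \<and> u \<le> 1" and W = W, OF unit_valuedD[OF W(2)] that(1) xy that(2)] p01
    by auto
  have qq: "\<bar>(?q w e - p) * (?q w f - p)\<bar> \<le> 1" if "w \<in> space (samples k a b)" "e \<in> ?E" "f \<in> ?E" for w e f
    using mult_mono[OF q1[OF that(1,2)] q1[OF that(1,3)]] by (simp add: abs_mult)
  have int: "integrable (samples k a b) (\<lambda>w. (?q w e - p) * (?q w f - p))" if "e \<in> ?E" "f \<in> ?E" for e f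
  proof (rule S.integrable_const_bound[of _ 1])
    show "(\<lambda>w. (?q w e - p) * (?q w f - p)) \<in> borel_measurable (samples k a b)"
      by (intro borel_measurable_times borel_measurable_diff borel_measurable_const
          measurable_edge_values_sample[OF kernelsD(1)[OF W(1)] _ xy] that)
    show "AE w in samples k a b. norm ((?q w e - p) * (?q w f - p)) \<le> 1"
      using qq that by (intro AE_I2) auto
  qed
  have sq: "((\<Sum>e\<in>?E. ?q w e) - real (k choose 2) * p)\<^sup>2 = (\<Sum>e\<in>?E. \<Sum>f\<in>?E. (?q w e - p) * (?q w f - p))" for w
  proof -
    have "(\<Sum>e\<in>?E. ?q w e) - real (k choose 2) * p = (\<Sum>e\<in>?E. ?q w e - p)"
      by (simp add: sum_subtractf card_complete_graph_on)
    then show ?thesis by (simp only: power2_eq_square sum_product)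
  qed
  show "integrable (samples k a b) (\<lambda>w. ((\<Sum>e\<in>?E. ?q w e) - real (k choose 2) * p)\<^sup>2)"
    unfolding sq by (intro Bochner_Integration.integrable_sum int)
  have "(\<integral>w. ((\<Sum>e\<in>?E. ?q w e) - real (k choose 2) * p)\<^sup>2 \<partial>samples k a b)
    = (\<Sum>e\<in>?E. \<Sum>f\<in>?E. \<integral>w. (?q w e - p) * (?q w f - p) \<partial>samples k a b)"
    unfolding sq using int by (simp add: Bochner_Integration.integral_sum)
  also have "\<dots> \<le> (\<Sum>e\<in>?E. \<Sum>f\<in>?E. of_bool (f \<inter> ({a, b} \<union> e) \<noteq> {}))"
  proof (intro sum_mono)
    fix e f assume e: "e \<in> ?E" and f: "f \<in> ?E"
    have "\<bar>\<integral>w. (?q w e - p) * (?q w f - p) \<partial>samples k a b\<bar> \<le> 1"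
      by (rule S.abs_integral_le_const) (use qq e f in auto)
    then show "(\<integral>w. (?q w e - p) * (?q w f - p) \<partial>samples k a b) \<le> of_bool (f \<inter> ({a, b} \<union> e) \<noteq> {})"
      using expectation_disjoint_edges_eq_0[OF W(1) xy e f _ p, of a b]
      by (cases "f \<inter> ({a, b} \<union> e) = {}") auto
  qed
  also have "\<dots> \<le> (\<Sum>e\<in>?E. 4 * real k)"
  proof (rule sum_mono)
    fix e assume e: "e \<in> ?E"
    then have ce: "finite e" "card e = 2" using card.infinite by (fastforce simp: complete_graph_on_def)+
    have "card ({a, b} \<union> e) \<le> card {a, b} + card e" by (rule card_Un_le)
    also have "\<dots> \<le> 4" using ce by (simp add: card_insert_if)
    finally have c4: "card ({a, b} \<union> e) \<le> 4" .
    have "(\<Sum>f\<in>?E. of_bool (f \<inter> ({a, b} \<union> e) \<noteq> {}) :: real) = card (?E \<inter> {f. f \<inter> ({a, b} \<union> e) \<noteq> {}})"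
      by (rule sum_of_bool_eq; rule finite_complete_graph_on)
    also have "?E \<inter> {f. f \<inter> ({a, b} \<union> e) \<noteq> {}} = {f \<in> ?E. f \<inter> ({a, b} \<union> e) \<noteq> {}}" by blast
    also have "real (card {f \<in> ?E. f \<inter> ({a, b} \<union> e) \<noteq> {}}) \<le> real (card ({a, b} \<union> e) * k)"
      using card_edges_meeting_le[of "{a, b} \<union> e" k] ce(1) by (simp only: of_nat_le_iff) simp
    also have "\<dots> \<le> real (4 * k)" using c4 by (simp only: of_nat_le_iff mult_le_mono1)
    finally show "(\<Sum>f\<in>?E. of_bool (f \<inter> ({a, b} \<union> e) \<noteq> {}) :: real) \<le> 4 * real k" by simp
  qed
  also have "\<dots> = real (k choose 2) * (4 * real k)" by (simp add: card_complete_graph_on)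
  finally show "(\<integral>w. ((\<Sum>e\<in>?E. ?q w e) - real (k choose 2) * p)\<^sup>2 \<partial>samples k a b) \<le> real (k choose 2) * (4 * real k)" .
qed

lemma choose_two_real: "2 * real (k choose 2) = real k * (real k - 1)"
proof -
  have "2 dvd k * (k - 1)" by (cases k) auto
  then have "2 * (k choose 2) = k * (k - 1)" unfolding choose_two by (rule dvd_mult_div_cancel)
  then have "2 * real (k choose 2) = real (k * (k - 1))" by (metis of_nat_mult of_nat_numeral)
  then show ?thesis by (cases k) (auto simp: algebra_simps)
qed

text \<open>Chebyshev's inequality with two layers of randomness. With N pairs, choosing the
  vertices contributes 4 k N to the second moment and choosing the edges another N, together at most
  5 k N. Dividing by the square of N \<open>\<delta>\<close>, where N = k (k - 1) / 2, produces the
  constant 10.\<close>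

lemma atypical_edge_count_le:
  assumes W: "W \<in> kernels M" "unit_valued W" and xy: "x \<in> space M" "y \<in> space M"
    and p: "p = (\<integral>z. W z \<partial>(M \<Otimes>\<^sub>M M))" and k: "k \<ge> 2" and d: "\<delta> > 0"
    and B: "B \<subseteq> graphs_on k" "\<And>F. F \<in> B \<Longrightarrow> real (k choose 2) * \<delta> \<le> \<bar>real (card F) - real (k choose 2) * p\<bar>"
  shows "(\<integral>w. (\<Sum>F\<in>B. bernoulli_weight (edge_values W (w(a := x, b := y))) (complete_graph_on k) F) \<partial>samples k a b)
    \<le> 10 / ((real k - 1) * \<delta>\<^sup>2)"
proof -
  let ?E = "complete_graph_on k" and ?N = "real (k choose 2)"
  let ?q = "\<lambda>w. edge_values W (w(a := x, b := y))"
  let ?A = "\<lambda>w. \<Sum>F\<in>B. bernoulli_weight (?q w) ?E F"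
  interpret S: prob_space "samples k a b" by (rule prob_space_samples)
  have N: "?N > 0" using k by (simp add: zero_less_binomial)
  have iA: "integrable (samples k a b) ?A"
    by (intro Bochner_Integration.integrable_sum integrable_bernoulli_weight W xy)
  note sm = edge_sum_second_moment[OF W xy p, of k a b]
  have "(?N * \<delta>)\<^sup>2 * (\<integral>w. ?A w \<partial>samples k a b) = (\<integral>w. (?N * \<delta>)\<^sup>2 * ?A w \<partial>samples k a b)" by simp
  also have "\<dots> \<le> (\<integral>w. ((\<Sum>e\<in>?E. ?q w e) - ?N * p)\<^sup>2 + ?N \<partial>samples k a b)"
  proof (rule integral_mono)
    show "integrable (samples k a b) (\<lambda>w. (?N * \<delta>)\<^sup>2 * ?A w)" using iA by simp
    show "integrable (samples k a b) (\<lambda>w. ((\<Sum>e\<in>?E. ?q w e) - ?N * p)\<^sup>2 + ?N)"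
      by (intro Bochner_Integration.integrable_add S.integrable_const sm(1))
    fix w assume w: "w \<in> space (samples k a b)"
    have q01: "0 \<le> ?q w e \<and> ?q w e \<le> 1" if "e \<in> ?E" for e
      by (rule edge_values_bounds[where P = "\<lambda>u. 0 \<le> u \<and> u \<le> 1" and W = W, OF unit_valuedD[OF W(2)] w xy that])
    note nn = bernoulli_weight_nonneg[of ?E "?q w", OF q01]
    have "(?N * \<delta>)\<^sup>2 * ?A w = (\<Sum>F\<in>B. bernoulli_weight (?q w) ?E F * (?N * \<delta>)\<^sup>2)"
      by (simp add: sum_distrib_left mult.commute)
    also have "\<dots> \<le> (\<Sum>F\<in>B. bernoulli_weight (?q w) ?E F * (real (card F) - ?N * p)\<^sup>2)"
    proof (intro sum_mono mult_left_mono nn)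
      fix F assume "F \<in> B"
      then have "\<bar>?N * \<delta>\<bar> \<le> \<bar>real (card F) - ?N * p\<bar>" using B(2) N d by simp
      then show "(?N * \<delta>)\<^sup>2 \<le> (real (card F) - ?N * p)\<^sup>2" by (rule abs_le_square_iff[THEN iffD1])
    qed
    also have "\<dots> \<le> (\<Sum>F\<in>Pow ?E. bernoulli_weight (?q w) ?E F * (real (card F) - ?N * p)\<^sup>2)"
      using B(1) nn by (intro sum_mono2) (auto simp: graphs_on_def)
    also have "\<dots> \<le> ((\<Sum>e\<in>?E. ?q w e) - ?N * p)\<^sup>2 + ?N"
      using bernoulli_second_moment[of ?E "?q w" "?N * p"] q01 by (simp add: card_complete_graph_on)
    finally show "(?N * \<delta>)\<^sup>2 * ?A w \<le> ((\<Sum>e\<in>?E. ?q w e) - ?N * p)\<^sup>2 + ?N" .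
  qed
  also have "\<dots> \<le> ?N * (4 * real k) + ?N" 
    using sm(2) Bochner_Integration.integral_add[OF sm(1) S.integrable_const[of ?N]] by (simp add: S.prob_space del: One_nat_def)
  also have "\<dots> \<le> ?N * (5 * real k)" using k N by (simp add: algebra_simps)
  finally have "?N * (?N * \<delta>\<^sup>2 * (\<integral>w. ?A w \<partial>samples k a b)) \<le> ?N * (5 * real k)"
    by (simp add: power2_eq_square mult_ac)
  then have bound: "?N * \<delta>\<^sup>2 * (\<integral>w. ?A w \<partial>samples k a b) \<le> 5 * real k" using N by simp
  have "real k * ((real k - 1) * \<delta>\<^sup>2 * X) = 2 * (?N * \<delta>\<^sup>2 * X)" for X
  proof -
    have "real k * ((real k - 1) * \<delta>\<^sup>2 * X) = real k * (real k - 1) * \<delta>\<^sup>2 * X" by (simp only: mult.assoc)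
    also have "\<dots> = 2 * ?N * \<delta>\<^sup>2 * X" by (simp only: choose_two_real)
    finally show ?thesis by (simp only: mult.assoc)
  qed
  from this[of "\<integral>w. ?A w \<partial>samples k a b"]
  have "real k * ((real k - 1) * \<delta>\<^sup>2 * (\<integral>w. ?A w \<partial>samples k a b)) \<le> real k * 10"
    using bound by (simp only:)
  then have "(real k - 1) * \<delta>\<^sup>2 * (\<integral>w. ?A w \<partial>samples k a b) \<le> 10" using k by simp
  then show ?thesis using k d by (simp add: pos_le_divide_eq mult_ac)
qed


text \<open>Unless the edge count falls on the wrong side, the gain is exactly c minus the indicator
  of ab, whose mean is \<open>c - W (x, y)\<close>. Otherwise the two differ by at most 1, so the
  error per ordered pair is the probability of the wrong side. The flag \<open>c\<close> encodes the
  side, and \<open>2 * of_bool c - 1\<close> is its sign.\<close>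

lemma extremist_velocity_approx:
  fixes c :: bool
  assumes W: "W \<in> kernels M" "unit_valued W" and xy: "x \<in> space M" "y \<in> space M"
    and p: "p = (\<integral>z. W z \<partial>(M \<Otimes>\<^sub>M M))" and k: "k \<ge> 2" and d: "\<delta> > 0"
    and c: "(2 * of_bool c - 1) * (p - 1 / 2) \<ge> \<delta>"
  shows "\<bar>velocity M k (extremist_rule k) W (x, y) - real k * (real k - 1) * (of_bool c - W (x, y))\<bar>
    \<le> real k * (real k - 1) * (10 / ((real k - 1) * \<delta>\<^sup>2))"
proof -
  let ?E = "complete_graph_on k" and ?N = "real (k choose 2)" and ?R = "extremist_rule k"
  \<comment> \<open>Ties count as atypical on either side, since the rule then leaves the graph
    unchanged.\<close>
  define B where "B = {F \<in> graphs_on k. if c then real (card F) \<le> ?N / 2 else real (card F) \<ge> ?N / 2}"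
  have B: "?N * \<delta> \<le> \<bar>real (card F) - ?N * p\<bar>" if "F \<in> B" for F
  proof -
    have "?N * \<delta> \<le> ?N * ((2 * of_bool c - 1) * (p - 1 / 2))" using c by (intro mult_left_mono) auto
    then show ?thesis using that by (cases c) (auto simp: B_def algebra_simps)
  qed
  have "\<bar>pair_velocity k ?R a b W x y - (of_bool c - W (x, y))\<bar> \<le> 10 / ((real k - 1) * \<delta>\<^sup>2)"
    if ab: "(a, b) \<in> vertex_pairs k" for a b
  proof -
    interpret S: prob_space "samples k a b" by (rule prob_space_samples)
    let ?q = "\<lambda>w. edge_values W (w(a := x, b := y))"
    let ?A = "\<lambda>w. \<Sum>F\<in>B. bernoulli_weight (?q w) ?E F"
    have iA: "integrable (samples k a b) ?A"
      by (intro Bochner_Integration.integrable_sum integrable_bernoulli_weight W xy)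
    have ae: "a \<noteq> b" "{a, b} \<in> ?E" using ab edge_in_complete_graph_on by (auto simp: vertex_pairs_def)
    have pt: "\<bar>mean_gain k ?R a b (?q w) - (of_bool c - W (x, y))\<bar> \<le> ?A w" if w: "w \<in> space (samples k a b)" for w
    proof -
      have q01: "0 \<le> ?q w e \<and> ?q w e \<le> 1" if "e \<in> ?E" for e
        by (rule edge_values_bounds[where P = "\<lambda>u. 0 \<le> u \<and> u \<le> 1" and W = W, OF unit_valuedD[OF W(2)] w xy that])
      let ?w = "bernoulli_weight (?q w) ?E"
      have nn: "?w F \<ge> 0" for F by (rule bernoulli_weight_nonneg) (rule q01)
      \<comment> \<open>The target is rewritten as the mean of c minus the indicator of ab, so that
        it can be compared with the gain graph by graph.\<close>
      have "(\<Sum>F\<in>graphs_on k. ?w F * (of_bool c - of_bool ({a, b} \<in> F))) =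
        of_bool c * (\<Sum>F\<in>Pow ?E. ?w F) - (\<Sum>F\<in>Pow ?E. ?w F * of_bool ({a, b} \<in> F))"
        unfolding graphs_on_def right_diff_distrib sum_subtractf sum_distrib_left by (simp only: mult.commute)
      also have "\<dots> = of_bool c - W (x, y)"
        unfolding sum_bernoulli_weight[OF finite_complete_graph_on]
          sum_bernoulli_weight_mem[OF finite_complete_graph_on ae(2)] edge_values_root[OF W(1) xy ae(1)] by simp
      finally have "\<bar>mean_gain k ?R a b (?q w) - (of_bool c - W (x, y))\<bar>
        = \<bar>\<Sum>F\<in>graphs_on k. ?w F * (edge_gain k ?R a b F - (of_bool c - of_bool ({a, b} \<in> F)))\<bar>"
        by (simp add: mean_gain_def sum_subtractf right_diff_distrib mult.commute)
      also have "\<dots> \<le> (\<Sum>F\<in>graphs_on k. \<bar>?w F * (edge_gain k ?R a b F - (of_bool c - of_bool ({a, b} \<in> F)))\<bar>)"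
        by (rule sum_abs)
      also have "\<dots> \<le> (\<Sum>F\<in>graphs_on k. if F \<in> B then ?w F else 0)"
      proof (rule sum_mono)
        fix F assume F: "F \<in> graphs_on k"
        have "\<bar>edge_gain k ?R a b F - (of_bool c - of_bool ({a, b} \<in> F))\<bar> \<le> of_bool (F \<in> B)"
        proof -
          have FB: "F \<in> B \<longleftrightarrow> (if c then real (card F) \<le> ?N / 2 else real (card F) \<ge> ?N / 2)"
            using F by (simp add: B_def)
          consider "real (card F) < ?N / 2" | "real (card F) > ?N / 2" | "real (card F) = ?N / 2" by linarith
          then show ?thesis
            by cases (cases c; cases "{a, b} \<in> F"; simp add: FB edge_gain_extremist_rule[OF F ab])+
        qed
        then have "?w F * \<bar>edge_gain k ?R a b F - (of_bool c - of_bool ({a, b} \<in> F))\<bar> \<le> ?w F * of_bool (F \<in> B)"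
          by (intro mult_left_mono nn)
        then show "\<bar>?w F * (edge_gain k ?R a b F - (of_bool c - of_bool ({a, b} \<in> F)))\<bar> \<le> (if F \<in> B then ?w F else 0)"
          unfolding abs_mult abs_of_nonneg[OF nn] by (cases "F \<in> B") (simp_all only: of_bool_eq simp_thms if_True if_False mult_1_right mult_zero_right)
      qed
      also have "\<dots> = (\<Sum>F\<in>B. ?w F)"
      proof -
        have "graphs_on k \<inter> B = B" by (auto simp: B_def)
        then show ?thesis using sum.inter_restrict[of "graphs_on k" ?w B] by simp
      qed
      finally show ?thesis .
    qed
    have "\<bar>pair_velocity k ?R a b W x y - (of_bool c - W (x, y))\<bar>
      = \<bar>\<integral>w. mean_gain k ?R a b (?q w) - (of_bool c - W (x, y)) \<partial>samples k a b\<bar>"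
      using integrable_mean_gain[OF W(1) xy] by (simp add: pair_velocity_def S.prob_space del: One_nat_def)
    also have "\<dots> \<le> (\<integral>w. \<bar>mean_gain k ?R a b (?q w) - (of_bool c - W (x, y))\<bar> \<partial>samples k a b)"
      by (rule integral_abs_bound)
    also have "\<dots> \<le> (\<integral>w. ?A w \<partial>samples k a b)"
      by (intro integral_mono integrable_abs Bochner_Integration.integrable_diff
          integrable_mean_gain[OF W(1) xy] S.integrable_const iA pt)
    also have "\<dots> \<le> 10 / ((real k - 1) * \<delta>\<^sup>2)"
      by (rule atypical_edge_count_le[OF W xy p k d _ B]) (auto simp: B_def)
    finally show ?thesis .
  qed
  then have "\<bar>\<Sum>(a, b)\<in>vertex_pairs k. pair_velocity k ?R a b W x y - (of_bool c - W (x, y))\<bar>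
    \<le> real k * (real k - 1) * (10 / ((real k - 1) * \<delta>\<^sup>2))"
    by (rule abs_sum_vertex_pairs_le)
  moreover have "(\<Sum>(a, b)\<in>vertex_pairs k. pair_velocity k ?R a b W x y - (of_bool c - W (x, y)))
    = velocity M k ?R W (x, y) - real k * (real k - 1) * (of_bool c - W (x, y))"
    unfolding velocity_eq_sum_pair_velocity[OF W(1) xy]
    by (simp add: case_prod_beta sum_subtractf card_vertex_pairs right_diff_distrib)
  ultimately show ?thesis by simp
qed

subsection \<open>The rescaled limit\<close>

text \<open>The velocity estimate needs the density to keep distance \<open>\<delta>\<close> from
  one half. Once this is known for all times, every single value \<open>u t (x, y)\<close> solves a
  perturbed linear equation with rate k (k - 1) and relative error \<open>\<eta>\<close>.\<close>

lemma extremist_trajectory_approx: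
  fixes c :: bool
  assumes W: "W \<in> kernels M" "unit_valued W" and p: "p = (\<integral>z. W z \<partial>(M \<Otimes>\<^sub>M M))"
    and d: "\<delta> > 0" and c: "(2 * of_bool c - 1) * (p - 1 / 2) \<ge> 2 * \<delta>"
    and k: "k \<ge> 2" and \<eta>: "\<eta> = 10 / ((real k - 1) * \<delta>\<^sup>2)" "\<eta> < 1 / 4"
    and u: "strong_trajectory k (extremist_rule k) W u" and t: "t \<ge> 0" and xy: "x \<in> space M" "y \<in> space M"
  shows "\<bar>u t (x, y) - (of_bool c + exp (- (real k * (real k - 1) * t)) * (W (x, y) - of_bool c))\<bar> \<le> \<eta>"
proof -
  let ?V = "velocity M k (extremist_rule k)"
  let ?K = "real k * (real k - 1)"
  let ?s = "2 * of_bool c - 1 :: real"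
  define q where "q t = (\<integral>z. u t z \<partial>(M \<Otimes>\<^sub>M M))" for t
  have K: "?K > 0" using k by simp
  have \<eta>0: "\<eta> \<ge> 0" using k \<eta>(1) by simp
  note ut = strong_trajectoryD(1,2)[OF u]
  have q0: "q 0 = p"
    unfolding q_def p by (intro Bochner_Integration.integral_cong) (auto simp: space_pair_measure strong_trajectoryD(3)[OF u])
  have approx: "\<bar>?V (u t) (x, y) - ?K * (of_bool c - u t (x, y))\<bar> \<le> ?K * \<eta>"
    if "t \<ge> 0" "?s * (q t - 1 / 2) \<ge> \<delta>" "x \<in> space M" "y \<in> space M" for t x y
    using extremist_velocity_approx[OF ut(1)[OF that(1)] ut(2)[OF that(1)] that(3,4) q_def k d that(2)]
    unfolding \<eta>(1) .
  have "p \<le> 1" "p \<ge> 0" using expectation_unit_valued[OF W] p by auto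
  \<comment> \<open>From \<open>2 * \<delta> \<le> \<bar>p - 1 / 2\<bar> \<le> 1 / 2\<close>.
    Together with \<open>\<eta> < 1 / 4\<close> it makes the outward drift k (k - 1) (1/2 -
    \<open>\<delta>\<close> - \<open>\<eta>\<close>) positive at the barrier.\<close>
  then have d4: "\<delta> \<le> 1 / 4" using c by (cases c) auto
  \<comment> \<open>The velocity estimate holds at the barrier but not beyond it, so the criterion
    that tests the derivative only on the level \<open>\<delta>\<close> is the suitable one.\<close>
  have stay: "?s * (q t - 1 / 2) \<ge> \<delta>" if "t \<ge> 0" for t
  proof (rule stays_ge_of_deriv_pos[OF _ _ _ that])
    show "((\<lambda>t. ?s * (q t - 1 / 2)) has_real_derivative ?s * (\<integral>z. ?V (u t) z \<partial>(M \<Otimes>\<^sub>M M))) (at t within {0..})"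
      if "t \<ge> 0" for t
      using strong_trajectory_integral[OF is_rule_extremist_rule u that]
      unfolding q_def[symmetric] by (auto intro!: derivative_eq_intros)
    show "\<delta> \<le> ?s * (q 0 - 1 / 2)" using c d q0 by simp
    fix t :: real assume t: "t \<ge> 0" and eq: "?s * (q t - 1 / 2) = \<delta>"
    have iu: "integrable (M \<Otimes>\<^sub>M M) (u t)" by (rule integrable_kernel[OF ut(1)[OF t]])
    have iV: "integrable (M \<Otimes>\<^sub>M M) (?V (u t))"
      by (rule integrable_bounded_on_space[OF measurable_velocity[OF ut(1)[OF t]]
            velocity_bounds(1)[OF is_rule_extremist_rule ut(1)[OF t] unit_valuedD[OF ut(2)[OF t]]]])
    have "\<bar>\<integral>z. ?V (u t) z - ?K * (of_bool c - u t z) \<partial>(M \<Otimes>\<^sub>M M)\<bar> \<le> ?K * \<eta>"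
      by (rule prob_space.abs_integral_le_const[OF prob_space_square])
        (use approx[OF t] eq K \<eta>0 in \<open>auto simp: space_pair_measure\<close>)
    moreover have "(\<integral>z. ?V (u t) z - ?K * (of_bool c - u t z) \<partial>(M \<Otimes>\<^sub>M M))
      = (\<integral>z. ?V (u t) z \<partial>(M \<Otimes>\<^sub>M M)) - ?K * (of_bool c - q t)"
      using iu iV prob_space.prob_space[OF prob_space_square] by (simp add: q_def)
    ultimately have ap: "\<bar>(\<integral>z. ?V (u t) z \<partial>(M \<Otimes>\<^sub>M M)) - ?K * (of_bool c - q t)\<bar> \<le> ?K * \<eta>" by simp
    have "?K * (1 / 2 - \<delta> - \<eta>) > 0" by (rule mult_pos_pos[OF K]) (use d4 \<eta>(2) in simp)
    moreover have "?s * (\<integral>z. ?V (u t) z \<partial>(M \<Otimes>\<^sub>M M)) \<ge> ?K * (1 / 2 - \<delta> - \<eta>)"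
    proof -
      have "?s * (?K * (of_bool c - q t)) = ?K * (1 / 2 - \<delta>)"
        using eq by (cases c) auto
      moreover have "?s * X \<ge> ?s * Y - r" if "\<bar>X - Y\<bar> \<le> r" for X Y r :: real
        using that by (cases c) auto
      ultimately show ?thesis using ap by (fastforce simp: right_diff_distrib)
    qed
    ultimately show "?s * (\<integral>z. ?V (u t) z \<partial>(M \<Otimes>\<^sub>M M)) > 0" by linarith
  qed
  have "\<bar>u t (x, y) - (of_bool c + exp (- (?K * t)) * (u 0 (x, y) - of_bool c))\<bar> \<le> \<eta>"
    by (rule perturbed_linear_ode[OF strong_trajectory_pointwise[OF u _ xy] _ \<eta>0 _ t])
      (use K approx[OF _ stay _ _] xy in auto)
  then show ?thesis by (simp add: strong_trajectoryD(3)[OF u xy])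
qed

lemma graphon_truncate:
  assumes "W \<in> graphons M"
  obtains W' where "W' \<in> kernels M" "unit_valued W'" "AE z in M \<Otimes>\<^sub>M M. W z = W' z"
proof -
  have W: "W \<in> kernels M" and ae: "AE z in M \<Otimes>\<^sub>M M. 0 \<le> W z \<and> W z \<le> 1"
    using assms by (auto simp: graphons_def)
  define W' where "W' z = max 0 (min 1 (W z))" for z
  show thesis
  proof (rule that[of W'])
    have [measurable]: "W \<in> borel_measurable (M \<Otimes>\<^sub>M M)" using kernelsD(1)[OF W] .
    have "W' \<in> borel_measurable (M \<Otimes>\<^sub>M M)" unfolding W'_def by measurable
    moreover have "\<exists>C. \<forall>x\<in>space M. \<forall>y\<in>space M. \<bar>W' (x, y)\<bar> \<le> C" by (rule exI[of _ 1]) (auto simp: W'_def)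
    moreover have "W' (x, y) = W' (y, x)" if "x \<in> space M" "y \<in> space M" for x y
      using kernelsD(3)[OF W that] by (simp add: W'_def)
    ultimately show "W' \<in> kernels M" by (simp add: kernels_def)
    show "unit_valued W'" by (simp add: unit_valued_def W'_def)
    show "AE z in M \<Otimes>\<^sub>M M. W z = W' z" using ae by eventually_elim (simp add: W'_def)
  qed
qed

lemma l1_norm_graphon:
  assumes "W \<in> graphons M"
  shows "l1_norm M W = (\<integral>z. W z \<partial>(M \<Otimes>\<^sub>M M))"
proof -
  have [measurable]: "W \<in> borel_measurable (M \<Otimes>\<^sub>M M)" and ae: "AE z in M \<Otimes>\<^sub>M M. 0 \<le> W z \<and> W z \<le> 1"
    using assms kernelsD(1) by (auto simp: graphons_def)
  show ?thesis unfolding l1_norm_def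
    by (rule integral_cong_AE) (use ae in \<open>auto elim!: AE_mono_on_space\<close>)
qed

text \<open>This shape covers the limits, where \<open>a\<close> and \<open>b\<close> are both the
  limiting constant, and the perturbations at density one half, where \<open>b\<close> is 0.\<close>

lemma kernel_affine:
  assumes "W \<in> kernels M"
  shows "(\<lambda>z. a + r * (W z - b)) \<in> kernels M"
proof -
  obtain C where C: "\<forall>x\<in>space M. \<forall>y\<in>space M. \<bar>W (x, y)\<bar> \<le> C" using kernelsD(2)[OF assms] by blast
  have "\<bar>a + r * (W (x, y) - b)\<bar> \<le> \<bar>a\<bar> + \<bar>r\<bar> * (C + \<bar>b\<bar>)" if "x \<in> space M" "y \<in> space M" for x y
  proof -
    have "\<bar>W (x, y)\<bar> \<le> C" using C that by blast
    then have "\<bar>W (x, y) - b\<bar> \<le> C + \<bar>b\<bar>" by linarith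
    then have "\<bar>r * (W (x, y) - b)\<bar> \<le> \<bar>r\<bar> * (C + \<bar>b\<bar>)" unfolding abs_mult by (intro mult_left_mono) auto
    then show ?thesis by linarith
  qed
  moreover have "(\<lambda>z. a + r * (W z - b)) \<in> borel_measurable (M \<Otimes>\<^sub>M M)"
    using kernelsD(1)[OF assms] by auto
  ultimately show ?thesis using kernelsD(3)[OF assms] unfolding kernels_def
    by (auto intro!: exI[of _ "\<bar>a\<bar> + \<bar>r\<bar> * (C + \<bar>b\<bar>)"])
qed

lemma extremist_rescaled_limit:
  fixes c :: bool
  assumes W: "W \<in> graphons M" and ne: "l1_norm M W \<noteq> 1 / 2" and c: "c \<longleftrightarrow> l1_norm M W > 1 / 2" and t: "t \<ge> 0"
  shows "is_rescaled_limit M extremist_rule t W (\<lambda>z. of_bool c + exp (- t) * (W z - of_bool c))"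
  unfolding is_rescaled_limit_def
proof
  have Wk: "W \<in> kernels M" using W by (simp add: graphons_def)
  let ?U = "\<lambda>z. of_bool c + exp (- t) * (W z - of_bool c)"
  show U: "?U \<in> kernels M" by (rule kernel_affine[OF Wk])
  \<comment> \<open>A graphon lies in the unit interval only almost everywhere; strong trajectories
    start from a truncated representative.\<close>
  obtain W' where W': "W' \<in> kernels M" "unit_valued W'" "AE z in M \<Otimes>\<^sub>M M. W z = W' z"
    using graphon_truncate[OF W] by blast
  define p where "p = (\<integral>z. W' z \<partial>(M \<Otimes>\<^sub>M M))"
  have p: "l1_norm M W = p"
    unfolding l1_norm_graphon[OF W] p_def
    by (rule integral_cong_AE) (use W' kernelsD(1) Wk in auto)
  \<comment> \<open>Half the distance to density one half, so that the starting margin is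
    \<open>2 * \<delta>\<close>. It does not depend on \<open>k\<close>, which lets
    \<open>\<eta> k\<close> tend to 0.\<close>
  define \<delta> where "\<delta> = \<bar>p - 1 / 2\<bar> / 2"
  have d: "\<delta> > 0" using ne p by (simp add: \<delta>_def)
  have side: "(2 * of_bool c - 1) * (p - 1 / 2) \<ge> 2 * \<delta>" using c p by (cases c) (auto simp: \<delta>_def)
  define \<eta> where "\<eta> k = 10 / ((real k - 1) * \<delta>\<^sup>2)" for k
  have "\<eta> \<longlonglongrightarrow> 0" unfolding \<eta>_def using d by real_asymp
  show "(\<lambda>k. linf_norm M (\<lambda>z. flow M k (extremist_rule k) (t / (real k * (real k - 1))) W z - ?U z)) \<longlonglongrightarrow> 0"
    unfolding tendsto_linf_norm_0_iff
  proof (intro allI impI)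
    fix e :: real assume e: "e > 0"
    have "\<forall>\<^sub>F k in sequentially. \<eta> k < min e (1 / 4)"
      using order_tendstoD(2)[OF \<open>\<eta> \<longlonglongrightarrow> 0\<close>, of "min e (1 / 4)"] e by simp
    then show "\<forall>\<^sub>F k in sequentially. linf_norm M (\<lambda>z. flow M k (extremist_rule k) (t / (real k * (real k - 1))) W z - ?U z) \<le> ereal e"
      using eventually_ge_at_top[of 2]
    proof eventually_elim
      case (elim k)
      let ?K = "real k * (real k - 1)"
      have K: "?K > 0" using elim by simp
      have tK: "t / ?K \<ge> 0" "?K * (t / ?K) = t"
        using t K by (simp, metis less_irrefl nonzero_mult_div_cancel_left times_divide_eq_right)
      obtain u where u: "strong_trajectory k (extremist_rule k) W' u"
        using strong_trajectory_exists[OF is_rule_extremist_rule W'(1,2)] by blast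
      note fl = flow_AE_eq[OF is_rule_extremist_rule u W'(3) tK(1)]
      show ?case
      proof (rule linf_norm_le)
        show "(\<lambda>z. flow M k (extremist_rule k) (t / ?K) W z - ?U z) \<in> borel_measurable (M \<Otimes>\<^sub>M M)"
          using kernelsD(1)[OF fl(2)] kernelsD(1)[OF U] by (rule borel_measurable_diff)
        have "AE z in M \<Otimes>\<^sub>M M. \<bar>u (t / ?K) z - (of_bool c + exp (- t) * (W' z - of_bool c))\<bar> \<le> \<eta> k"
        proof (rule AE_I_on_space)
          fix x y assume xy: "x \<in> space M" "y \<in> space M"
          have "\<eta> k < 1 / 4" using elim by simp
          from extremist_trajectory_approx[OF W'(1,2) p_def d side elim(2) \<eta>_def this u tK(1) xy]
          show "\<bar>u (t / ?K) (x, y) - (of_bool c + exp (- t) * (W' (x, y) - of_bool c))\<bar> \<le> \<eta> k"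
            unfolding tK(2) .
        qed
        with fl(1) W'(3) show "AE z in M \<Otimes>\<^sub>M M. \<bar>flow M k (extremist_rule k) (t / ?K) W z - ?U z\<bar> \<le> e"
        proof eventually_elim
          case (elim z)
          have "\<eta> k \<le> e" using \<open>\<eta> k < min e (1 / 4)\<close> by simp
          then show ?case using elim by simp
        qed
      qed
    qed
  qed
qed

lemma is_rescaled_limit_unique:
  assumes "is_rescaled_limit M R t W U" "is_rescaled_limit M R t W U'"
  shows "AE z in M \<Otimes>\<^sub>M M. U z = U' z"
proof -
  let ?f = "\<lambda>k. flow M k (R k) (t / (real k * (real k - 1))) W"
  have k: "U \<in> kernels M" "U' \<in> kernels M" using assms by (auto simp: is_rescaled_limit_def)
  have "linf_norm M (\<lambda>z. U z - U' z) \<le> ereal e" if "e > 0" for e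
  proof -
    have "\<forall>\<^sub>F k in sequentially. linf_norm M (\<lambda>z. ?f k z - U z) \<le> ereal (e / 2)"
      "\<forall>\<^sub>F k in sequentially. linf_norm M (\<lambda>z. ?f k z - U' z) \<le> ereal (e / 2)"
      using assms that unfolding is_rescaled_limit_def tendsto_linf_norm_0_iff by simp_all
    then have "\<forall>\<^sub>F k in sequentially. linf_norm M (\<lambda>z. ?f k z - U z) \<le> ereal (e / 2) \<and> linf_norm M (\<lambda>z. ?f k z - U' z) \<le> ereal (e / 2)"
      by eventually_elim simp
    then obtain k where "linf_norm M (\<lambda>z. ?f k z - U z) \<le> ereal (e / 2)" "linf_norm M (\<lambda>z. ?f k z - U' z) \<le> ereal (e / 2)"
      using eventually_happens by fastforce
    from AE_le_linf_norm[OF this(1)] AE_le_linf_norm[OF this(2)]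
    have "AE z in M \<Otimes>\<^sub>M M. \<bar>U z - U' z\<bar> \<le> e" by eventually_elim linarith
    then show ?thesis using kernelsD(1) k by (intro linf_norm_le borel_measurable_diff) auto
  qed
  then have "((\<lambda>n::nat. linf_norm M (\<lambda>z. U z - U' z)) \<longlonglongrightarrow> 0)"
    unfolding tendsto_linf_norm_0_iff by simp
  then have "linf_norm M (\<lambda>z. U z - U' z) \<le> ereal 0" by (simp add: LIMSEQ_const_iff)
  from AE_le_linf_norm[OF this] show ?thesis by eventually_elim simp
qed

lemma is_rescaled_limit_rescaled_flow:
  assumes "is_rescaled_limit M R t W U"
  shows "is_rescaled_limit M R t W (rescaled_flow M R t W)"
  unfolding rescaled_flow_def using assms by (rule someI[of "is_rescaled_limit M R t W"])

lemma rescaled_flow_extremist: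
  assumes W: "W \<in> graphons M" and ne: "l1_norm M W \<noteq> 1 / 2" and t: "t \<ge> 0"
  shows "AE z in M \<Otimes>\<^sub>M M. rescaled_flow M extremist_rule t W z =
      of_bool (l1_norm M W > 1 / 2) + exp (- t) * (W z - of_bool (l1_norm M W > 1 / 2))"
  using extremist_rescaled_limit[OF W ne refl t]
  by (intro is_rescaled_limit_unique[OF is_rescaled_limit_rescaled_flow])

lemma rescalable_extremist:
  assumes "W \<in> graphons M" "l1_norm M W \<noteq> 1 / 2"
  shows "W \<in> rescalable_set M extremist_rule"
  using extremist_rescaled_limit[OF assms refl] assms(1)
  unfolding rescalable_set_def rescalable_at_def by blast

lemma rescaled_flow_in_kernels:
  assumes "W \<in> rescalable_set M R" "t \<ge> 0"
  shows "rescaled_flow M R t W \<in> kernels M"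
  using assms is_rescaled_limit_rescaled_flow
  unfolding rescalable_set_def rescalable_at_def is_rescaled_limit_def by blast

subsection \<open>The cut distance\<close>

lemma integrable_cut:
  assumes "U \<in> kernels M" "S \<in> sets M" "T \<in> sets M"
  shows "integrable (M \<Otimes>\<^sub>M M) (\<lambda>z. indicator (S \<times> T) z *\<^sub>R U z)"
  using integrable_kernel[OF assms(1)] assms(2,3) by (intro integrable_mult_indicator) auto

lemma cut_integral_diff:
  assumes "U \<in> kernels M" "W \<in> kernels M" "S \<in> sets M" "T \<in> sets M"
  shows "(LINT z:S \<times> T|M \<Otimes>\<^sub>M M. U z - W z) = (LINT z:S \<times> T|M \<Otimes>\<^sub>M M. U z) - (LINT z:S \<times> T|M \<Otimes>\<^sub>M M. W z)"
  by (rule set_integral_diff) (use assms integrable_cut in \<open>auto simp: set_integrable_def\<close>)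

lemma cut_integral_le:
  assumes UW: "U \<in> kernels M" "W \<in> kernels M" and ST: "S \<in> sets M" "T \<in> sets M"
    and c: "AE z in M \<Otimes>\<^sub>M M. \<bar>U z - W z\<bar> \<le> c" "c \<ge> 0"
  shows "\<bar>LINT z:S \<times> T|M \<Otimes>\<^sub>M M. U z - W z\<bar> \<le> c"
proof -
  have int: "integrable (M \<Otimes>\<^sub>M M) (\<lambda>z. indicator (S \<times> T) z *\<^sub>R (U z - W z))"
    using integrable_kernel[OF UW(1)] integrable_kernel[OF UW(2)] ST by (intro integrable_mult_indicator) auto
  have "\<bar>LINT z:S \<times> T|M \<Otimes>\<^sub>M M. U z - W z\<bar> \<le> (\<integral>z. \<bar>indicator (S \<times> T) z *\<^sub>R (U z - W z)\<bar> \<partial>(M \<Otimes>\<^sub>M M))"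
    unfolding set_lebesgue_integral_def by (rule integral_abs_bound)
  also have "\<dots> \<le> c"
  proof (rule prob_space.integral_le_const[OF prob_space_square])
    show "integrable (M \<Otimes>\<^sub>M M) (\<lambda>z. \<bar>indicator (S \<times> T) z *\<^sub>R (U z - W z)\<bar>)" using int by (rule integrable_abs)
    show "AE z in M \<Otimes>\<^sub>M M. \<bar>indicator (S \<times> T) z *\<^sub>R (U z - W z)\<bar> \<le> c"
      using c(1) by eventually_elim (use c(2) in \<open>auto simp: indicator_def\<close>)
  qed
  finally show ?thesis .
qed

text \<open>A supremum of reals bounds its members only if they are bounded above; here this follows
  from boundedness of kernels.\<close>

lemma cut_integral_le_cut_dist:
  assumes UW: "U \<in> kernels M" "W \<in> kernels M" and ST: "S \<in> sets M" "T \<in> sets M"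
  shows "\<bar>LINT z:S \<times> T|M \<Otimes>\<^sub>M M. U z - W z\<bar> \<le> cut_dist M U W"
proof -
  obtain C where C: "\<forall>x\<in>space M. \<forall>y\<in>space M. \<bar>U (x, y)\<bar> \<le> C" using kernelsD(2)[OF UW(1)] by blast
  obtain D where D: "\<forall>x\<in>space M. \<forall>y\<in>space M. \<bar>W (x, y)\<bar> \<le> D" using kernelsD(2)[OF UW(2)] by blast
  have "AE z in M \<Otimes>\<^sub>M M. \<bar>U z - W z\<bar> \<le> \<bar>C + D\<bar>"
  proof (rule AE_I_on_space)
    fix x y assume "x \<in> space M" "y \<in> space M"
    then have "\<bar>U (x, y)\<bar> \<le> C" "\<bar>W (x, y)\<bar> \<le> D" using C D by blast+
    then show "\<bar>U (x, y) - W (x, y)\<bar> \<le> \<bar>C + D\<bar>" by linarith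
  qed
  then have b: "\<bar>LINT z:S \<times> T|M \<Otimes>\<^sub>M M. U z - W z\<bar> \<le> \<bar>C + D\<bar>" if "S \<in> sets M" "T \<in> sets M" for S T
    by (intro cut_integral_le UW that) auto
  have "bdd_above ((\<lambda>(S, T). \<bar>LINT z:S \<times> T|M \<Otimes>\<^sub>M M. U z - W z\<bar>) ` (sets M \<times> sets M))"
    by (rule bdd_aboveI2[of _ _ "\<bar>C + D\<bar>"]) (use b in auto)
  from cSUP_upper[OF _ this, of "(S, T)"] show ?thesis using ST by (simp add: cut_dist_def)
qed

lemma cut_dist_le:
  assumes "\<And>S T. S \<in> sets M \<Longrightarrow> T \<in> sets M \<Longrightarrow> \<bar>LINT z:S \<times> T|M \<Otimes>\<^sub>M M. U z - W z\<bar> \<le> c"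
  shows "cut_dist M U W \<le> c"
  unfolding cut_dist_def by (rule cSUP_least) (use assms in auto)

lemma cut_dist_le_AE:
  assumes "U \<in> kernels M" "W \<in> kernels M" "AE z in M \<Otimes>\<^sub>M M. \<bar>U z - W z\<bar> \<le> c" "c \<ge> 0"
  shows "cut_dist M U W \<le> c"
  by (intro cut_dist_le cut_integral_le assms)

lemma cut_dist_triangle:
  assumes "U \<in> kernels M" "V \<in> kernels M" "W \<in> kernels M"
  shows "cut_dist M U W \<le> cut_dist M U V + cut_dist M V W"
proof (rule cut_dist_le)
  fix S T assume ST: "S \<in> sets M" "T \<in> sets M"
  show "\<bar>LINT z:S \<times> T|M \<Otimes>\<^sub>M M. U z - W z\<bar> \<le> cut_dist M U V + cut_dist M V W"
    using cut_integral_le_cut_dist[OF assms(1,2) ST] cut_integral_le_cut_dist[OF assms(2,3) ST]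
    unfolding cut_integral_diff[OF assms(1,2) ST] cut_integral_diff[OF assms(2,3) ST] cut_integral_diff[OF assms(1,3) ST]
    by linarith
qed

text \<open>Take S and T to be the whole space. Total mass is thus continuous in the cut topology,
  and the two sides of density one half are open.\<close>

lemma integral_diff_le_cut_dist:
  assumes "U \<in> kernels M" "W \<in> kernels M"
  shows "\<bar>(\<integral>z. U z \<partial>(M \<Otimes>\<^sub>M M)) - (\<integral>z. W z \<partial>(M \<Otimes>\<^sub>M M))\<bar> \<le> cut_dist M U W"
proof -
  have "(LINT z:space M \<times> space M|M \<Otimes>\<^sub>M M. U z - W z) = (\<integral>z. U z - W z \<partial>(M \<Otimes>\<^sub>M M))"
    unfolding set_lebesgue_integral_def
    by (rule Bochner_Integration.integral_cong) (auto simp: space_pair_measure)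
  also have "\<dots> = (\<integral>z. U z \<partial>(M \<Otimes>\<^sub>M M)) - (\<integral>z. W z \<partial>(M \<Otimes>\<^sub>M M))"
    using integrable_kernel assms by simp
  finally show ?thesis
    using cut_integral_le_cut_dist[OF assms sets.top sets.top] by simp
qed

text \<open>Constants cancel in the difference, leaving the factor \<open>r\<close>. With
  \<open>r = exp (- t)\<close> the rescaled flow does not increase cut distance between graphons on
  the same side.\<close>

lemma cut_dist_affine_le:
  assumes k: "U \<in> kernels M" "W \<in> kernels M" "U' \<in> kernels M" "W' \<in> kernels M"
    and ae: "AE z in M \<Otimes>\<^sub>M M. U' z = a + r * (U z - b)" "AE z in M \<Otimes>\<^sub>M M. W' z = a + r * (W z - b)"
    and r: "0 \<le> r" "r \<le> 1"
  shows "cut_dist M U' W' \<le> cut_dist M U W"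
proof (rule cut_dist_le)
  fix S T assume ST: "S \<in> sets M" "T \<in> sets M"
  have [measurable]: "U \<in> borel_measurable (M \<Otimes>\<^sub>M M)" "W \<in> borel_measurable (M \<Otimes>\<^sub>M M)"
    "U' \<in> borel_measurable (M \<Otimes>\<^sub>M M)" "W' \<in> borel_measurable (M \<Otimes>\<^sub>M M)"
    using k kernelsD(1) by auto
  note ST[measurable]
  have "(LINT z:S \<times> T|M \<Otimes>\<^sub>M M. U' z - W' z) = (LINT z:S \<times> T|M \<Otimes>\<^sub>M M. r * (U z - W z))"
    unfolding set_lebesgue_integral_def
  proof (rule integral_cong_AE)
    show "AE z in M \<Otimes>\<^sub>M M. indicator (S \<times> T) z *\<^sub>R (U' z - W' z) = indicator (S \<times> T) z *\<^sub>R (r * (U z - W z))"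
      using ae
    proof eventually_elim
      case (elim z)
      then have "U' z - W' z = r * (U z - W z)" by (simp add: algebra_simps)
      then show ?case by simp
    qed
  qed measurable
  also have "\<dots> = r * (LINT z:S \<times> T|M \<Otimes>\<^sub>M M. U z - W z)" by simp
  finally have "\<bar>LINT z:S \<times> T|M \<Otimes>\<^sub>M M. U' z - W' z\<bar> = r * \<bar>LINT z:S \<times> T|M \<Otimes>\<^sub>M M. U z - W z\<bar>"
    using r(1) by (simp add: abs_mult)
  also have "\<dots> \<le> 1 * \<bar>LINT z:S \<times> T|M \<Otimes>\<^sub>M M. U z - W z\<bar>" using r by (intro mult_right_mono) auto
  also have "\<dots> \<le> cut_dist M U W" using cut_integral_le_cut_dist[OF k(1,2) ST] by simp
  finally show "\<bar>LINT z:S \<times> T|M \<Otimes>\<^sub>M M. U' z - W' z\<bar> \<le> cut_dist M U W" .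
qed

lemma openin_cut_ball:
  assumes W: "W \<in> kernels M"
  shows "openin (cut_topology M) {U \<in> kernels M. cut_dist M U W < e}"
  unfolding openin_cut_topology
proof (intro conjI ballI)
  fix U assume U: "U \<in> {U \<in> kernels M. cut_dist M U W < e}"
  show "\<exists>\<epsilon>>0. \<forall>V\<in>kernels M. cut_dist M V U < \<epsilon> \<longrightarrow> V \<in> {U \<in> kernels M. cut_dist M U W < e}"
  proof (intro exI[of _ "e - cut_dist M U W"] conjI ballI impI)
    fix V assume "V \<in> kernels M" "cut_dist M V U < e - cut_dist M U W"
    then show "V \<in> {U \<in> kernels M. cut_dist M U W < e}"
      using cut_dist_triangle[of V U W] U W by simp
  qed (use U in simp)
qed simp

lemma openin_cut_integral:
  assumes "open A"
  shows "openin (cut_topology M) {U \<in> kernels M. (\<integral>z. U z \<partial>(M \<Otimes>\<^sub>M M)) \<in> A}"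
  unfolding openin_cut_topology
proof (intro conjI ballI)
  fix U assume U: "U \<in> {U \<in> kernels M. (\<integral>z. U z \<partial>(M \<Otimes>\<^sub>M M)) \<in> A}"
  then obtain e where e: "e > 0" "\<And>r. dist r (\<integral>z. U z \<partial>(M \<Otimes>\<^sub>M M)) < e \<Longrightarrow> r \<in> A"
    using assms unfolding open_dist by auto
  show "\<exists>\<epsilon>>0. \<forall>V\<in>kernels M. cut_dist M V U < \<epsilon> \<longrightarrow> V \<in> {U \<in> kernels M. (\<integral>z. U z \<partial>(M \<Otimes>\<^sub>M M)) \<in> A}"
  proof (intro exI[of _ e] conjI ballI impI)
    fix V assume V: "V \<in> kernels M" "cut_dist M V U < e"
    then have "(\<integral>z. V z \<partial>(M \<Otimes>\<^sub>M M)) \<in> A"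
      using integral_diff_le_cut_dist[of V U] U by (intro e(2)) (simp add: dist_real_def)
    then show "V \<in> {U \<in> kernels M. (\<integral>z. U z \<partial>(M \<Otimes>\<^sub>M M)) \<in> A}" using V by simp
  qed (rule e(1))
qed simp

subsection \<open>The rescaling core\<close>

lemma graphonsD:
  assumes "W \<in> graphons M"
  shows "W \<in> kernels M" "AE z in M \<Otimes>\<^sub>M M. 0 \<le> W z \<and> W z \<le> 1"
  using assms by (auto simp: graphons_def)

text \<open>The side of \<open>W\<close> is relatively open and consists of rescalable graphons, and
  on it the limit is a single affine map that does not increase cut distance.\<close>

lemma core_if_l1_norm_ne:
  assumes W: "W \<in> graphons M" and ne: "l1_norm M W \<noteq> 1 / 2"
  shows "W \<in> rescaling_core M extremist_rule"
proof -
  let ?B = "rescalable_set M extremist_rule"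
  define c where "c \<longleftrightarrow> l1_norm M W > 1 / 2"
  define A where "A = (if c then {1 / 2<..} else {..<1 / 2 :: real})"
  define N where "N = {U \<in> kernels M. (\<integral>z. U z \<partial>(M \<Otimes>\<^sub>M M)) \<in> A}"
  have "open A" by (simp add: A_def)
  then have N: "openin (cut_topology M) N" unfolding N_def by (rule openin_cut_integral)
  have NA: "U \<in> N \<longleftrightarrow> l1_norm M U \<in> A" if "U \<in> graphons M" for U
    using that graphonsD(1)[OF that] by (simp add: N_def l1_norm_graphon)
  have NB: "l1_norm M U \<noteq> 1 / 2" "c \<longleftrightarrow> l1_norm M U > 1 / 2" if "U \<in> N" "U \<in> graphons M" for U
    using that NA[OF that(2)] by (auto simp: A_def split: if_splits)
  have WN: "W \<in> N" using ne W by (simp add: NA A_def c_def)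
  have B_sub: "?B \<subseteq> graphons M" "graphons M \<subseteq> kernels M" by (auto simp: rescalable_set_def graphons_def)
  have WB: "W \<in> ?B" by (rule rescalable_extremist[OF W ne])
  have "W \<in> subtopology (cut_topology M) (graphons M) interior_of ?B"
    unfolding interior_of_def
  proof (intro CollectI exI[of _ "N \<inter> graphons M"] conjI)
    show "openin (subtopology (cut_topology M) (graphons M)) (N \<inter> graphons M)"
      using N by (auto simp: openin_subtopology)
    show "W \<in> N \<inter> graphons M" using WN W by simp
    show "N \<inter> graphons M \<subseteq> ?B" using NB(1) rescalable_extremist by blast
  qed
  moreover have "topcontinuous_at (subtopology (cut_topology M) ?B) (cut_topology M) (rescaled_flow M extremist_rule t) W"
    if t: "t \<ge> 0" for t
    unfolding topcontinuous_at_def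
  proof (intro conjI allI impI)
    let ?f = "rescaled_flow M extremist_rule t"
    have ts: "topspace (subtopology (cut_topology M) ?B) = ?B"
      using B_sub by (auto simp: topspace_cut_topology)
    show "W \<in> topspace (subtopology (cut_topology M) ?B)" using WB ts by simp
    show "?f \<in> topspace (subtopology (cut_topology M) ?B) \<rightarrow> topspace (cut_topology M)"
      unfolding ts topspace_cut_topology using rescaled_flow_in_kernels[OF _ t] by blast
    fix V assume V: "openin (cut_topology M) V \<and> ?f W \<in> V"
    then obtain e where e: "e > 0" "\<And>U. U \<in> kernels M \<Longrightarrow> cut_dist M U (?f W) < e \<Longrightarrow> U \<in> V"
      unfolding openin_cut_topology by blast
    have Wk: "W \<in> kernels M" by (rule graphonsD(1)[OF W])
    let ?G = "{U \<in> kernels M. cut_dist M U W < e}"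
    show "\<exists>U. openin (subtopology (cut_topology M) ?B) U \<and> W \<in> U \<and> (\<forall>y\<in>U. ?f y \<in> V)"
    \<comment> \<open>Intersecting the ball with \<open>N\<close> keeps neighbours on the side of
      \<open>W\<close>, where the same formula governs both limits.\<close>
    proof (intro exI[of _ "?G \<inter> N \<inter> ?B"] conjI ballI)
      show "openin (subtopology (cut_topology M) ?B) (?G \<inter> N \<inter> ?B)"
        unfolding openin_subtopology using openin_Int[OF openin_cut_ball[OF Wk] N] by blast
      have "cut_dist M W W \<le> 0" by (rule cut_dist_le_AE[OF Wk Wk]) auto
      then show "W \<in> ?G \<inter> N \<inter> ?B" using WN WB Wk e(1) by simp
      fix U assume U: "U \<in> ?G \<inter> N \<inter> ?B"
      then have Ug: "U \<in> graphons M" "U \<in> N" "U \<in> kernels M" using B_sub by auto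
      have f: "AE z in M \<Otimes>\<^sub>M M. ?f U z = of_bool c + exp (- t) * (U z - of_bool c)"
        "AE z in M \<Otimes>\<^sub>M M. ?f W z = of_bool c + exp (- t) * (W z - of_bool c)"
        using rescaled_flow_extremist[OF Ug(1) NB(1)[OF Ug(2,1)] t] rescaled_flow_extremist[OF W ne t]
        unfolding NB(2)[OF Ug(2,1), symmetric] c_def[symmetric] by blast+
      have kf: "?f U \<in> kernels M" "?f W \<in> kernels M"
        using U WB rescaled_flow_in_kernels[OF _ t] by auto
      have "cut_dist M (?f U) (?f W) \<le> cut_dist M U W"
        by (rule cut_dist_affine_le[OF Ug(3) Wk kf f]) (use t in auto)
      then show "?f U \<in> V" using U kf by (intro e(2)) auto
    qed
  qed
  ultimately show ?thesis by (simp add: rescaling_core_def)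
qed

text \<open>At density one half the two formulas for the limit, applied to small perturbations of the
  graphon upwards and downwards, force two different values of the total mass of the limit.\<close>

lemma l1_norm_ne_if_core:
  assumes core: "W \<in> rescaling_core M extremist_rule"
  shows "W \<in> graphons M \<and> l1_norm M W \<noteq> 1 / 2"
proof -
  let ?B = "rescalable_set M extremist_rule" and ?f = "rescaled_flow M extremist_rule 1"
  let ?I = "\<lambda>U. \<integral>z. U z \<partial>(M \<Otimes>\<^sub>M M)"
  have "W \<in> ?B" using core interior_of_subset by (fastforce simp: rescaling_core_def)
  then have W: "W \<in> graphons M" by (simp add: rescalable_set_def)
  note Wk = graphonsD[OF W]
  have cont: "topcontinuous_at (subtopology (cut_topology M) ?B) (cut_topology M) ?f W"
    using core by (simp add: rescaling_core_def)
  have "l1_norm M W \<noteq> 1 / 2"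
  proof
    assume half: "l1_norm M W = 1 / 2"
    \<comment> \<open>Continuity would put the two limiting masses within
      \<open>2 * \<epsilon> = (1 - exp (-1)) / 2\<close> of each other, while the formulas at time 1
      separate them by at least \<open>1 - exp (-1)\<close>.\<close>
    define \<epsilon> :: real where "\<epsilon> = (1 - exp (-1)) / 4"
    have \<epsilon>: "\<epsilon> > 0" by (simp add: \<epsilon>_def)
    \<comment> \<open>No formula is available for the limit at \<open>W\<close> itself, so its total
      mass serves as an unknown reference value.\<close>
    define V where "V = {U \<in> kernels M. ?I U \<in> ball (?I (?f W)) \<epsilon>}"
    have "openin (cut_topology M) V" unfolding V_def by (rule openin_cut_integral) simp
    moreover have "?f W \<in> V" using rescaled_flow_in_kernels[OF \<open>W \<in> ?B\<close>] \<epsilon> by (simp add: V_def)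
    ultimately obtain G where G: "openin (subtopology (cut_topology M) ?B) G" "W \<in> G" "\<And>U. U \<in> G \<Longrightarrow> ?f U \<in> V"
      using cont[unfolded topcontinuous_at_def, THEN conjunct2, THEN conjunct2, rule_format, of V] by blast
    then obtain T where T: "openin (cut_topology M) T" "G = T \<inter> ?B" unfolding openin_subtopology by blast
    then obtain d where d: "d > 0" "\<And>U. U \<in> kernels M \<Longrightarrow> cut_dist M U W < d \<Longrightarrow> U \<in> T"
      using G(2) unfolding openin_cut_topology by blast
    \<comment> \<open>Mixing weight: below 1 to give a convex combination with \<open>W\<close>, and
      below \<open>d\<close> to stay in the cut ball.\<close>
    define s where "s = min (1 / 2) (d / 2)"
    have s: "0 < s" "s < 1" "s < d" using d(1) by (auto simp: s_def)
    have IW: "?I W = 1 / 2" using half l1_norm_graphon[OF W] by simp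
    \<comment> \<open>Mixing \<open>W\<close> with the constant \<open>r\<close>: for
      \<open>r = 1\<close> the mass becomes (1 + s) / 2, for \<open>r = 0\<close> it becomes (1 - s)
      / 2, one on each side of one half. The term \<open>W z - 0\<close> fits the shape of
      \<open>kernel_affine\<close>.\<close>
    have *: "(\<lambda>z. r * s + (1 - s) * (W z - 0)) \<in> graphons M"
      "(\<lambda>z. r * s + (1 - s) * (W z - 0)) \<in> T" "?I (\<lambda>z. r * s + (1 - s) * (W z - 0)) = r * s + (1 - s) / 2"
      if r: "r = 0 \<or> r = 1" for r
    proof -
      let ?U = "\<lambda>z. r * s + (1 - s) * (W z - 0)"
      have Uk: "?U \<in> kernels M" by (rule kernel_affine[OF Wk(1)])
      have b: "0 \<le> r * s + (1 - s) * (v - 0) \<and> r * s + (1 - s) * (v - 0) \<le> 1 \<and> \<bar>r * s + (1 - s) * (v - 0) - v\<bar> \<le> s"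
        if v: "0 \<le> v \<and> v \<le> 1" for v
      proof -
        have "0 \<le> (1 - s) * v" "(1 - s) * v \<le> (1 - s) * 1" "0 \<le> s * v" "s * v \<le> s * 1"
          using v s by (auto intro!: mult_left_mono)
        then show ?thesis using r s by (auto simp: algebra_simps)
      qed
      have "AE z in M \<Otimes>\<^sub>M M. 0 \<le> ?U z \<and> ?U z \<le> 1" using Wk(2) by eventually_elim (use b in blast)
      then show "?U \<in> graphons M" using Uk unfolding graphons_def by blast
      have "AE z in M \<Otimes>\<^sub>M M. \<bar>?U z - W z\<bar> \<le> s" using Wk(2) by eventually_elim (use b in blast)
      then have "cut_dist M ?U W \<le> s" by (rule cut_dist_le_AE[OF Uk Wk(1)]) (use s in simp)
      then show "?U \<in> T" using Uk s by (intro d(2)) auto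
      have "?I ?U = r * s + (1 - s) * ?I W"
        using integrable_kernel[OF Wk(1)] prob_space.prob_space[OF prob_space_square] by simp
      then show "?I ?U = r * s + (1 - s) / 2" by (simp add: IW)
    qed
    have near: "\<bar>?I (?f U) - ?I (?f W)\<bar> < \<epsilon>" if "U \<in> graphons M" "U \<in> T" "l1_norm M U \<noteq> 1 / 2" for U
      using G(3)[of U] T(2) that rescalable_extremist by (auto simp: V_def dist_real_def abs_minus_commute)
    have If: "?I (?f U) = of_bool (?I U > 1 / 2) + exp (-1) * (?I U - of_bool (?I U > 1 / 2))"
      if U: "U \<in> graphons M" and ne: "?I U \<noteq> 1 / 2" for U
    proof -
      have ne': "l1_norm M U \<noteq> 1 / 2" using ne l1_norm_graphon[OF U] by simp
      have "?I (?f U) = ?I (\<lambda>z. of_bool (?I U > 1 / 2) + exp (-1) * (U z - of_bool (?I U > 1 / 2)))"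
      proof (rule integral_cong_AE)
        show "?f U \<in> borel_measurable (M \<Otimes>\<^sub>M M)"
          by (intro kernelsD(1) rescaled_flow_in_kernels rescalable_extremist U ne') simp
        show "(\<lambda>z. of_bool (?I U > 1 / 2) + exp (-1) * (U z - of_bool (?I U > 1 / 2))) \<in> borel_measurable (M \<Otimes>\<^sub>M M)"
          by (intro kernelsD(1) kernel_affine graphonsD(1) U)
        show "AE z in M \<Otimes>\<^sub>M M. ?f U z = of_bool (?I U > 1 / 2) + exp (-1) * (U z - of_bool (?I U > 1 / 2))"
          using rescaled_flow_extremist[OF U ne', of 1] unfolding l1_norm_graphon[OF U] by simp
      qed
      then show ?thesis
        using integrable_kernel[OF graphonsD(1)[OF U]] prob_space.prob_space[OF prob_space_square] by simp
    qed
    let ?U = "\<lambda>r z. r * s + (1 - s) * (W z - 0)"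
    have I1: "?I (?U 1) > 1 / 2" using *(3)[of 1] s by (simp add: field_simps)
    have I0: "?I (?U 0) < 1 / 2" using *(3)[of 0] s by (simp add: field_simps)
    have "\<bar>?I (?f (?U 1)) - ?I (?f W)\<bar> < \<epsilon>" "\<bar>?I (?f (?U 0)) - ?I (?f W)\<bar> < \<epsilon>"
      using near[of "?U 1"] near[of "?U 0"] *(1,2)[of 1] *(1,2)[of 0] I1 I0
      by (auto simp: l1_norm_graphon)
    moreover have "?I (?f (?U 1)) = 1 + exp (-1) * (?I (?U 1) - 1)"
      using If[of "?U 1"] *(1)[of 1] I1 by auto
    moreover have "?I (?f (?U 0)) = exp (-1) * ?I (?U 0)"
      using If[of "?U 0"] *(1)[of 0] I0 by auto
    moreover have "exp (-1) * (?I (?U 1) - 1) \<ge> exp (-1) * (- 1 / 2 :: real)" "exp (-1) * ?I (?U 0) \<le> exp (-1) * (1 / 2)"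
      using I1 I0 by (intro mult_left_mono; simp)+
    ultimately show False using \<epsilon> unfolding \<epsilon>_def by argo
  qed
  with W show ?thesis by simp
qed
end

theorem theorem7p7:
  fixes M :: "'a measure"
  assumes "prob_space M" and "atomless M" and "separable_sigma_algebra M"
  shows "rescaling_core M extremist_rule = {W \<in> graphons M. l1_norm M W \<noteq> 1 / 2} \<and>
    (\<forall>W\<in>graphons M.
       (l1_norm M W > 1 / 2 \<longrightarrow>
          (\<forall>t\<ge>0. AE z in M \<Otimes>\<^sub>M M.
             rescaled_flow M extremist_rule t W z = 1 - exp (- t) * (1 - W z))) \<and>
       (l1_norm M W < 1 / 2 \<longrightarrow>
          (\<forall>t\<ge>0. AE z in M \<Otimes>\<^sub>M M.
             rescaled_flow M extremist_rule t W z = exp (- t) * W z)))"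
proof -
  interpret graphon_space M using assms(1) by (simp add: graphon_space_def)
  show ?thesis
  proof (intro conjI ballI impI allI)
    show "rescaling_core M extremist_rule = {W \<in> graphons M. l1_norm M W \<noteq> 1 / 2}"
      using core_if_l1_norm_ne l1_norm_ne_if_core by blast
  next
    fix W and t :: real assume W: "W \<in> graphons M" and gt: "l1_norm M W > 1 / 2" and t: "t \<ge> 0"
    have "AE z in M \<Otimes>\<^sub>M M. rescaled_flow M extremist_rule t W z = 1 + exp (- t) * (W z - 1)"
      using rescaled_flow_extremist[OF W _ t] gt by simp
    then show "AE z in M \<Otimes>\<^sub>M M. rescaled_flow M extremist_rule t W z = 1 - exp (- t) * (1 - W z)"
      by eventually_elim (simp add: algebra_simps)
  next
    fix W and t :: real assume W: "W \<in> graphons M" and lt: "l1_norm M W < 1 / 2" and t: "t \<ge> 0"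
    then show "AE z in M \<Otimes>\<^sub>M M. rescaled_flow M extremist_rule t W z = exp (- t) * W z"
      using rescaled_flow_extremist[OF W _ t] by simp
  qed
qed

end
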